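(* Let $d>1$ be arbitrary. There exists a function $c\colon(0,1)\to(0,\infty)$ such that the following holds. Let $0<\varepsilon<1$. If $(A_n)_{n\in\mathbb N}$ is a (deterministic) sequence of real orthogonal $d\times d$ matrices, then for each $1\le j<d$, almost surely, $$\liminf_{n\to\infty}\frac1n\log\frac{s_j(A_\varepsilon^{(n)})}{s_{j+1}(A_\varepsilon^{(n)})}\ge c(\varepsilon).$$ Moreover, for any $\delta>0$, one has $c(\varepsilon)>\exp(-1/\varepsilon^{2+\delta})$ for all sufficiently small $\varepsilon>0$.
   Context: $s_1(M)\ge\dots\ge s_d(M)$ are the singular values of a $d\times d$ matrix $M$. $(\Xi_n)_{n\in\mathbb N}$ is a sequence of independent random $d\times d$ matrices, each with mutually independent entries uniformly distributed on $[-1,1]$. Given a fixed sequence $(A_n)$, set $A_{n,\varepsilon}=A_n+\varepsilon\Xi_n$ and $A_\varepsilon^{(n)}=A_{n,\varepsilon}A_{n-1,\varepsilon}\cdots A_{1,\varepsilon}$. "Almost surely" refers to the randomness of $(\Xi_n)$. With $d$ fixed, the constant $c(\varepsilon)$ depends only on $\varepsilon$, not on the sequence $(A_n)$. *)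

theory Defs
  imports
    "HOL-Probability.Probability"
    "HOL-Computational_Algebra.Polynomial"
begin

definition charpoly :: "real^'n^'n \<Rightarrow> real poly" where
  "charpoly M = det (\<chi> i j. (if i = j then [:0, 1:] else 0) - [:M $ i $ j:])"

(* Square roots of the eigenvalues of M^T M, repeated according to multiplicity and listed
   in decreasing order. Since M^T M is symmetric and positive semidefinite, its characteristic
   polynomial splits over the reals with nonnegative roots, so the list has length CARD('n). *)
definition singular_values :: "real^'n^'n \<Rightarrow> real list" where
  "singular_values M =
     rev (sorted_list_of_multiset (image_mset sqrt (proots (charpoly (transpose M ** M)))))"

(* The j-th largest singular value, counted from 1; meaningful for 1 \<le> j \<le> CARD('n). *)
definition singular_value :: "nat \<Rightarrow> real^'n^'n \<Rightarrow> real" where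
  "singular_value j M = singular_values M ! (j - 1)"

(* The sequence is indexed by the positive integers; \<Xi> 0 is unconstrained. *)
definition uniform_noise :: "'w measure \<Rightarrow> (nat \<Rightarrow> 'w \<Rightarrow> real^'n^'n) \<Rightarrow> bool" where
  "uniform_noise M \<Xi> \<longleftrightarrow>
     prob_space M \<and>
     prob_space.indep_vars M (\<lambda>_. borel) \<Xi> {1..} \<and>
     (\<forall>n\<ge>1. prob_space.indep_vars M (\<lambda>_. borel) (\<lambda>(i, j) \<omega>. \<Xi> n \<omega> $ i $ j) UNIV) \<and>
     (\<forall>n\<ge>1. \<forall>i j. distr M lborel (\<lambda>\<omega>. \<Xi> n \<omega> $ i $ j) = uniform_measure lborel {-1..1})"

fun perturbed_product ::
    "real \<Rightarrow> (nat \<Rightarrow> real^'n^'n) \<Rightarrow> (nat \<Rightarrow> real^'n^'n) \<Rightarrow> nat \<Rightarrow> real^'n^'n" where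
  "perturbed_product \<epsilon> A X 0 = mat 1"
| "perturbed_product \<epsilon> A X (Suc n) =
     (A (Suc n) + \<epsilon> *\<^sub>R X (Suc n)) ** perturbed_product \<epsilon> A X n"

end

theory Submission
  imports Defs
begin

text \<open>For a flag \<open>U \<subseteq> U' \<subseteq> U''\<close> of dimensions \<open>j - 1\<close>, \<open>j\<close>, \<open>j + 1\<close>, let \<open>P\<close> be the square root of
  \<open>v(j - 1) v(j + 1) / v(j)\<^sup>2\<close>, where \<open>v(i)\<close> is the factor by which the product of the first \<open>n\<close>
  matrices scales volume on the \<open>i\<close>-dimensional member of the flag. Up to a constant, \<open>P\<^sup>2\<close> bounds
  \<open>s(j + 1) / s(j)\<close> from above for one of finitely many coordinate pairs \<open>(U, U'')\<close>, chosen by greedy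
  column pivoting, and all \<open>U'\<close> between them. So it suffices that the expectation of \<open>P\<close>, averaged over
  \<open>U'\<close>, decays exponentially in \<open>n\<close>; the Borel-Cantelli argument then gives the almost sure bound.

  With \<open>U\<close> and \<open>U''\<close> fixed, \<open>U'\<close> ranges over a projective line, and a matrix \<open>g\<close> acts from the functions on
  the line over \<open>(g U, g U'')\<close> to those on the line over \<open>(U, U'')\<close>, by the factor \<open>P\<close> and composition.
  This action is unitary in \<open>L\<^sup>2\<close> because \<open>P\<^sup>2\<close> is the Jacobian of \<open>g\<close> on the line. A perturbed
  orthogonal matrix \<open>A + \<epsilon> \<Xi>\<close> has the same law, with probability \<open>2\<close> to the power \<open>-d\<^sup>2\<close>, as \<open>A + \<epsilon> \<Xi>/2\<close>
  composed on the right with a random one of four determinant one maps at distance of order \<open>\<epsilon>\<close> from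
  the identity which act on the plane \<open>U'' / U\<close> only. Averaging over these four maps has norm at most
  \<open>1 - c \<epsilon>\<^sup>2\<close> in \<open>L\<^sup>2\<close> of the line, by Schur's test. Hence one step multiplies the largest norm, over all
  \<open>(U, U'')\<close>, by at most \<open>1 - c' \<epsilon>\<^sup>2\<close>, and the theorem holds with a rate proportional to \<open>\<epsilon>\<^sup>2\<close>.\<close>

subsection \<open>Lebesgue measure under linear maps\<close>

text \<open>The matrices \<open>A n\<close> vary arbitrarily with n, so no stationary measure is
  available. What survives is a contraction in each single step, uniform over all flags and over the
  orthogonal matrix of that step. The exponent of P is forced by this: a function is transported
  with the factor P, and in the square norm \<open>P^2\<close> is exactly the Jacobian, so a
  deterministic factor costs nothing and every gain comes from the noise. Without noise there is no
  gain at all, and the gain is only quadratic in \<epsilon> because the four planar maps form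
  inverse pairs, whose linear effects cancel. A planar map at distance \<open>l - 1\<close> from the
  identity shifts the noise by an amount of order \<open>(l - 1) / \<epsilon>\<close>. Halving the
  cube leaves room for a shift of at most \<open>1/2\<close>, which dictates that
  \<open>l - 1\<close> be a small multiple of \<epsilon>. Functions on the projective line are
  represented by functions on the plane that are homogeneous of degree -1. The invariant integral
  then becomes a plain Lebesgue integral over an annulus, and a change of variables needs only the
  determinant of a two by two matrix.\<close>

lemma nn_integral_lborel_translate:
  fixes f :: "'a::euclidean_space \<Rightarrow> ennreal"
  assumes [measurable]: "f \<in> borel_measurable borel"
  shows "(\<integral>\<^sup>+x. f (c + x) \<partial>lborel) = (\<integral>\<^sup>+x. f x \<partial>lborel)"
proof -
  have "(\<integral>\<^sup>+x. f x \<partial>lborel) = (\<integral>\<^sup>+x. f x \<partial>distr lborel borel ((+) c))"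
    by (simp add: lborel_distr_plus)
  also have "\<dots> = (\<integral>\<^sup>+x. f (c + x) \<partial>lborel)"
    by (subst nn_integral_distr) auto
  finally show ?thesis by simp
qed

lemma nn_integral_lborel_scale:
  fixes f :: "'a::euclidean_space \<Rightarrow> ennreal"
  assumes [measurable]: "f \<in> borel_measurable borel" and "c > 0"
  shows "(\<integral>\<^sup>+x. f x \<partial>lborel) = ennreal (c ^ DIM('a)) * (\<integral>\<^sup>+x. f (c *\<^sub>R x) \<partial>lborel)"
proof -
  have "(\<integral>\<^sup>+x. f x \<partial>lborel) =
      (\<integral>\<^sup>+x. f x \<partial>density (distr lborel borel (\<lambda>x. 0 + c *\<^sub>R x)) (\<lambda>_. \<bar>c\<bar>^DIM('a)))"
    using lborel_affine[of c "0::'a"] assms by simp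
  also have "\<dots> = ennreal (c ^ DIM('a)) * (\<integral>\<^sup>+x. f (c *\<^sub>R x) \<partial>lborel)"
    using assms by (simp add: nn_integral_density nn_integral_distr nn_integral_cmult)
  finally show ?thesis .
qed

text \<open>Uniqueness of Haar measure, by Fubini with the indicator of a unit cube as second factor.\<close>

lemma nn_integral_lborel_linear:
  fixes T :: "'a::euclidean_space \<Rightarrow> 'a"
  assumes "linear T" "bij T"
  obtains c :: real where "c > 0"
    "\<And>f. f \<in> borel_measurable borel \<Longrightarrow> (\<integral>\<^sup>+x. f (T x) \<partial>lborel) = c * (\<integral>\<^sup>+x. f x \<partial>lborel)"
proof -
  define S where "S = inv T"
  have linS: "linear S"
    unfolding S_def using assms by (simp add: bij_is_inj inj_linear_imp_inv_linear)
  have TS [simp]: "T (S y) = y" for y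
    unfolding S_def using assms(2) by (simp add: bij_is_surj surj_f_inv_f)
  have ST [simp]: "S (T y) = y" for y
    unfolding S_def using assms(2) by (simp add: bij_is_inj)
  have [measurable]: "T \<in> borel_measurable borel" "S \<in> borel_measurable borel"
    using assms(1) linS
    by (auto intro!: borel_measurable_continuous_onI linear_continuous_on simp: linear_linear)
  define w :: "'a \<Rightarrow> ennreal" where "w = indicator (cbox 0 One)"
  have w1: "(\<integral>\<^sup>+x. w x \<partial>lborel) = 1"
    unfolding w_def by (simp add: emeasure_lborel_cbox_eq)
  have [measurable]: "w \<in> borel_measurable borel" unfolding w_def by measurable
  \<comment> \<open>What remains of the integral of \<open>w (y - T x)\<close> over x after x is
    shifted by \<open>S y\<close>; hence the minus sign.\<close>
  define C where "C = (\<integral>\<^sup>+x. w (T (- x)) \<partial>lborel)"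
  have key: "(\<integral>\<^sup>+x. f (T x) \<partial>lborel) = C * (\<integral>\<^sup>+x. f x \<partial>lborel)"
    if [measurable]: "f \<in> borel_measurable borel" for f
  proof -
    have "(\<integral>\<^sup>+x. f (T x) \<partial>lborel) = (\<integral>\<^sup>+y. (\<integral>\<^sup>+x. f (T x) \<partial>lborel) * w y \<partial>lborel)"
      by (simp add: nn_integral_cmult w1)
    also have "\<dots> = (\<integral>\<^sup>+y. (\<integral>\<^sup>+x. f (T x) * w y \<partial>lborel) \<partial>lborel)"
      by (simp add: nn_integral_multc)
    also have "\<dots> = (\<integral>\<^sup>+y. (\<integral>\<^sup>+x. f (T x + y) * w y \<partial>lborel) \<partial>lborel)"
    proof (rule nn_integral_cong)
      fix y
      have "(\<integral>\<^sup>+x. f (T (S y + x)) * w y \<partial>lborel) = (\<integral>\<^sup>+x. f (T x) * w y \<partial>lborel)"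
        by (rule nn_integral_lborel_translate) measurable
      then show "(\<integral>\<^sup>+x. f (T x) * w y \<partial>lborel) = (\<integral>\<^sup>+x. f (T x + y) * w y \<partial>lborel)"
        by (simp add: linear_add[OF assms(1)] add.commute)
    qed
    also have "\<dots> = (\<integral>\<^sup>+x. (\<integral>\<^sup>+y. f (T x + y) * w y \<partial>lborel) \<partial>lborel)"
      by (rule lborel_pair.Fubini') measurable
    also have "\<dots> = (\<integral>\<^sup>+x. (\<integral>\<^sup>+y. f y * w (y - T x) \<partial>lborel) \<partial>lborel)"
    proof (rule nn_integral_cong)
      fix x
      have "(\<integral>\<^sup>+y. f (T x + y) * w (T x + y - T x) \<partial>lborel) = (\<integral>\<^sup>+y. f y * w (y - T x) \<partial>lborel)"
        by (rule nn_integral_lborel_translate) measurable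
      then show "(\<integral>\<^sup>+y. f (T x + y) * w y \<partial>lborel) = (\<integral>\<^sup>+y. f y * w (y - T x) \<partial>lborel)"
        by simp
    qed
    also have "\<dots> = (\<integral>\<^sup>+y. (\<integral>\<^sup>+x. f y * w (y - T x) \<partial>lborel) \<partial>lborel)"
      by (rule lborel_pair.Fubini') measurable
    also have "\<dots> = (\<integral>\<^sup>+y. C * f y \<partial>lborel)"
    proof (rule nn_integral_cong)
      fix y
      have "(\<integral>\<^sup>+x. w (y - T (S y + x)) \<partial>lborel) = (\<integral>\<^sup>+x. w (y - T x) \<partial>lborel)"
        by (rule nn_integral_lborel_translate) measurable
      then have "(\<integral>\<^sup>+x. w (y - T x) \<partial>lborel) = C"
        unfolding C_def by (simp add: linear_add[OF assms(1)] linear_neg[OF assms(1)])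
      then show "(\<integral>\<^sup>+x. f y * w (y - T x) \<partial>lborel) = C * f y"
        by (simp add: nn_integral_cmult mult.commute)
    qed
    finally show ?thesis by (simp add: nn_integral_cmult)
  qed
  have "bounded (S ` cbox 0 One)"
    using linS by (intro bounded_linear_image bounded_cbox) (simp add: linear_linear)
  then obtain a where a: "S ` cbox 0 One \<subseteq> cball 0 a"
    using bounded_subset_ballD ball_subset_cball by (metis order_trans)
  have "w (T (- x)) \<le> indicator (cball 0 a) x" for x
  proof (cases "T (- x) \<in> cbox 0 One")
    case True
    then have "S (T (- x)) \<in> cball 0 a" using a by blast
    then show ?thesis by (simp add: w_def indicator_def)
  qed (simp add: w_def)
  then have "C \<le> (\<integral>\<^sup>+x. indicator (cball (0::'a) a) x \<partial>lborel)"
    unfolding C_def by (intro nn_integral_mono) auto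
  also have "\<dots> < \<infinity>"
    using emeasure_lborel_cball_finite[of "0::'a" a] by simp
  finally have fin: "C < \<infinity>" .
  have "C \<noteq> 0"
  proof
    assume "C = 0"
    then have "(\<integral>\<^sup>+(x::'a). 1 \<partial>lborel) = 0" using key[of "\<lambda>_. 1"] by simp
    then show False by simp
  qed
  with fin have "C = ennreal (enn2real C)" "enn2real C > 0"
    by (auto simp: enn2real_positive_iff zero_less_iff_neq_zero)
  with key that show ?thesis by metis
qed

text \<open>A linear map conjugate to its inverse has determinant of absolute value \<open>1\<close>.\<close>

lemma nn_integral_lborel_conj_inverse:
  fixes T :: "'a::euclidean_space \<Rightarrow> 'a"
  assumes "linear T" "linear S" "linear P" "\<And>x. T (S x) = x" "\<And>x. S (T x) = x"
    "\<And>x. P (P x) = x" "\<And>x. P (T (P x)) = S x"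
    and [measurable]: "f \<in> borel_measurable borel"
  shows "(\<integral>\<^sup>+x. f (T x) \<partial>lborel) = (\<integral>\<^sup>+x. f x \<partial>lborel)"
proof -
  have bij: "bij T" "bij S" "bij P"
    using assms(4-6) by (metis bijI')+
  have meas: "g \<in> borel_measurable borel" if "linear g" for g :: "'a \<Rightarrow> 'a"
    using that by (auto intro!: borel_measurable_continuous_onI linear_continuous_on simp: linear_linear)
  note [measurable] = meas[OF assms(1)] meas[OF assms(2)] meas[OF assms(3)]
  obtain t where t: "t > 0" "\<And>f. f \<in> borel_measurable borel \<Longrightarrow>
      (\<integral>\<^sup>+x. f (T x) \<partial>lborel) = ennreal t * (\<integral>\<^sup>+x. f x \<partial>lborel)"
    using nn_integral_lborel_linear[OF assms(1) bij(1)] by metis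
  obtain p where p: "p > 0" "\<And>f. f \<in> borel_measurable borel \<Longrightarrow>
      (\<integral>\<^sup>+x. f (P x) \<partial>lborel) = ennreal p * (\<integral>\<^sup>+x. f x \<partial>lborel)"
    using nn_integral_lborel_linear[OF assms(3) bij(3)] by metis
  define g :: "'a \<Rightarrow> ennreal" where "g = indicator (cbox 0 One)"
  have g1: "(\<integral>\<^sup>+x. g x \<partial>lborel) = 1"
    unfolding g_def by (simp add: emeasure_lborel_cbox_eq)
  have [measurable]: "g \<in> borel_measurable borel" unfolding g_def by measurable
  \<comment> \<open>\<open>S\<close> is rewritten as \<open>P T P\<close>. The factor t of
    \<open>T\<close> is picked up twice, while the factor p of \<open>P\<close> is absorbed when
    \<open>P\<close> is applied a second time, as \<open>P\<close> is an involution. This leaves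
    \<open>t * t = 1\<close>.\<close>
  have "1 = (\<integral>\<^sup>+x. g (S (T x)) \<partial>lborel)" using g1 assms(5) by simp
  also have "\<dots> = ennreal t * (\<integral>\<^sup>+x. g (P (T (P x))) \<partial>lborel)"
    by (subst t(2)) (auto simp: assms(7))
  also have "(\<integral>\<^sup>+x. g (P (T (P x))) \<partial>lborel) = ennreal p * (\<integral>\<^sup>+x. g (P (T x)) \<partial>lborel)"
    by (rule p(2)) measurable
  also have "(\<integral>\<^sup>+x. g (P (T x)) \<partial>lborel) = ennreal t * (\<integral>\<^sup>+x. g (P x) \<partial>lborel)"
    by (rule t(2)) measurable
  also have "ennreal p * (ennreal t * (\<integral>\<^sup>+x. g (P x) \<partial>lborel)) = ennreal t * (ennreal p * (\<integral>\<^sup>+x. g (P x) \<partial>lborel))"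
    by (simp add: mult_ac)
  also have "ennreal p * (\<integral>\<^sup>+x. g (P x) \<partial>lborel) = (\<integral>\<^sup>+x. g (P (P x)) \<partial>lborel)"
    by (rule p(2)[symmetric]) measurable
  also have "\<dots> = 1" using g1 assms(6) by simp
  finally have "ennreal (t * t) = ennreal 1" using t(1) by (simp add: ennreal_mult')
  then have "t * t = 1" using t(1) by (subst (asm) ennreal_inj) auto
  then have "t = 1" using t(1) by (metis abs_of_pos abs_square_eq_1 power2_eq_square)
  then show ?thesis using t(2) by simp
qed

subsection \<open>Homogeneous functions on the plane\<close>

text \<open>A fundamental domain for the dilations by powers of \<open>exp 1\<close>. The outer
  radius \<open>exp 1\<close> gives every ray logarithmic length one inside it, so no normalising
  constants appear.\<close>

definition annulus :: "(real^2) set" where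
  "annulus = {x. 1 \<le> norm x \<and> norm x \<le> exp 1}"

lemma annulus_borel [measurable]: "annulus \<in> sets borel"
  unfolding annulus_def by measurable

lemma annulus_radial:
  assumes "y \<noteq> 0"
  shows "(\<integral>\<^sup>+t. indicator annulus (exp t *\<^sub>R y) \<partial>lborel) = (1::ennreal)"
proof -
  have *: "0 < norm y" using assms by simp
  have "exp t *\<^sub>R y \<in> annulus \<longleftrightarrow> t \<in> {- ln (norm y)..1 - ln (norm y)}" for t
  proof -
    have "1 \<le> exp t * norm y \<longleftrightarrow> exp (- ln (norm y)) \<le> exp t"
      using * by (simp add: exp_minus divide_simps)
    moreover have "exp t * norm y \<le> exp 1 \<longleftrightarrow> exp t \<le> exp (1 - ln (norm y))"
      using * by (simp add: exp_diff divide_simps)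
    ultimately show ?thesis by (simp add: annulus_def)
  qed
  then have "(\<integral>\<^sup>+t. indicator annulus (exp t *\<^sub>R y) \<partial>lborel) =
      (\<integral>\<^sup>+t. indicator {- ln (norm y)..1 - ln (norm y)} t \<partial>lborel)"
    by (intro nn_integral_cong) (simp add: indicator_def)
  also have "\<dots> = 1" by simp
  finally show ?thesis .
qed

text \<open>Integrating over both the point and its dilation factor lets the two weights trade places.\<close>

lemma homogeneous_weight_change:
  fixes G w1 w2 :: "real^2 \<Rightarrow> ennreal"
  assumes [measurable]: "G \<in> borel_measurable borel" "w1 \<in> borel_measurable borel"
      "w2 \<in> borel_measurable borel"
    and hom: "\<And>r y. r > 0 \<Longrightarrow> ennreal (r\<^sup>2) * G (r *\<^sub>R y) = G y"
    and w1: "\<And>y. y \<noteq> 0 \<Longrightarrow> (\<integral>\<^sup>+t. w1 (exp t *\<^sub>R y) \<partial>lborel) = 1"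
    and w2: "\<And>y. y \<noteq> 0 \<Longrightarrow> (\<integral>\<^sup>+t. w2 (exp t *\<^sub>R y) \<partial>lborel) = 1"
  shows "(\<integral>\<^sup>+y. G y * w1 y \<partial>lborel) = (\<integral>\<^sup>+y. G y * w2 y \<partial>lborel)"
proof -
  have nz: "AE y in lborel. y \<noteq> (0::real^2)"
    by (rule AE_lborel_singleton)
  have "(\<integral>\<^sup>+y. G y * w1 y \<partial>lborel) =
      (\<integral>\<^sup>+y. G y * w1 y * (\<integral>\<^sup>+t. w2 (exp t *\<^sub>R y) \<partial>lborel) \<partial>lborel)"
    using nz by (intro nn_integral_cong_AE) (auto simp: w2)
  also have "\<dots> = (\<integral>\<^sup>+y. (\<integral>\<^sup>+t. G y * w1 y * w2 (exp t *\<^sub>R y) \<partial>lborel) \<partial>lborel)"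
    by (intro nn_integral_cong nn_integral_cmult[symmetric]) measurable
  also have "\<dots> = (\<integral>\<^sup>+t. (\<integral>\<^sup>+y. G y * w1 y * w2 (exp t *\<^sub>R y) \<partial>lborel) \<partial>lborel)"
    by (rule lborel_pair.Fubini') measurable
  also have "\<dots> = (\<integral>\<^sup>+t. (\<integral>\<^sup>+y. G y * w2 y * w1 (exp (-t) *\<^sub>R y) \<partial>lborel) \<partial>lborel)"
  proof (rule nn_integral_cong)
    fix t :: real
    \<comment> \<open>For fixed t the dilation by \<open>exp (-t)\<close> has Jacobian
      \<open>exp (-t) ^ 2\<close>, which is cancelled by the homogeneity of degree -2 of
      \<open>G\<close>; only the arguments of the two weights change.\<close>
    have "(\<integral>\<^sup>+y. G y * w1 y * w2 (exp t *\<^sub>R y) \<partial>lborel) = ennreal (exp (-t) ^ 2) *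
       (\<integral>\<^sup>+y. G (exp (-t) *\<^sub>R y) * w1 (exp (-t) *\<^sub>R y) * w2 (exp t *\<^sub>R exp (-t) *\<^sub>R y) \<partial>lborel)"
      using nn_integral_lborel_scale[of "\<lambda>y. G y * w1 y * w2 (exp t *\<^sub>R y)" "exp (-t)"] by simp
    also have "\<dots> = (\<integral>\<^sup>+y. ennreal (exp (-t) ^ 2) * (G (exp (-t) *\<^sub>R y) * w1 (exp (-t) *\<^sub>R y) * w2 y) \<partial>lborel)"
      by (subst nn_integral_cmult) (auto simp: exp_minus)
    also have "\<dots> = (\<integral>\<^sup>+y. (ennreal (exp (-t) ^ 2) * G (exp (-t) *\<^sub>R y)) * w2 y * w1 (exp (-t) *\<^sub>R y) \<partial>lborel)"
      by (simp add: mult_ac)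
    also have "\<dots> = (\<integral>\<^sup>+y. G y * w2 y * w1 (exp (-t) *\<^sub>R y) \<partial>lborel)"
      by (subst hom) auto
    finally show "(\<integral>\<^sup>+y. G y * w1 y * w2 (exp t *\<^sub>R y) \<partial>lborel) =
      (\<integral>\<^sup>+y. G y * w2 y * w1 (exp (-t) *\<^sub>R y) \<partial>lborel)" .
  qed
  also have "\<dots> = (\<integral>\<^sup>+y. (\<integral>\<^sup>+t. G y * w2 y * w1 (exp (-t) *\<^sub>R y) \<partial>lborel) \<partial>lborel)"
    by (rule lborel_pair.Fubini') measurable
  also have "\<dots> = (\<integral>\<^sup>+y. G y * w2 y * (\<integral>\<^sup>+t. w1 (exp (-t) *\<^sub>R y) \<partial>lborel) \<partial>lborel)"
    by (intro nn_integral_cong nn_integral_cmult) measurable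
  also have "\<dots> = (\<integral>\<^sup>+y. G y * w2 y * (\<integral>\<^sup>+t. w1 (exp t *\<^sub>R y) \<partial>lborel) \<partial>lborel)"
  proof (rule nn_integral_cong)
    fix y :: "real^2"
    have "(\<integral>\<^sup>+t. w1 (exp t *\<^sub>R y) \<partial>lborel) =
        (\<integral>\<^sup>+t. w1 (exp t *\<^sub>R y) \<partial>distr lborel borel uminus)"
      by (simp add: lborel_distr_uminus)
    also have "\<dots> = (\<integral>\<^sup>+t. w1 (exp (-t) *\<^sub>R y) \<partial>lborel)"
      by (subst nn_integral_distr) auto
    finally show "G y * w2 y * (\<integral>\<^sup>+t. w1 (exp (-t) *\<^sub>R y) \<partial>lborel) =
      G y * w2 y * (\<integral>\<^sup>+t. w1 (exp t *\<^sub>R y) \<partial>lborel)" by simp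
  qed
  also have "\<dots> = (\<integral>\<^sup>+y. G y * w2 y \<partial>lborel)"
    using nz by (intro nn_integral_cong_AE) (auto simp: w1)
  finally show ?thesis .
qed

lemma matrix_vector_mult_borel [measurable]: "(*v) (h :: real^'n^'m) \<in> borel_measurable borel"
  by (intro borel_measurable_continuous_onI) (auto intro!: linear_continuous_on simp: matrix_vector_mul_bounded_linear)

text \<open>Uniqueness of Haar measure leaves an unknown factor; it is read off from the image of
  the unit square, whose measure is \<open>\<bar>det h\<bar>\<close>.\<close>

lemma nn_integral_lborel_matrix2:
  fixes h :: "real^2^2"
  assumes "det h \<noteq> 0" and [measurable]: "f \<in> borel_measurable borel"
  shows "(\<integral>\<^sup>+x. f (h *v x) \<partial>lborel) * ennreal \<bar>det h\<bar> = (\<integral>\<^sup>+x. f x \<partial>lborel)"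
proof -
  have inv: "invertible h" using assms by (simp add: invertible_det_nz)
  then have bij: "bij ((*v) h)"
    by (simp add: invertible_eq_bij)
  obtain c where c: "c > 0" "\<And>f. f \<in> borel_measurable borel \<Longrightarrow>
      (\<integral>\<^sup>+x. f (h *v x) \<partial>lborel) = ennreal c * (\<integral>\<^sup>+x. f x \<partial>lborel)"
    using nn_integral_lborel_linear[OF matrix_vector_mul_linear bij] by metis
  define C where "C = cbox (0::real^2) One"
  have comp: "compact ((*v) h ` C)"
    unfolding C_def by (intro compact_continuous_image linear_continuous_on
        matrix_vector_mul_bounded_linear compact_cbox)
  have C1: "measure lebesgue C = 1" unfolding C_def by simp
  have "measure lebesgue ((*v) h ` C) = \<bar>det (matrix ((*v) h))\<bar> * measure lebesgue C"
    by (rule measure_linear_image) (auto simp: C_def)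
  then have m: "measure lborel ((*v) h ` C) = \<bar>det h\<bar>"
    using comp C1 by (simp add: matrix_of_matrix_vector_mul borel_compact measure_completion)
  have em: "emeasure lborel ((*v) h ` C) = ennreal \<bar>det h\<bar>"
    using m emeasure_bounded_finite[OF compact_imp_bounded[OF comp]] emeasure_eq_ennreal_measure[of lborel "(*v) h ` C"]
    by auto
  have [measurable]: "(*v) h ` C \<in> sets borel" using comp by (rule borel_compact)
  have "ennreal c * ennreal \<bar>det h\<bar> = ennreal c * (\<integral>\<^sup>+x. indicator ((*v) h ` C) x \<partial>lborel)"
    by (simp add: em)
  also have "\<dots> = (\<integral>\<^sup>+x. indicator ((*v) h ` C) (h *v x) \<partial>lborel)"
    by (rule c(2)[symmetric]) measurable
  also have "\<dots> = (\<integral>\<^sup>+x. indicator C x \<partial>lborel)"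
    using bij by (intro nn_integral_cong) (simp add: indicator_def inj_image_mem_iff bij_is_inj)
  also have "\<dots> = 1" by (simp add: C_def emeasure_lborel_cbox_eq)
  finally have cd: "ennreal c * ennreal \<bar>det h\<bar> = 1" .
  have "(\<integral>\<^sup>+x. f (h *v x) \<partial>lborel) * ennreal \<bar>det h\<bar> =
      (ennreal c * ennreal \<bar>det h\<bar>) * (\<integral>\<^sup>+x. f x \<partial>lborel)"
    by (subst c(2)) (auto simp: mult_ac)
  then show ?thesis by (simp add: cd)
qed

text \<open>For homogeneous functions of degree \<open>-2\<close> the integral over the annulus plays the role of the
  invariant integral over the projective line.\<close>

lemma annulus_integral_matrix2:
  fixes h :: "real^2^2" and G :: "real^2 \<Rightarrow> ennreal"
  assumes h: "det h \<noteq> 0" and [measurable]: "G \<in> borel_measurable borel"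
    and hom: "\<And>r y. r > 0 \<Longrightarrow> ennreal (r\<^sup>2) * G (r *\<^sub>R y) = G y"
  shows "(\<integral>\<^sup>+x. G (h *v x) * indicator annulus x \<partial>lborel) * ennreal \<bar>det h\<bar> =
    (\<integral>\<^sup>+x. G x * indicator annulus x \<partial>lborel)"
proof -
  have inv: "invertible h" using assms by (simp add: invertible_det_nz)
  then obtain k where k: "h ** k = mat 1" "k ** h = mat 1"
    by (auto simp: invertible_def)
  have kh: "k *v (h *v x) = x" "h *v (k *v x) = x" for x
    using k by (simp_all add: matrix_vector_mul_assoc)
  have "(\<integral>\<^sup>+x. G (h *v x) * indicator annulus (k *v (h *v x)) \<partial>lborel) * ennreal \<bar>det h\<bar> =
    (\<integral>\<^sup>+x. G x * indicator annulus (k *v x) \<partial>lborel)"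
    by (rule nn_integral_lborel_matrix2[OF h]) measurable
  \<comment> \<open>The substitution has deformed the annulus into its image under \<open>h\<close>,
    but every ray still meets that image in logarithmic length one, so it is an equally good
    weight.\<close>
  also have "\<dots> = (\<integral>\<^sup>+x. G x * indicator annulus x \<partial>lborel)"
  proof (rule homogeneous_weight_change)
    show "(\<integral>\<^sup>+t. indicator annulus (k *v exp t *\<^sub>R y) \<partial>lborel) = (1::ennreal)" if "y \<noteq> 0" for y
    proof -
      have "k *v y \<noteq> 0" using that kh(2)[of y] by auto
      then show ?thesis by (simp add: matrix_vector_mult_scaleR annulus_radial)
    qed
  qed (use hom annulus_radial in auto)
  finally show ?thesis by (simp add: kh)
qed

section \<open>Spectral gap for four hyperbolic matrices of the plane\<close>

lemma inverse_sqrt_upper: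
  fixes y :: real
  assumes "\<bar>y\<bar> \<le> 1/5"
  shows "1 / sqrt (1 + y) \<le> 1 - y/2 + 3/8 * y^2 - 5/16 * y^3 + y^4 / 2"
proof -
  define p where "p = 1 - y/2 + 3/8 * y^2 - 5/16 * y^3 + y^4 / 2"
  have b: "\<bar>y ^ k\<bar> \<le> (1/5) ^ k" for k
    using power_mono[OF assms, of k] by (simp add: power_abs)
  have "0 < p"
  proof -
    have "0 \<le> y^2" "0 \<le> y^4" "y \<le> 1/5" "y^3 \<le> 1/125"
      using b[of 1] b[of 3] by (simp_all add: abs_le_iff power_divide)
    then show ?thesis unfolding p_def by linarith
  qed
  have pos: "1 + y > 0" using assms by (simp add: abs_le_iff)
  \<comment> \<open>p is the Taylor polynomial of degree four of the inverse square root, with the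
    last coefficient raised from 35/128 to 1/2. The error in \<open>(1 + y) * p^2\<close> therefore
    starts with the positive term \<open>29/64 * y^4\<close>, which dominates for small y.\<close>
  have "(1 + y) * p^2 = 1 + (y^2)^2 * (29/64 + 23/32*y - 67/256*y^2 + 41/256*y^3 - y^4/16 + y^5/4)"
    unfolding p_def by (simp add: field_simps power2_eq_square power3_eq_cube eval_nat_numeral)
  moreover have "0 \<le> 29/64 + 23/32*y - 67/256*y^2 + 41/256*y^3 - y^4/16 + y^5/4"
    using b[of 1] b[of 2] b[of 3] b[of 4] b[of 5] by (simp add: abs_le_iff power_divide)
  ultimately have "1 \<le> (1 + y) * p^2" by simp
  then have "1 \<le> sqrt ((1 + y) * p^2)" by simp
  also have "\<dots> = sqrt (1 + y) * p" using \<open>0 < p\<close> by (simp add: real_sqrt_mult)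
  finally show ?thesis unfolding p_def[symmetric] using pos by (simp add: divide_simps mult.commute)
qed

text \<open>With \<open>t = S / C\<close>, odd powers of t cancel within each pair of opposite
  signs, and \<open>u^2 + v^2 = 1\<close> makes the quadratic term \<open>3/4 * t^2\<close>
  independent of the direction. The common factor \<open>1 / sqrt C\<close> lowers the main term 4
  by \<open>t^2\<close>, which outweighs it; half of the surplus \<open>t^2 / 4\<close> is given up
  to the quartic terms.\<close>

lemma four_direction_average:
  fixes C S u v :: real
  assumes C: "C > 0" and CS: "C^2 - S^2 = 1" and small: "0 \<le> S / C" "S / C \<le> 1/5" and uv: "u^2 + v^2 = 1"
  shows "1 / sqrt (C + S * u) + 1 / sqrt (C - S * u) + 1 / sqrt (C + S * v) + 1 / sqrt (C - S * v)
     \<le> 4 - (S/C)^2 / 8"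
proof -
  define t where "t = S / C"
  have t: "0 \<le> t" "t \<le> 1/5" using small by (auto simp: t_def)
  have pair: "1 / sqrt (C + S * z) + 1 / sqrt (C - S * z) \<le> (1 / sqrt C) * (2 + 3/4 * t^2 * z^2 + t^4 * z^4)"
    if z: "z^2 \<le> 1" for z
  proof -
    have "\<bar>z\<bar> \<le> 1" using z by (simp add: abs_square_le_1)
    then have tz: "\<bar>t * z\<bar> \<le> 1/5" using t mult_mono[of "\<bar>t\<bar>" "1/5" "\<bar>z\<bar>" 1] by (simp add: abs_mult)
    have e: "C + S * z = C * (1 + t * z)" "C - S * z = C * (1 + - (t * z))"
      using C by (simp_all add: t_def field_simps)
    have "1 / sqrt (1 + t * z) + 1 / sqrt (1 + - (t * z)) \<le> 2 + 3/4 * t^2 * z^2 + t^4 * z^4"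
      using inverse_sqrt_upper[OF tz] inverse_sqrt_upper[of "- (t * z)"] tz
      by (simp add: power_mult_distrib)
    then have "(1 / sqrt C) * (1 / sqrt (1 + t * z) + 1 / sqrt (1 + - (t * z))) \<le>
       (1 / sqrt C) * (2 + 3/4 * t^2 * z^2 + t^4 * z^4)"
      using C by (intro mult_left_mono) auto
    then show ?thesis unfolding e real_sqrt_mult by (simp only: distrib_left times_divide_times_eq mult_1)
  qed
  have u2: "u^2 \<le> 1" and v2: "v^2 \<le> 1"
    using uv zero_le_power2[of u] zero_le_power2[of v] by linarith+
  have "u^4 \<le> u^2" "v^4 \<le> v^2"
    using mult_left_mono[OF u2, of "u^2"] mult_left_mono[OF v2, of "v^2"]
    by (simp_all add: power_add[symmetric])
  with uv have uv4: "u^4 + v^4 \<le> 1" by linarith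
  have t2: "t^2 \<le> 1/25" using power_mono[OF t(2,1), of 2] by (simp add: power_divide)
  have "1 / sqrt (C + S * u) + 1 / sqrt (C - S * u) + 1 / sqrt (C + S * v) + 1 / sqrt (C - S * v)
     \<le> (1 / sqrt C) * (2 + 3/4 * t^2 * u^2 + t^4 * u^4) + (1 / sqrt C) * (2 + 3/4 * t^2 * v^2 + t^4 * v^4)"
    using pair[OF u2] pair[OF v2] by linarith
  also have "\<dots> = (1 / sqrt C) * (4 + 3/4 * t^2 * (u^2 + v^2) + t^4 * (u^4 + v^4))"
    by (simp add: algebra_simps)
  also have "\<dots> \<le> (1 / sqrt C) * (4 + 3/4 * t^2 + t^4)"
    using uv mult_left_mono[OF uv4, of "t^4"] C by (intro mult_left_mono) auto
  also have "\<dots> \<le> (1 - t^2 / 4) * (4 + 3/4 * t^2 + t^4)"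
  proof (rule mult_right_mono)
    \<comment> \<open>Thus \<open>1 / sqrt C\<close> is the fourth root of \<open>1 - t^2\<close>,
      and Bernoulli's inequality compares this with \<open>1 - t^2/4\<close>.\<close>
    have "1 - t^2 = (1 / C)^2"
    proof -
      have "1 - t^2 = (C^2 - S^2) / C^2" using C by (simp add: t_def field_simps)
      then show ?thesis by (simp add: CS power_divide)
    qed
    also have "\<dots> = (1 / sqrt C)^4"
      using C by (simp add: power_divide power4_eq_xxxx power2_eq_square)
    finally have "(1 / sqrt C)^4 = 1 - t^2" by simp
    also have "\<dots> \<le> (1 - t^2/4)^4"
      using Bernoulli_inequality[of "- (t^2/4)" 4] t2 by simp
    finally have "(1 / sqrt C)^4 \<le> (1 - t^2/4)^4" .
    moreover have "0 \<le> 1 - t^2/4" using t2 by simp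
    ultimately show "1 / sqrt C \<le> 1 - t^2/4"
      using power_strict_mono[of "1 - t^2/4" "1 / sqrt C" 4] by linarith
  qed (use t in auto)
  also have "\<dots> = 4 - t^2 / 4 + t^2 * (13/16 * t^2) - t^6 / 4"
  proof -
    have "(1 - a / 4) * (4 + 3/4 * a + a^2) = 4 - a / 4 + a * (13/16 * a) - a^3 / 4" for a :: real
      by (simp add: field_simps power2_eq_square power3_eq_cube)
    from this[of "t^2"] show ?thesis by (simp add: power_mult[symmetric])
  qed
  also have "\<dots> \<le> 4 - t^2 / 8"
  proof -
    have "t^2 * (13/16 * t^2) \<le> t^2 * (1/8)" using t2 by (intro mult_left_mono) auto
    moreover have "0 \<le> t^6" using t by simp
    ultimately show ?thesis by linarith
  qed
  finally show ?thesis by (simp add: t_def)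
qed

text \<open>The contracting directions are spaced by 45 degrees. The first two matrices alone would not do:
  the average of \<open>1 / norm (hyp l i *v x)\<close> over them exceeds \<open>1\<close> at \<open>x = axis 1 1\<close>. The family of all
  four is closed under inversion.\<close>

definition hyp :: "real \<Rightarrow> nat \<Rightarrow> real^2^2" where
  "hyp l i = (if i = 0 then vector [vector [l, 0], vector [0, 1/l]]
    else if i = 1 then vector [vector [1/l, 0], vector [0, l]]
    else if i = 2 then vector [vector [(l + 1/l)/2, (l - 1/l)/2], vector [(l - 1/l)/2, (l + 1/l)/2]]
    else vector [vector [(l + 1/l)/2, - (l - 1/l)/2], vector [- (l - 1/l)/2, (l + 1/l)/2]])"

text \<open>For indices below 4, the index of the inverse matrix within the family
  \<open>hyp l\<close>.\<close>

definition flip :: "nat \<Rightarrow> nat" where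
  "flip i = (if i = 0 then 1 else if i = 1 then 0 else if i = 2 then 3 else 2)"

lemma lessThan_4: "{..<4::nat} = {0, 1, 2, 3}" by auto

lemma det_hyp: "l > 0 \<Longrightarrow> det (hyp l i) = 1"
  by (simp add: det_2 hyp_def field_simps) 

lemma hyp_flip:
  assumes "l > 0" "i < 4" shows "hyp l (flip i) *v (hyp l i *v x) = x"
proof -
  define m where "m = 1 / l"
  have lm: "l * m = 1" using assms by (simp add: m_def)
  define p q where "p = (l + m) / 2" and "q = (l - m) / 2"
  have "p * p - q * q = l * m" by (simp add: p_def q_def field_simps)
  then have pq: "p * p - q * q = 1" using lm by simp
  have h: "hyp l 2 = vector [vector [p, q], vector [q, p]]"
    "hyp l 3 = vector [vector [p, - q], vector [- q, p]]"
    by (simp_all add: hyp_def p_def q_def m_def minus_divide_left)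
  have e: "p * (p * a + q * b) - q * (q * a + p * b) = a" for a b
    using pq by algebra
  have e': "p * (p * a - q * b) + q * (p * b - q * a) = a" for a b
    using pq by algebra
  have "i \<in> {0, 1, 2, 3}" using assms(2) lessThan_4 by blast
  then consider "i = 0" | "i = 1" | "i = 2" | "i = 3" by blast
  then show ?thesis
  proof cases
    case 1
    then show ?thesis using assms by (simp add: vec_eq_iff forall_2 hyp_def flip_def matrix_vector_mult_def sum_2)
  next
    case 2
    then show ?thesis using assms by (simp add: vec_eq_iff forall_2 hyp_def flip_def matrix_vector_mult_def sum_2)
  next
    case 3
    then show ?thesis using e[of "x$1" "x$2"] e[of "x$2" "x$1"]
      by (simp add: vec_eq_iff forall_2 h flip_def matrix_vector_mult_def sum_2 add.commute)
  next
    case 4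
    then show ?thesis using e'[of "x$1" "x$2"] e'[of "x$2" "x$1"]
      by (simp add: vec_eq_iff forall_2 h flip_def matrix_vector_mult_def sum_2 add.commute)
  qed
qed

lemma hyp_inj:
  assumes "l > 0" "i < 4" "x \<noteq> 0" shows "hyp l i *v x \<noteq> 0"
  using hyp_flip[OF assms(1,2), of x] assms(3) by auto

text \<open>Here C and S are the hyperbolic cosine and sine of \<open>2 * ln l\<close>. For x at
  angle a, the two quadratic expressions in the coordinates are \<open>(norm x)^2\<close> times the
  cosine and the sine of 2a, which is why the four directions reduce to a pair u, v on the unit
  circle.\<close>

lemma norm_hyp:
  fixes x :: "real^2"
  assumes "l > 0"
  defines "C \<equiv> (l^2 + 1/l^2)/2" and "S \<equiv> (l^2 - 1/l^2)/2"
  shows "norm (hyp l 0 *v x) = sqrt (C * (norm x)\<^sup>2 + S * ((x$1)\<^sup>2 - (x$2)\<^sup>2))"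
    "norm (hyp l 1 *v x) = sqrt (C * (norm x)\<^sup>2 - S * ((x$1)\<^sup>2 - (x$2)\<^sup>2))"
    "norm (hyp l 2 *v x) = sqrt (C * (norm x)\<^sup>2 + S * (2 * x$1 * x$2))"
    "norm (hyp l 3 *v x) = sqrt (C * (norm x)\<^sup>2 - S * (2 * x$1 * x$2))"
proof -
  define m where "m = 1 / l"
  have lm: "l * m = 1" using assms by (simp add: m_def)
  have CS: "C = (l^2 + m^2)/2" "S = (l^2 - m^2)/2"
    by (simp_all add: C_def S_def m_def power_divide)
  have n2: "(norm x)\<^sup>2 = (x$1)\<^sup>2 + (x$2)\<^sup>2"
    unfolding norm_vec_def L2_set_def by (simp add: sum_2)
  have nv: "norm y = sqrt ((y$1)\<^sup>2 + (y$2)\<^sup>2)" for y :: "real^2"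
    unfolding norm_vec_def L2_set_def by (simp add: sum_2)
  show "norm (hyp l 0 *v x) = sqrt (C * (norm x)\<^sup>2 + S * ((x$1)\<^sup>2 - (x$2)\<^sup>2))"
    unfolding nv[of "hyp l 0 *v x"] n2 CS
    by (simp add: hyp_def matrix_vector_mult_def sum_2 m_def[symmetric] m_def[symmetric, simplified divide_inverse mult_1])
       (simp add: m_def field_simps power2_eq_square)
  show "norm (hyp l 1 *v x) = sqrt (C * (norm x)\<^sup>2 - S * ((x$1)\<^sup>2 - (x$2)\<^sup>2))"
    unfolding nv[of "hyp l 1 *v x"] n2 CS
    by (simp add: hyp_def matrix_vector_mult_def sum_2 m_def[symmetric])
       (simp add: m_def field_simps power2_eq_square)
  show "norm (hyp l 2 *v x) = sqrt (C * (norm x)\<^sup>2 + S * (2 * x$1 * x$2))"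
    unfolding nv[of "hyp l 2 *v x"] n2 CS
    by (simp add: hyp_def matrix_vector_mult_def sum_2 m_def[symmetric])
       (simp add: field_simps power2_eq_square)
  show "norm (hyp l 3 *v x) = sqrt (C * (norm x)\<^sup>2 - S * (2 * x$1 * x$2))"
    unfolding nv[of "hyp l 3 *v x"] n2 CS
    by (simp add: hyp_def matrix_vector_mult_def sum_2 m_def[symmetric])
       (simp add: field_simps power2_eq_square)
qed

text \<open>\<open>S / C\<close> equals \<open>(l^4 - 1) / (l^4 + 1)\<close>. The bound
  \<open>13/12\<close> on l keeps this below 1/5, as the Taylor estimate requires, and Bernoulli's
  inequality bounds it below by \<open>l - 1\<close>.\<close>

lemma sum_inverse_norm_hyp:
  fixes x :: "real^2"
  assumes l: "1 \<le> l" "l \<le> 13/12" and x: "x \<noteq> 0"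
  shows "(\<Sum>i<4. 1 / norm (hyp l i *v x)) \<le> (4 - (l - 1)^2 / 8) / norm x"
proof -
  define C S where "C = (l^2 + 1/l^2)/2" and "S = (l^2 - 1/l^2)/2"
  define n where "n = norm x"
  define u v where "u = ((x$1)\<^sup>2 - (x$2)\<^sup>2) / n^2" and "v = (2 * x$1 * x$2) / n^2"
  have n: "n > 0" using x by (simp add: n_def)
  have n2: "n^2 = (x$1)\<^sup>2 + (x$2)\<^sup>2"
    unfolding n_def norm_vec_def L2_set_def by (simp add: sum_2)
  have lp: "l > 0" using l by simp
  have l4: "1 \<le> l^4" "l^4 \<le> 7/5"
    using power_mono[OF l(2), of 4] l one_le_power[of l 4] by (simp_all add: power_divide)
  have CS: "C^2 - S^2 = 1" "C > 0"
    using lp by (simp_all add: C_def S_def field_simps power2_eq_square add_pos_pos)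
  have SC: "S / C = (l^4 - 1) / (l^4 + 1)"
  proof -
    have "S = (l^4 - 1) / (2 * l^2)" "C = (l^4 + 1) / (2 * l^2)"
      using lp by (simp_all add: S_def C_def field_simps eval_nat_numeral)
    then show ?thesis using lp by simp
  qed
  have SC5: "0 \<le> S / C" "S / C \<le> 1/5"
    unfolding SC using l4 by (simp_all add: field_simps)
  have "4 * (l - 1) \<le> l^4 - 1"
    using Bernoulli_inequality[of "l - 1" 4] l by simp
  then have "(l - 1) * (l^4 + 1) \<le> l^4 - 1"
    using mult_left_mono[of "l^4 + 1" 4 "l - 1"] l4 l by linarith
  then have SCl: "l - 1 \<le> S / C"
    unfolding SC using l4 by (subst pos_le_divide_eq) linarith+
  have uv: "u^2 + v^2 = 1"
  proof -
    have "((x$1)\<^sup>2 - (x$2)\<^sup>2)^2 + (2 * x$1 * x$2)^2 = (n^2)^2"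
      unfolding n2 by (simp add: power2_eq_square algebra_simps)
    then show ?thesis using n by (simp add: u_def v_def power_divide add_divide_distrib[symmetric])
  qed
  have e: "norm (hyp l 0 *v x) = n * sqrt (C + S * u)"
    "norm (hyp l 1 *v x) = n * sqrt (C - S * u)"
    "norm (hyp l 2 *v x) = n * sqrt (C + S * v)"
    "norm (hyp l 3 *v x) = n * sqrt (C - S * v)"
  proof -
    have r: "n * sqrt z = sqrt (z * n^2)" for z using n by (simp add: real_sqrt_mult)
    have "(C + S * u) * n^2 = C * n^2 + S * ((x$1)\<^sup>2 - (x$2)\<^sup>2)"
      "(C - S * u) * n^2 = C * n^2 - S * ((x$1)\<^sup>2 - (x$2)\<^sup>2)"
      "(C + S * v) * n^2 = C * n^2 + S * (2 * x$1 * x$2)"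
      "(C - S * v) * n^2 = C * n^2 - S * (2 * x$1 * x$2)"
      using n by (simp_all add: u_def v_def field_simps)
    then show "norm (hyp l 0 *v x) = n * sqrt (C + S * u)"
    "norm (hyp l 1 *v x) = n * sqrt (C - S * u)"
    "norm (hyp l 2 *v x) = n * sqrt (C + S * v)"
    "norm (hyp l 3 *v x) = n * sqrt (C - S * v)"
      unfolding r norm_hyp[OF lp] C_def[symmetric] S_def[symmetric] n_def[symmetric] by simp_all
  qed
  have "(\<Sum>i<4. 1 / norm (hyp l i *v x)) =
     (1 / sqrt (C + S * u) + 1 / sqrt (C - S * u) + 1 / sqrt (C + S * v) + 1 / sqrt (C - S * v)) / n"
    unfolding lessThan_4 using e by (simp add: add_divide_distrib mult.commute)
  also have "\<dots> \<le> (4 - (S/C)^2 / 8) / n"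
    using n four_direction_average[OF CS(2,1) SC5 uv] by (simp add: divide_right_mono)
  also have "\<dots> \<le> (4 - (l - 1)^2 / 8) / n"
    using n SCl l by (intro divide_right_mono diff_left_mono power_mono) auto
  finally show ?thesis unfolding n_def .
qed

text \<open>Schur's test for the average of the four hyperbolic matrices acting on homogeneous functions
  of degree \<open>-1\<close>, with test function \<open>1 / norm x\<close>.\<close>

lemma hyp_contraction:
  fixes F :: "real^2 \<Rightarrow> ennreal"
  assumes l: "1 \<le> l" "l \<le> 13/12" and [measurable]: "F \<in> borel_measurable borel"
    and hom: "\<And>r y. r > 0 \<Longrightarrow> ennreal r * F (r *\<^sub>R y) = F y"
  shows "(\<integral>\<^sup>+x. (\<Sum>i<4. F (hyp l i *v x))\<^sup>2 * indicator annulus x \<partial>lborel) \<le>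
    ennreal ((4 - (l - 1)^2 / 8)^2) * (\<integral>\<^sup>+x. (F x)\<^sup>2 * indicator annulus x \<partial>lborel)"
proof -
  define p where "p = 4 - (l - 1)^2 / 8"
  have lp: "l > 0" using l by simp
  have "(l - 1)^2 \<le> 1" using l by (simp add: abs_square_le_1)
  then have p: "p > 0" unfolding p_def by simp
  \<comment> \<open>At \<open>y = hyp l i *v x\<close> the weight is
    \<open>norm (hyp l i *v x) / norm x\<close>. Writing it in terms of y makes \<open>G i\<close>
    homogeneous of degree -2, so that the determinant one change of variables applies to each
    i.\<close>
  define G where "G i y = ennreal (norm y / norm (hyp l (flip i) *v y)) * (F y)\<^sup>2" for i y
  have [measurable]: "G i \<in> borel_measurable borel" for i unfolding G_def by measurable
  have pw: "(\<Sum>i<4. F (hyp l i *v x))\<^sup>2 \<le> ennreal p * (\<Sum>i<4. G i (hyp l i *v x))" if x: "x \<noteq> 0" for x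
  proof -
    define N where "N i = norm (hyp l i *v x)" for i
    have N: "N i > 0" if "i < 4" for i using hyp_inj[OF lp that x] by (simp add: N_def)
    \<comment> \<open>The Schur weights: the sum of the \<open>1 / N i\<close> is the quantity
      bounded by \<open>sum_inverse_norm_hyp\<close>.\<close>
    have split: "ennreal (sqrt (1 / N i)) * (ennreal (sqrt (N i)) * z) = z" if "i < 4" for i z
      using N[OF that] by (simp add: mult.assoc[symmetric] ennreal_mult'[symmetric] real_sqrt_mult[symmetric])
    have sq: "ennreal (sqrt a) ^ 2 = ennreal a" if "a \<ge> 0" for a
      using that by (simp add: ennreal_power)
    have "(\<Sum>i<4. F (hyp l i *v x))\<^sup>2 =
       (\<integral>\<^sup>+i. ennreal (sqrt (1 / N i)) * (ennreal (sqrt (N i)) * F (hyp l i *v x)) \<partial>count_space {..<4})\<^sup>2"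
      by (simp add: nn_integral_count_space_finite split)
    also have "\<dots> \<le> (\<integral>\<^sup>+i. ennreal (sqrt (1 / N i)) ^ 2 \<partial>count_space {..<4}) *
       (\<integral>\<^sup>+i. (ennreal (sqrt (N i)) * F (hyp l i *v x)) ^ 2 \<partial>count_space {..<4})"
      by (rule Cauchy_Schwarz_nn_integral) auto
    also have "\<dots> = (\<Sum>i<4. ennreal (1 / N i)) * (\<Sum>i<4. ennreal (N i) * (F (hyp l i *v x))\<^sup>2)"
      using N by (simp add: nn_integral_count_space_finite power_mult_distrib sq N_def)
    also have "(\<Sum>i<4. ennreal (1 / N i)) = ennreal (\<Sum>i<4. 1 / N i)"
      by (rule sum_ennreal) (simp add: N_def)
    also have "\<dots> \<le> ennreal (p / norm x)"
      using sum_inverse_norm_hyp[OF l x] by (intro ennreal_leI) (simp add: N_def p_def)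
    also have "ennreal (p / norm x) * (\<Sum>i<4. ennreal (N i) * (F (hyp l i *v x))\<^sup>2) =
      ennreal p * (\<Sum>i<4. G i (hyp l i *v x))"
    proof -
      have "ennreal (p / norm x) * (ennreal (N i) * z) = ennreal p * (ennreal (N i / norm x) * z)" for i z
        using p by (simp add: mult.assoc[symmetric] ennreal_mult'[symmetric] N_def)
      then show ?thesis
        by (simp add: sum_distrib_left G_def hyp_flip[OF lp] N_def)
    qed
    finally show ?thesis by (simp add: mult_right_mono)
  qed
  have nz: "AE x in lborel. x \<noteq> (0::real^2)"
    by (rule AE_lborel_singleton)
  have "(\<integral>\<^sup>+x. (\<Sum>i<4. F (hyp l i *v x))\<^sup>2 * indicator annulus x \<partial>lborel) \<le>
     (\<integral>\<^sup>+x. ennreal p * (\<Sum>i<4. G i (hyp l i *v x) * indicator annulus x) \<partial>lborel)"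
  proof (rule nn_integral_mono_AE, use nz in eventually_elim)
    case (elim x)
    show ?case using mult_right_mono[OF pw[OF elim], of "indicator annulus x"]
      by (simp add: sum_distrib_right mult.assoc)
  qed
  also have "\<dots> = ennreal p * (\<Sum>i<4. (\<integral>\<^sup>+x. G i (hyp l i *v x) * indicator annulus x \<partial>lborel))"
    by (subst nn_integral_cmult, measurable) (subst nn_integral_sum, measurable)
  also have "\<dots> = ennreal p * (\<Sum>i<4. (\<integral>\<^sup>+x. G i x * indicator annulus x \<partial>lborel))"
  proof -
    have "(\<integral>\<^sup>+x. G i (hyp l i *v x) * indicator annulus x \<partial>lborel) =
       (\<integral>\<^sup>+x. G i x * indicator annulus x \<partial>lborel)" for i
    proof -
      have "ennreal (r\<^sup>2) * G i (r *\<^sub>R y) = G i y" if "r > 0" for r y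
      proof -
        have "G i y = ennreal (norm y / norm (hyp l (flip i) *v y)) * (ennreal r * F (r *\<^sub>R y))\<^sup>2"
          by (simp add: hom[OF that] G_def)
        also have "\<dots> = ennreal (r\<^sup>2) * G i (r *\<^sub>R y)"
          using that by (simp add: G_def matrix_vector_mult_scaleR power_mult_distrib ennreal_power mult_ac)
        finally show ?thesis by simp
      qed
      then show ?thesis using annulus_integral_matrix2[of "hyp l i" "G i"] by (simp add: det_hyp[OF lp])
    qed
    then show ?thesis by simp
  qed
  also have "\<dots> = ennreal p * (\<integral>\<^sup>+x. (\<Sum>i<4. G i x) * indicator annulus x \<partial>lborel)"
    by (subst nn_integral_sum[symmetric]) (auto simp: sum_distrib_right simp del: sum_mult_indicator)
  also have "\<dots> \<le> ennreal p * (\<integral>\<^sup>+x. ennreal p * ((F x)\<^sup>2 * indicator annulus x) \<partial>lborel)"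
  proof (intro mult_left_mono nn_integral_mono_AE, use nz in eventually_elim)
    case (elim x)
    have "(\<Sum>i<4. G i x) = ennreal (\<Sum>i<4. norm x / norm (hyp l (flip i) *v x)) * (F x)\<^sup>2"
      by (simp add: G_def sum_distrib_right[symmetric] sum_ennreal)
    \<comment> \<open>Since \<open>flip\<close> permutes the four indices, the same bound for the
      test function serves for the adjoint as well; each of the two uses contributes a factor
      p.\<close>
    also have "(\<Sum>i<4. norm x / norm (hyp l (flip i) *v x)) = norm x * (\<Sum>i<4. 1 / norm (hyp l i *v x))"
      unfolding lessThan_4 by (simp add: flip_def algebra_simps)
    also have "\<dots> \<le> p"
      using mult_left_mono[OF sum_inverse_norm_hyp[OF l elim], of "norm x"] elim by (simp add: p_def)
    finally have "(\<Sum>i<4. G i x) \<le> ennreal p * (F x)\<^sup>2"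
      by (simp add: mult_right_mono ennreal_leI)
    then show ?case using mult_right_mono[of _ _ "indicator annulus x"] by (simp add: mult.assoc[symmetric] mult_right_mono)
  qed auto
  also have "\<dots> = ennreal (p^2) * (\<integral>\<^sup>+x. (F x)\<^sup>2 * indicator annulus x \<partial>lborel)"
    using p by (simp add: nn_integral_cmult power2_eq_square ennreal_mult mult.assoc)
  finally show ?thesis unfolding p_def .
qed

subsection \<open>Volume ratios along a flag\<close>

text \<open>The distance from \<open>R v\<close> to the subspace \<open>R W\<close>, that is, the
  norm of the image of v in the quotient by \<open>R W\<close>. As an infimum over W it is
  compatible with the image of W under any matrix and has open sublevel sets.\<close>

definition quot_norm :: "(real^'n) set \<Rightarrow> real^'n^'n \<Rightarrow> real^'n \<Rightarrow> real" where
  "quot_norm W R v = (INF u\<in>W. norm (R *v (v + u)))"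

lemma quot_norm_projection:
  fixes W :: "(real^'n) set"
  assumes W: "subspace W"
  obtains \<pi> where "linear \<pi>" "\<And>v. quot_norm W R v = norm (\<pi> v)"
    "\<And>u. u \<in> W \<Longrightarrow> \<pi> u = 0" "\<And>v. \<exists>u\<in>W. \<pi> v = R *v (v + u)"
    "\<And>v u. u \<in> W \<Longrightarrow> \<pi> v \<bullet> (R *v u) = 0"
proof -
  define U where "U = (*v) R ` W"
  have U: "subspace U"
    unfolding U_def by (rule linear_subspace_image[OF matrix_vector_mul_linear W])
  have "\<exists>z. (\<forall>u\<in>W. z \<bullet> (R *v u) = 0) \<and> (\<exists>u\<in>W. z = R *v (v + u))" for v
  proof -
    obtain y z where yz: "y \<in> span U" "\<And>w. w \<in> span U \<Longrightarrow> orthogonal z w" "R *v v = y + z"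
      using orthogonal_subspace_decomp_exists[of U "R *v v"] by metis
    then have "y \<in> U" using U by (metis span_eq_iff)
    then obtain w where w: "w \<in> W" "y = R *v w" by (auto simp: U_def)
    have "z = R *v (v + - w)" using yz(3) w(2) by (simp add: matrix_vector_mult_diff_distrib)
    moreover have "- w \<in> W" using w W by (simp add: subspace_neg)
    moreover have "z \<bullet> (R *v u) = 0" if "u \<in> W" for u
      using yz(2)[of "R *v u"] that by (simp add: orthogonal_def U_def span_base)
    ultimately show ?thesis by blast
  qed
  then have "\<exists>\<pi>. \<forall>v. (\<forall>u\<in>W. \<pi> v \<bullet> (R *v u) = 0) \<and> (\<exists>u\<in>W. \<pi> v = R *v (v + u))"
    by (intro choice allI)
  then obtain \<pi> where \<pi>: "\<forall>v. (\<forall>u\<in>W. \<pi> v \<bullet> (R *v u) = 0) \<and> (\<exists>u\<in>W. \<pi> v = R *v (v + u))" ..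
  \<comment> \<open>\<open>\<pi> v\<close> is the component of \<open>R v\<close> orthogonal to
    \<open>R W\<close>. For singular R the vector u is not unique, but the value is, and linearity
    follows from that uniqueness.\<close>
  have orth: "\<pi> v \<bullet> (R *v u) = 0" if "u \<in> W" for u v using \<pi> that by blast
  have ex: "\<exists>u\<in>W. \<pi> v = R *v (v + u)" for v using \<pi> by blast
  have uniq: "\<pi> v = z" if z: "\<And>u. u \<in> W \<Longrightarrow> z \<bullet> (R *v u) = 0" "\<exists>u\<in>W. z = R *v (v + u)" for v z
  proof -
    obtain u u' where u: "u \<in> W" "\<pi> v = R *v (v + u)" "u' \<in> W" "z = R *v (v + u')"
      using ex[of v] z(2) by blast
    have d: "\<pi> v - z = R *v (u - u')"
      unfolding u by (simp add: matrix_vector_mult_diff_distrib matrix_vector_right_distrib)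
    have "u - u' \<in> W" using u W by (simp add: subspace_diff)
    then have "(\<pi> v - z) \<bullet> (R *v (u - u')) = 0"
      by (simp only: inner_diff_left orth z(1) diff_self)
    then have "(\<pi> v - z) \<bullet> (\<pi> v - z) = 0" by (simp only: d)
    then show ?thesis by simp
  qed
  have lin: "linear \<pi>"
  proof (rule linearI)
    fix v v' :: "real^'n" and c :: real
    obtain u u' where u: "u \<in> W" "\<pi> v = R *v (v + u)" "u' \<in> W" "\<pi> v' = R *v (v' + u')"
      using ex by blast
    show "\<pi> (v + v') = \<pi> v + \<pi> v'"
    proof (rule uniq)
      show "\<exists>w\<in>W. \<pi> v + \<pi> v' = R *v (v + v' + w)"
        by (rule bexI[of _ "u + u'"]) (use u W in \<open>auto simp: matrix_vector_right_distrib subspace_add\<close>)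
    qed (simp add: inner_add_left orth)
    show "\<pi> (c *\<^sub>R v) = c *\<^sub>R \<pi> v"
    proof (rule uniq)
      show "\<exists>w\<in>W. c *\<^sub>R \<pi> v = R *v (c *\<^sub>R v + w)"
        by (rule bexI[of _ "c *\<^sub>R u"])
          (use u W in \<open>auto simp: matrix_vector_right_distrib matrix_vector_mult_scaleR subspace_scale scaleR_add_right\<close>)
    qed (simp add: orth)
  qed
  have nrm: "quot_norm W R v = norm (\<pi> v)" for v
  proof -
    obtain u where u: "u \<in> W" "\<pi> v = R *v (v + u)" using ex by blast
    show ?thesis unfolding quot_norm_def
    proof (rule cInf_eq_minimum)
      show "norm (\<pi> v) \<in> (\<lambda>u. norm (R *v (v + u))) ` W" using u by auto
      fix y assume "y \<in> (\<lambda>u. norm (R *v (v + u))) ` W"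
      then obtain u' where u': "u' \<in> W" "y = norm (R *v (v + u'))" by auto
      define z where "z = R *v (u' - u)"
      have e: "R *v (v + u') = \<pi> v + z"
        unfolding u(2) z_def by (simp add: matrix_vector_mult_diff_distrib matrix_vector_right_distrib)
      have "u' - u \<in> W" using W u'(1) u(1) by (rule subspace_diff)
      then have "orthogonal (\<pi> v) z"
        unfolding orthogonal_def z_def by (rule orth)
      then have "(norm (\<pi> v + z))\<^sup>2 = (norm (\<pi> v))\<^sup>2 + (norm z)\<^sup>2"
        by (rule norm_add_Pythagorean)
      then have "(norm (\<pi> v))\<^sup>2 \<le> (norm (\<pi> v + z))\<^sup>2" by simp
      then have "norm (\<pi> v) \<le> norm (\<pi> v + z)" by (rule power2_le_imp_le) simp
      then show "norm (\<pi> v) \<le> y" by (simp only: u'(2) e)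
    qed
  qed
  have zero: "\<pi> u = 0" if "u \<in> W" for u
  proof (rule uniq)
    show "\<exists>w\<in>W. 0 = R *v (u + w)"
      by (rule bexI[of _ "- u"]) (use that W in \<open>simp_all add: subspace_neg\<close>)
  qed simp
  show ?thesis using that[OF lin nrm zero ex orth] .
qed

lemma quot_norm_image:
  "quot_norm ((*v) T ` W) R (T *v v) = quot_norm W (R ** T) v"
  unfolding quot_norm_def image_image matrix_vector_mul_assoc[symmetric]
  by (simp only: matrix_vector_right_distrib)

lemma quot_norm_less_iff:
  assumes "W \<noteq> {}"
  shows "quot_norm W R v < c \<longleftrightarrow> (\<exists>u\<in>W. norm (R *v (v + u)) < c)"
  unfolding quot_norm_def using assms by (intro cINF_less_iff) (auto intro: bdd_belowI2[of _ 0])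

text \<open>An infimum of continuous functions is upper semicontinuous, even over an uncountable
  index set: each strict sublevel set is a union of open sets.\<close>

lemma quot_norm_borel [measurable]:
  fixes W :: "(real^'n) set"
  assumes "W \<noteq> {}"
  shows "(\<lambda>(R, v). quot_norm W R v) \<in> borel_measurable borel"
proof (rule borel_measurableI_less)
  fix c
  have "continuous_on UNIV (\<lambda>p. norm (fst p *v (snd p + u)))" for u :: "real^'n"
    unfolding matrix_vector_mult_def by (intro continuous_intros continuous_on_vec_lambda)
  then have "open {p. norm (fst p *v (snd p + u)) < c}" for u :: "real^'n"
    by (intro open_Collect_less continuous_on_const)
  then have "open (\<Union>u\<in>W. {p. norm (fst p *v (snd p + u)) < c})" by blast
  also have "(\<Union>u\<in>W. {p. norm (fst p *v (snd p + u)) < c}) =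
      {p \<in> space borel. (case p of (R, v) \<Rightarrow> quot_norm W R v) < c}"
    by (auto simp: quot_norm_less_iff[OF assms])
  finally show "{p \<in> space borel. (case p of (R, v) \<Rightarrow> quot_norm W R v) < c} \<in> sets borel"
    by (rule borel_open)
qed

text \<open>The squared area of the parallelogram spanned by the images of \<open>a\<close> and \<open>b\<close> in the quotient,
  with the inner product recovered by polarization.\<close>

definition quot_area2 :: "(real^'n) set \<Rightarrow> real^'n \<Rightarrow> real^'n \<Rightarrow> real^'n^'n \<Rightarrow> real" where
  "quot_area2 W a b R = (quot_norm W R a)\<^sup>2 * (quot_norm W R b)\<^sup>2
     - (((quot_norm W R (a + b))\<^sup>2 - (quot_norm W R (a - b))\<^sup>2) / 4)\<^sup>2"

text \<open>If \<open>a\<close>, \<open>b\<close> are orthonormal, orthogonal to \<open>W\<close>, and \<open>x\<close> is a unit vector, this is the function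
  \<open>P\<close> of the introduction for \<open>U = W\<close>, \<open>U'' = W + span {a, b}\<close> and \<open>U' = W + span {x$1 *\<^sub>R a + x$2 *\<^sub>R b}\<close>.
  It vanishes on degenerate flags, where the numerator is \<open>0\<close>.\<close>

definition flag_ratio :: "(real^'n) set \<Rightarrow> real^'n \<Rightarrow> real^'n \<Rightarrow> real^'n^'n \<Rightarrow> real^2 \<Rightarrow> real" where
  "flag_ratio W a b R x =
     sqrt (sqrt (quot_area2 W a b R)) / quot_norm W R (x$1 *\<^sub>R a + x$2 *\<^sub>R b)"

lemma quot_area2_projection:
  assumes "linear \<pi>" "\<And>v. quot_norm W R v = norm (\<pi> v)"
  shows "quot_area2 W a b R = (\<pi> a \<bullet> \<pi> a) * (\<pi> b \<bullet> \<pi> b) - (\<pi> a \<bullet> \<pi> b)\<^sup>2"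
proof -
  have "(norm (\<pi> (a + b)))\<^sup>2 - (norm (\<pi> (a - b)))\<^sup>2 = 4 * (\<pi> a \<bullet> \<pi> b)"
    unfolding linear_add[OF assms(1)] linear_diff[OF assms(1)]
    by (simp add: power2_norm_eq_inner inner_add_left inner_add_right inner_diff_left inner_diff_right inner_commute)
  then show ?thesis
    unfolding quot_area2_def assms(2) by (simp add: power2_norm_eq_inner)
qed

text \<open>Absorbs the rightmost factor of a product into the flag, so that a bound over all flags
  at \<open>mat 1\<close> covers every matrix. Both sides are built from the same infima, so T may
  be singular.\<close>

lemma flag_ratio_image:
  "flag_ratio ((*v) T ` W) (T *v a) (T *v b) R x = flag_ratio W a b (R ** T) x"
  unfolding flag_ratio_def quot_area2_def
  by (simp add: quot_norm_image[symmetric] matrix_vector_right_distrib matrix_vector_mult_diff_distrib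
      matrix_vector_mult_scaleR)

text \<open>Areas in the quotient are multiplied by \<open>\<bar>det h\<bar>\<close>, and
  \<open>flag_ratio\<close> contains the square root of an area; the terms u and u' vanish in the
  quotient. For determinant one a change of basis is just a change of the variable x.\<close>

lemma flag_ratio_change_basis:
  fixes W :: "(real^'n) set" and h :: "real^2^2"
  assumes W: "subspace W" and u: "u \<in> W" "u' \<in> W"
    and a': "a' = h$1$1 *\<^sub>R a + h$2$1 *\<^sub>R b + u" and b': "b' = h$1$2 *\<^sub>R a + h$2$2 *\<^sub>R b + u'"
  shows "flag_ratio W a' b' R x = sqrt \<bar>det h\<bar> * flag_ratio W a b R (h *v x)"
proof -
  obtain \<pi> :: "real^'n \<Rightarrow> real^'n" where \<pi>: "linear \<pi>" "\<And>v. quot_norm W R v = norm (\<pi> v)" "\<And>u. u \<in> W \<Longrightarrow> \<pi> u = 0"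
    by (rule quot_norm_projection[OF W, of R]) blast
  note lin = linear_add[OF \<pi>(1)] linear_scale[OF \<pi>(1)]
  have pa: "\<pi> a' = h$1$1 *\<^sub>R \<pi> a + h$2$1 *\<^sub>R \<pi> b" "\<pi> b' = h$1$2 *\<^sub>R \<pi> a + h$2$2 *\<^sub>R \<pi> b"
    unfolding a' b' lin using \<pi>(3) u by auto
  have "\<pi> (x$1 *\<^sub>R a' + x$2 *\<^sub>R b') = \<pi> ((h *v x)$1 *\<^sub>R a + (h *v x)$2 *\<^sub>R b)"
    unfolding lin pa by (simp add: matrix_vector_mult_def sum_2 algebra_simps)
  moreover have "quot_area2 W a' b' R = \<bar>det h\<bar>\<^sup>2 * quot_area2 W a b R"
    unfolding quot_area2_projection[OF \<pi>(1,2)] pa power2_abs det_2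
    by (simp add: inner_add_left inner_add_right inner_commute[of "\<pi> b" "\<pi> a"] power2_eq_square algebra_simps)
  ultimately show ?thesis
    unfolding flag_ratio_def \<pi>(2) by (simp add: real_sqrt_mult)
qed

lemma flag_ratio_scale:
  fixes W :: "(real^'n) set"
  assumes "subspace W" "r > 0"
  shows "flag_ratio W a b R x = r * flag_ratio W a b R (r *\<^sub>R x)"
proof -
  obtain \<pi> :: "real^'n \<Rightarrow> real^'n" where \<pi>: "linear \<pi>" "\<And>v. quot_norm W R v = norm (\<pi> v)"
    by (rule quot_norm_projection[OF assms(1), of R]) blast
  have "(r *\<^sub>R x)$1 *\<^sub>R a + (r *\<^sub>R x)$2 *\<^sub>R b = r *\<^sub>R (x$1 *\<^sub>R a + x$2 *\<^sub>R b)"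
    by (simp add: scaleR_add_right)
  then show ?thesis
    unfolding flag_ratio_def \<pi>(2) using assms(2) by (simp add: linear_scale[OF \<pi>(1)])
qed

text \<open>Individual noise matrices may be singular and map a flag to a degenerate one; the value
  0 lets the uniform bound include these flags.\<close>

lemma flag_ratio_dependent:
  fixes W :: "(real^'n) set"
  assumes W: "subspace W" and "\<alpha> \<noteq> 0 \<or> \<beta> \<noteq> 0" "\<alpha> *\<^sub>R a + \<beta> *\<^sub>R b \<in> W"
  shows "flag_ratio W a b R x = 0"
proof -
  obtain \<pi> :: "real^'n \<Rightarrow> real^'n" where \<pi>: "linear \<pi>" "\<And>v. quot_norm W R v = norm (\<pi> v)" "\<And>u. u \<in> W \<Longrightarrow> \<pi> u = 0"
    by (rule quot_norm_projection[OF W, of R]) blast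
  have z: "\<alpha> *\<^sub>R \<pi> a + \<beta> *\<^sub>R \<pi> b = 0"
    using \<pi>(3)[OF assms(3)] by (simp add: linear_add[OF \<pi>(1)] linear_scale[OF \<pi>(1)])
  have "quot_area2 W a b R = 0"
  proof (cases "\<alpha> = 0")
    case True
    then have "\<pi> b = 0" using z assms(2) by auto
    then show ?thesis unfolding quot_area2_projection[OF \<pi>(1,2)] by simp
  next
    case False
    have "\<alpha> *\<^sub>R \<pi> a = - (\<beta> *\<^sub>R \<pi> b)" using z by (simp add: add_eq_0_iff2)
    then have "(1/\<alpha>) *\<^sub>R \<alpha> *\<^sub>R \<pi> a = (1/\<alpha>) *\<^sub>R - (\<beta> *\<^sub>R \<pi> b)" by simp
    then have "\<pi> a = (- (\<beta> / \<alpha>)) *\<^sub>R \<pi> b" using False by simp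
    then show ?thesis unfolding quot_area2_projection[OF \<pi>(1,2)] by (simp add: power2_eq_square)
  qed
  then show ?thesis unfolding flag_ratio_def by simp
qed

lemma flag_ratio_orthonormal:
  fixes W :: "(real^'n) set"
  assumes W: "subspace W" and ab: "norm a = 1" "norm b = 1" "a \<bullet> b = 0"
    and orth: "\<And>u. u \<in> W \<Longrightarrow> a \<bullet> u = 0" "\<And>u. u \<in> W \<Longrightarrow> b \<bullet> u = 0"
  shows "flag_ratio W a b (mat 1) x = 1 / norm x"
proof -
  obtain \<pi> :: "real^'n \<Rightarrow> real^'n" where \<pi>: "linear \<pi>" "\<And>v. quot_norm W (mat 1) v = norm (\<pi> v)"
     "\<And>v. \<exists>u\<in>W. \<pi> v = v + u" "\<And>v u. u \<in> W \<Longrightarrow> \<pi> v \<bullet> u = 0"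
    by (rule quot_norm_projection[OF W, of "mat 1"]) (unfold matrix_vector_mul_lid, blast)
  have fx: "\<pi> v = v" if v: "\<And>u. u \<in> W \<Longrightarrow> v \<bullet> u = 0" for v
  proof -
    obtain u where u: "u \<in> W" "\<pi> v = v + u" using \<pi>(3) by blast
    have "u \<bullet> u = 0" using \<pi>(4)[OF u(1), of v] v[OF u(1)] u(2) by (simp add: inner_add_left)
    then show ?thesis using u by simp
  qed
  have pab: "\<pi> a = a" "\<pi> b = b" using orth by (auto intro: fx)
  have aa: "a \<bullet> a = 1" "b \<bullet> b = 1" using ab by (simp_all add: norm_eq_1)
  have "(norm (x$1 *\<^sub>R a + x$2 *\<^sub>R b))\<^sup>2 = x$1 * x$1 + x$2 * x$2"
    unfolding power2_norm_eq_inner using aa ab(3)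
    by (simp add: inner_add_left inner_add_right inner_commute[of b a])
  also have "\<dots> = (norm x)\<^sup>2"
    unfolding power2_norm_eq_inner by (simp add: inner_vec_def sum_2)
  finally have "(norm (x$1 *\<^sub>R a + x$2 *\<^sub>R b))\<^sup>2 = (norm x)\<^sup>2" .
  then have "norm (x$1 *\<^sub>R a + x$2 *\<^sub>R b) = norm x" by (simp add: power2_eq_iff_nonneg)
  then show ?thesis
    unfolding flag_ratio_def quot_area2_projection[OF \<pi>(1,2)] \<pi>(2)
    by (simp add: linear_add[OF \<pi>(1)] linear_scale[OF \<pi>(1)] pab aa ab(3))
qed

lemma flag_ratio_borel [measurable]:
  fixes W :: "(real^'n) set"
  assumes "subspace W"
  shows "(\<lambda>(R, x). flag_ratio W a b R x) \<in> borel_measurable (borel \<Otimes>\<^sub>M borel)"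
proof -
  have W: "W \<noteq> {}" using assms subspace_0 by blast
  have [measurable]: "(\<lambda>(R, v). quot_norm W R v) \<in> borel_measurable (borel \<Otimes>\<^sub>M borel)"
    using quot_norm_borel[OF W] by (simp add: borel_prod)
  have [measurable]: "(\<lambda>x::real^2. x $ i) \<in> borel_measurable borel" for i
    by (intro borel_measurable_continuous_onI continuous_intros)
  show ?thesis unfolding flag_ratio_def quot_area2_def by measurable
qed

subsection \<open>Extending planar maps to the whole space\<close>

lemma matrix_add_rdistrib: "(A + B) ** (C :: real^'k^'n) = A ** C + B ** C"
  by (simp add: matrix_matrix_mult_def vec_eq_iff distrib_right sum.distrib)

lemma matrix_diff_ldistrib: "(A :: real^'n^'m) ** (B - C) = A ** B - A ** (C :: real^'k^'n)"
  by (simp add: matrix_matrix_mult_def vec_eq_iff right_diff_distrib sum_subtractf)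

text \<open>For orthonormal a and b, the map that acts by h in the basis a, b of their plane and as
  the identity on the orthogonal complement.\<close>

definition plane_ext :: "real^'n \<Rightarrow> real^'n \<Rightarrow> real^2^2 \<Rightarrow> real^'n^'n" where
  "plane_ext a b h = (\<chi> i j. (if i = j then 1 else 0)
     + (h$1$1 - 1) * (a$i * a$j) + h$1$2 * (a$i * b$j) + h$2$1 * (b$i * a$j) + (h$2$2 - 1) * (b$i * b$j))"

lemma plane_ext_apply:
  "plane_ext a b h *v v = v + ((h$1$1 - 1) * (a \<bullet> v) + h$1$2 * (b \<bullet> v)) *\<^sub>R a
     + (h$2$1 * (a \<bullet> v) + (h$2$2 - 1) * (b \<bullet> v)) *\<^sub>R b"
proof -
  have d: "(\<Sum>j\<in>UNIV. v$j * (if i = j then 1 else 0)) = v$i" for i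
    by (simp add: if_distrib[of "\<lambda>z. _ * z"] cong: if_cong)
  show ?thesis
    unfolding plane_ext_def matrix_vector_mult_def inner_vec_def vec_eq_iff
    by (simp add: distrib_right sum.distrib d sum_distrib_left sum_distrib_right mult_ac distrib_left)
qed

lemma plane_ext_mult:
  assumes ab: "norm a = 1" "norm b = 1" "a \<bullet> b = 0"
  shows "plane_ext a b h ** plane_ext a b k = plane_ext a b (h ** k)"
proof -
  have aa: "a \<bullet> a = 1" "b \<bullet> b = 1" using ab by (simp_all add: norm_eq_1)
  have "(plane_ext a b h ** plane_ext a b k) *v v = plane_ext a b (h ** k) *v v" for v
  proof -
    define p q where "p = a \<bullet> v" and "q = b \<bullet> v"
    have 1: "a \<bullet> (plane_ext a b k *v v) = k$1$1 * p + k$1$2 * q"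
      "b \<bullet> (plane_ext a b k *v v) = k$2$1 * p + k$2$2 * q"
      unfolding plane_ext_apply p_def q_def
      by (simp_all add: inner_add_right aa ab(3) inner_commute[of b a] algebra_simps)
    have 2: "(h ** k)$i$j = h$i$1 * k$1$j + h$i$2 * k$2$j" for i j
      by (simp add: matrix_matrix_mult_def sum_2)
    show ?thesis
      unfolding matrix_vector_mul_assoc[symmetric]
      unfolding plane_ext_apply[of a b h "plane_ext a b k *v v"] 1
      unfolding plane_ext_apply 2 p_def[symmetric] q_def[symmetric]
      by (simp add: algebra_simps)
  qed
  then show ?thesis by (simp add: matrix_eq)
qed

lemma plane_ext_one: "plane_ext a b (mat 1) = mat 1"
  by (simp add: plane_ext_def mat_def vec_eq_iff)

text \<open>Conjugating by a reflection of the plane inverts the hyperbolic matrices.\<close>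

definition refl2 :: "nat \<Rightarrow> real^2^2" where
  "refl2 i = (if i < 2 then vector [vector [0, 1], vector [1, 0]] else vector [vector [1, 0], vector [0, -1]])"

lemma refl2_involution: "refl2 i ** refl2 i = mat 1"
  by (simp add: refl2_def matrix_matrix_mult_def mat_def vec_eq_iff forall_2 sum_2)

lemma refl2_hyp:
  assumes "i < 4" shows "refl2 i ** hyp l i ** refl2 i = hyp l (flip i)"
proof -
  have "i \<in> {0, 1, 2, 3}" using assms lessThan_4 by blast
  then show ?thesis
    by (auto simp: refl2_def hyp_def flip_def matrix_matrix_mult_def vec_eq_iff forall_2 sum_2 minus_divide_left)
qed

lemma hyp_flip_mult:
  assumes "l > 0" "i < 4"
  shows "hyp l (flip i) ** hyp l i = mat 1" "hyp l i ** hyp l (flip i) = mat 1"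
proof -
  show "hyp l (flip i) ** hyp l i = mat 1"
    by (simp add: matrix_eq matrix_vector_mul_assoc[symmetric] hyp_flip[OF assms])
  then show "hyp l i ** hyp l (flip i) = mat 1" by (simp add: matrix_left_right_inverse)
qed

lemma linear_matrix_mult_right: "linear (\<lambda>\<eta> :: real^'n^'m. \<eta> ** (T :: real^'k^'n))"
  by (rule linearI) (simp_all add: matrix_add_rdistrib scalar_matrix_assoc)

lemma linear_imp_borel_measurable:
  fixes f :: "'a::euclidean_space \<Rightarrow> 'b::euclidean_space"
  shows "linear f \<Longrightarrow> f \<in> borel_measurable borel"
  by (auto intro!: borel_measurable_continuous_onI linear_continuous_on simp: linear_linear)

text \<open>Conjugation by the extended reflection turns right multiplication by the extended
  hyperbolic matrix into its inverse. This shows that Lebesgue measure on the space of matrices is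
  preserved without evaluating a determinant there.\<close>

lemma nn_integral_plane_ext:
  fixes a b :: "real^'n" and f :: "real^'n^'n \<Rightarrow> ennreal"
  assumes ab: "norm a = 1" "norm b = 1" "a \<bullet> b = 0" and l: "l > 0" "i < 4"
    and f: "f \<in> borel_measurable borel"
  shows "(\<integral>\<^sup>+\<eta>. f (\<eta> ** plane_ext a b (hyp l i)) \<partial>lborel) = (\<integral>\<^sup>+\<eta>. f \<eta> \<partial>lborel)"
  by (rule nn_integral_lborel_conj_inverse[where S="\<lambda>\<eta>. \<eta> ** plane_ext a b (hyp l (flip i))"
        and P="\<lambda>\<eta>. \<eta> ** plane_ext a b (refl2 i)"])
     (use f in \<open>auto simp: linear_matrix_mult_right matrix_mul_assoc[symmetric] plane_ext_mult[OF ab]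
        hyp_flip_mult[OF l] refl2_involution plane_ext_one
        refl2_hyp[OF l(2), unfolded matrix_mul_assoc[symmetric]]\<close>)

definition cube :: "real \<Rightarrow> (real^'n^'n) set" where
  "cube c = {\<xi>. \<forall>i j. \<bar>\<xi> $ i $ j\<bar> \<le> c}"

lemma cube_eq_cbox: "cube c = cbox (- (c *\<^sub>R One)) (c *\<^sub>R (One :: real^'n^'n))"
proof -
  have "\<xi> \<in> cbox (- (c *\<^sub>R One)) (c *\<^sub>R One) \<longleftrightarrow> (\<forall>b\<in>Basis. \<bar>\<xi> \<bullet> b\<bar> \<le> c)" for \<xi> :: "real^'n^'n"
    by (auto simp: mem_box abs_le_iff)
  also have "\<dots> \<xi> \<longleftrightarrow> (\<forall>i j. \<bar>\<xi> $ i $ j\<bar> \<le> c)" for \<xi> :: "real^'n^'n"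
    by (auto simp: Basis_vec_def inner_axis)
  finally show ?thesis by (auto simp: cube_def)
qed

lemma cube_borel [measurable]: "cube c \<in> sets borel"
  by (simp add: cube_eq_cbox)

lemma emeasure_cube:
  assumes "c \<ge> 0"
  shows "emeasure lborel (cube c :: (real^'n^'n) set) = ennreal ((2 * c) ^ (CARD('n) * CARD('n)))"
proof -
  have e: "(c *\<^sub>R One - - (c *\<^sub>R One)) \<bullet> b = 2 * c" if "b \<in> Basis" for b :: "real^'n^'n"
  proof -
    have "One \<bullet> b = 1" using that by (simp add: inner_sum_left inner_Basis)
    then show ?thesis by (simp only: inner_diff_left inner_minus_left inner_scaleR_left)
  qed
  have "emeasure lborel (cube c :: (real^'n^'n) set) =
      ennreal (\<Prod>b\<in>(Basis :: (real^'n^'n) set). (c *\<^sub>R One - - (c *\<^sub>R One)) \<bullet> b)"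
    unfolding cube_eq_cbox using assms by (subst emeasure_lborel_cbox) auto
  also have "\<dots> = ennreal (\<Prod>b\<in>(Basis :: (real^'n^'n) set). 2 * c)"
    by (intro arg_cong[of _ _ ennreal] prod.cong) (simp_all only: e)
  finally show ?thesis by simp
qed

lemma hyp_distance:
  assumes "l \<ge> 1" "i < 4"
  shows "\<bar>hyp l i $1$1 - 1\<bar> + \<bar>hyp l i $1$2\<bar> + \<bar>hyp l i $2$1\<bar> + \<bar>hyp l i $2$2 - 1\<bar> \<le> 2 * (l - 1)"
proof -
  have "i \<in> {0, 1, 2, 3}" using assms lessThan_4 by blast
  moreover have "1/l \<le> 1" "l + 1/l \<ge> 2" 
    using assms zero_le_power2[of "l - 1"] by (simp_all add: field_simps power2_eq_square)
  ultimately show ?thesis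
    using assms by (auto simp: hyp_def abs_if field_simps)
qed

lemma row_plane_ext_bound:
  fixes a b :: "real^'n"
  assumes ab: "norm a = 1" "norm b = 1" and l: "l \<ge> 1" "i < 4" and y: "norm (X $ r) \<le> z"
  shows "\<bar>(X ** (plane_ext a b (hyp l i) - mat 1)) $ r $ s\<bar> \<le> 2 * (l - 1) * z"
proof -
  define h where "h = hyp l i"
  define y where "y = X $ r"
  have z: "0 \<le> z" using y norm_ge_zero order_trans by blast
  have "(X ** (plane_ext a b h - mat 1)) $ r $ s =
      (h$1$1 - 1) * ((y \<bullet> a) * a$s) + h$1$2 * ((y \<bullet> a) * b$s) + h$2$1 * ((y \<bullet> b) * a$s) + (h$2$2 - 1) * ((y \<bullet> b) * b$s)"
    by (simp add: matrix_matrix_mult_def plane_ext_def mat_def y_def inner_vec_def algebra_simps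
        sum.distrib sum_subtractf sum_distrib_left sum_distrib_right)
  also have "\<bar>\<dots>\<bar> \<le> \<bar>h$1$1 - 1\<bar> * z + \<bar>h$1$2\<bar> * z + \<bar>h$2$1\<bar> * z + \<bar>h$2$2 - 1\<bar> * z"
  proof -
    have in1: "\<bar>y \<bullet> c\<bar> \<le> z" if "norm c = 1" for c
      using Cauchy_Schwarz_ineq2[of y c] that y by (simp add: y_def)
    have in2: "\<bar>c $ s\<bar> \<le> 1" if "norm c = 1" for c :: "real^'n"
      using component_le_norm_cart[of c s] that by simp
    have m: "\<bar>e * ((y \<bullet> c) * c'$s)\<bar> \<le> \<bar>e\<bar> * z" if "norm c = 1" "norm c' = 1" for e c c'
      unfolding abs_mult using mult_mono[OF in1[OF that(1)] in2[OF that(2)] z] 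
      by (intro mult_left_mono) auto
    show ?thesis
      using m[OF ab(1,1), of "h$1$1 - 1"] m[OF ab(1,2), of "h$1$2"] m[OF ab(2,1), of "h$2$1"] m[OF ab(2,2), of "h$2$2 - 1"]
      by linarith
  qed
  also have "\<dots> = (\<bar>h$1$1 - 1\<bar> + \<bar>h$1$2\<bar> + \<bar>h$2$1\<bar> + \<bar>h$2$2 - 1\<bar>) * z"
    by (simp add: algebra_simps)
  also have "\<dots> \<le> 2 * (l - 1) * z"
    using hyp_distance[OF l] z by (intro mult_right_mono) (auto simp: h_def)
  finally show ?thesis by (simp add: h_def)
qed

text \<open>The matrix in the conclusion is the noise that turns A into
  \<open>(A + \<epsilon> *\<^sub>R \<eta>) ** T\<close>. As the rows of A are unit vectors, the
  choice \<open>l - 1 = \<epsilon> / (4 * (d + 1))\<close> bounds the displacement of each entry of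
  \<eta> by \<open>(\<epsilon> * d + 2) / (4 * (d + 1))\<close>, which is at most the margin 1/2
  between the two cubes.\<close>

lemma shifted_noise_in_cube:
  fixes a b :: "real^'n" and A :: "real^'n^'n"
  assumes ab: "norm a = 1" "norm b = 1" and e: "0 < \<epsilon>" "\<epsilon> < 1" and i: "i < 4"
    and A: "orthogonal_matrix A" and \<eta>: "\<eta> \<in> cube (1/2)"
  defines "T \<equiv> plane_ext a b (hyp (1 + \<epsilon> / (4 * (CARD('n) + 1))) i)"
  shows "\<eta> ** T + (1 / \<epsilon>) *\<^sub>R (A ** (T - mat 1)) \<in> cube 1"
proof -
  define d where "d = real CARD('n)"
  define l where "l = 1 + \<epsilon> / (4 * (d + 1))"
  have d: "d \<ge> 0" by (simp add: d_def)
  have l: "l \<ge> 1" using e d by (simp add: l_def)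
  have T: "T = plane_ext a b (hyp l i)" by (simp add: T_def l_def d_def add.commute)
  have "\<bar>(\<eta> ** T + (1 / \<epsilon>) *\<^sub>R (A ** (T - mat 1))) $ r $ s\<bar> \<le> 1" for r s
  proof -
    have "norm (\<eta> $ r) \<le> (\<Sum>j\<in>UNIV. \<bar>\<eta> $ r $ j\<bar>)" by (rule norm_le_l1_cart)
    also have "\<dots> \<le> (\<Sum>j\<in>(UNIV :: 'n set). 1/2)"
      using \<eta> by (intro sum_mono) (simp add: cube_def)
    finally have "norm (\<eta> $ r) \<le> d / 2" by (simp add: d_def)
    from row_plane_ext_bound[OF ab l i this, of s]
    have 1: "\<bar>(\<eta> ** (T - mat 1)) $ r $ s\<bar> \<le> 2 * (l - 1) * (d / 2)" by (simp add: T)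
    have "norm (A $ r) = 1"
      using A by (simp add: orthogonal_matrix_orthonormal_rows row_def vec_lambda_unique)
    from row_plane_ext_bound[OF ab l i eq_refl[OF this], of s]
    have 2: "\<bar>(A ** (T - mat 1)) $ r $ s\<bar> \<le> 2 * (l - 1)" by (simp add: T)
    have "\<eta> ** T = \<eta> + \<eta> ** (T - mat 1)" by (simp add: matrix_diff_ldistrib)
    then have "\<bar>(\<eta> ** T + (1 / \<epsilon>) *\<^sub>R (A ** (T - mat 1))) $ r $ s\<bar> \<le>
       \<bar>\<eta> $ r $ s\<bar> + \<bar>(\<eta> ** (T - mat 1)) $ r $ s\<bar> + (1/\<epsilon>) * \<bar>(A ** (T - mat 1)) $ r $ s\<bar>"
      using e abs_triangle_ineq[of "\<eta> $ r $ s + (\<eta> ** (T - mat 1)) $ r $ s" "(1/\<epsilon>) * (A ** (T - mat 1)) $ r $ s"]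
        abs_triangle_ineq[of "\<eta> $ r $ s" "(\<eta> ** (T - mat 1)) $ r $ s"]
      by (simp add: abs_mult)
    also have "\<dots> \<le> 1/2 + 2 * (l - 1) * (d / 2) + (1/\<epsilon>) * (2 * (l - 1))"
      using 1 2 \<eta> e by (intro add_mono mult_left_mono) (auto simp: cube_def)
    also have "\<dots> = 1/2 + (\<epsilon> * d + 2) / (4 * (d + 1))"
    proof -
      define q where "q = d + 1"
      have q: "q > 0" and lq: "l - 1 = \<epsilon> / (4 * q)" using d by (simp_all add: q_def l_def)
      show ?thesis unfolding q_def[symmetric] lq using e q by (simp add: field_simps)
    qed
    also have "\<dots> \<le> 1"
    proof -
      have "\<epsilon> * d \<le> d" using e d by (simp add: mult_left_le_one_le)
      then have "(\<epsilon> * d + 2) / (4 * (d + 1)) \<le> 1/2"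
        using d by (subst pos_divide_le_eq) auto
      then show ?thesis by linarith
    qed
    finally show ?thesis .
  qed
  then show ?thesis by (simp add: cube_def)
qed

subsection \<open>Contraction by one noisy step\<close>

text \<open>For f homogeneous of degree -1, the squared norm of f in the square integrable functions
  on the circle of directions.\<close>

definition annulus_energy :: "(real^2 \<Rightarrow> ennreal) \<Rightarrow> ennreal" where
  "annulus_energy f = (\<integral>\<^sup>+x. (f x)\<^sup>2 * indicator annulus x \<partial>lborel)"

lemma ennreal_young:
  fixes a b :: ennreal
  assumes r: "r > 0"
  shows "(a + b)\<^sup>2 \<le> ennreal (1 + r) * a\<^sup>2 + ennreal (1 + 1 / r) * b\<^sup>2"
proof (cases "a = top \<or> b = top")
  case True
  then show ?thesis using r by (auto simp: ennreal_mult_top power2_eq_square ennreal_top_mult)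
next
  case False
  then obtain x y where xy: "a = ennreal x" "x \<ge> 0" "b = ennreal y" "y \<ge> 0"
    by (metis ennreal_cases)
  have "0 \<le> (r * x - y)\<^sup>2 / r" using r by simp
  also have "\<dots> = r * x\<^sup>2 + (1 / r) * y\<^sup>2 - 2 * x * y"
    using r by (simp add: field_simps power2_eq_square)
  finally have "(x + y)\<^sup>2 \<le> (1 + r) * x\<^sup>2 + (1 + 1 / r) * y\<^sup>2"
    by (simp add: power2_sum algebra_simps)
  then have "ennreal ((x + y)\<^sup>2) \<le> ennreal ((1 + r) * x\<^sup>2 + (1 + 1 / r) * y\<^sup>2)" by (rule ennreal_leI)
  also have "\<dots> = ennreal (1 + r) * ennreal (x\<^sup>2) + ennreal (1 + 1 / r) * ennreal (y\<^sup>2)"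
    using r by (subst ennreal_plus) (simp_all add: ennreal_mult)
  finally show ?thesis using xy by (simp add: ennreal_power flip: ennreal_plus)
qed

text \<open>Minkowski's inequality in squared form, which avoids roots of extended reals. The
  parameter \<open>\<beta>/\<alpha>\<close> in Young's inequality is the one for which the two terms
  add up to an exact square.\<close>

lemma annulus_energy_add:
  assumes [measurable]: "f \<in> borel_measurable borel" "g \<in> borel_measurable borel"
    and pos: "\<alpha> > 0" "\<beta> > 0"
    and f: "annulus_energy f \<le> ennreal (\<alpha>\<^sup>2) * K" and g: "annulus_energy g \<le> ennreal (\<beta>\<^sup>2) * K"
  shows "annulus_energy (\<lambda>x. f x + g x) \<le> ennreal ((\<alpha> + \<beta>)\<^sup>2) * K"
proof -
  have "annulus_energy (\<lambda>x. f x + g x) \<le> (\<integral>\<^sup>+x. ennreal (1 + \<beta>/\<alpha>) * ((f x)\<^sup>2 * indicator annulus x)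
      + ennreal (1 + 1/(\<beta>/\<alpha>)) * ((g x)\<^sup>2 * indicator annulus x) \<partial>lborel)"
    unfolding annulus_energy_def
  proof (rule nn_integral_mono)
    fix x
    show "(f x + g x)\<^sup>2 * indicator annulus x \<le> ennreal (1 + \<beta>/\<alpha>) * ((f x)\<^sup>2 * indicator annulus x)
      + ennreal (1 + 1/(\<beta>/\<alpha>)) * ((g x)\<^sup>2 * indicator annulus x)"
      using mult_right_mono[OF ennreal_young[of "\<beta>/\<alpha>" "f x" "g x"], of "indicator annulus x"] pos
      by (simp add: distrib_right mult.assoc)
  qed
  also have "\<dots> = ennreal (1 + \<beta>/\<alpha>) * annulus_energy f + ennreal (1 + 1/(\<beta>/\<alpha>)) * annulus_energy g"
    unfolding annulus_energy_def by (simp add: nn_integral_add nn_integral_cmult)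
  also have "\<dots> \<le> ennreal (1 + \<beta>/\<alpha>) * (ennreal (\<alpha>\<^sup>2) * K) + ennreal (1 + 1/(\<beta>/\<alpha>)) * (ennreal (\<beta>\<^sup>2) * K)"
    using f g by (intro add_mono mult_left_mono) auto
  also have "\<dots> = ennreal ((1 + \<beta>/\<alpha>) * \<alpha>\<^sup>2 + (1 + 1/(\<beta>/\<alpha>)) * \<beta>\<^sup>2) * K"
    using pos by (simp add: mult.assoc[symmetric] ennreal_mult'[symmetric] distrib_right[symmetric] flip: ennreal_plus)
  also have "(1 + \<beta>/\<alpha>) * \<alpha>\<^sup>2 + (1 + 1/(\<beta>/\<alpha>)) * \<beta>\<^sup>2 = (\<alpha> + \<beta>)\<^sup>2"
    using pos by (simp add: field_simps power2_eq_square)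
  finally show ?thesis .
qed

lemma annulus_energy_cmult:
  assumes [measurable]: "f \<in> borel_measurable borel" and "c \<ge> 0"
  shows "annulus_energy (\<lambda>x. ennreal c * f x) = ennreal (c\<^sup>2) * annulus_energy f"
  unfolding annulus_energy_def using assms(2)
  by (simp add: power_mult_distrib ennreal_power mult.assoc nn_integral_cmult)

text \<open>Minkowski's inequality for an integral over D: Cauchy-Schwarz in \<xi> gives one factor
  m, and Fubini gives the other.\<close>

lemma annulus_energy_nn_integral:
  fixes F :: "'a::euclidean_space \<Rightarrow> real^2 \<Rightarrow> ennreal"
  assumes [measurable]: "(\<lambda>(\<xi>, x). F \<xi> x) \<in> borel_measurable (borel \<Otimes>\<^sub>M borel)" "D \<in> sets borel"
    and K: "\<And>\<xi>. annulus_energy (F \<xi>) \<le> K" and m: "emeasure lborel D = ennreal m" "m \<ge> 0"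
  shows "annulus_energy (\<lambda>x. \<integral>\<^sup>+\<xi>. F \<xi> x * indicator D \<xi> \<partial>lborel) \<le> ennreal (m\<^sup>2) * K"
proof -
  have pw: "(\<integral>\<^sup>+\<xi>. F \<xi> x * indicator D \<xi> \<partial>lborel)\<^sup>2 \<le> ennreal m * (\<integral>\<^sup>+\<xi>. (F \<xi> x)\<^sup>2 * indicator D \<xi> \<partial>lborel)" for x
  proof -
    have ind: "(indicator D \<xi> :: ennreal) * indicator D \<xi> = indicator D \<xi>" for \<xi>
      by (simp add: indicator_def)
    have "(\<integral>\<^sup>+\<xi>. F \<xi> x * indicator D \<xi> \<partial>lborel)\<^sup>2 = (\<integral>\<^sup>+\<xi>. (F \<xi> x * indicator D \<xi>) * indicator D \<xi> \<partial>lborel)\<^sup>2"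
      by (simp add: mult.assoc ind)
    also have "\<dots> \<le> (\<integral>\<^sup>+\<xi>. (F \<xi> x * indicator D \<xi>)\<^sup>2 \<partial>lborel) * (\<integral>\<^sup>+\<xi>. (indicator D \<xi>)\<^sup>2 \<partial>lborel)"
      by (rule Cauchy_Schwarz_nn_integral) measurable
    also have "\<dots> = (\<integral>\<^sup>+\<xi>. (F \<xi> x)\<^sup>2 * indicator D \<xi> \<partial>lborel) * ennreal m"
      by (simp add: power_mult_distrib power2_eq_square[of "indicator D _"] ind m(1))
    finally show ?thesis by (simp add: mult.commute)
  qed
  have "annulus_energy (\<lambda>x. \<integral>\<^sup>+\<xi>. F \<xi> x * indicator D \<xi> \<partial>lborel) \<le>
      (\<integral>\<^sup>+x. ennreal m * (\<integral>\<^sup>+\<xi>. (F \<xi> x)\<^sup>2 * indicator D \<xi> \<partial>lborel) * indicator annulus x \<partial>lborel)"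
    unfolding annulus_energy_def by (intro nn_integral_mono mult_right_mono pw) auto
  also have "\<dots> = (\<integral>\<^sup>+x. (\<integral>\<^sup>+\<xi>. ennreal m * indicator D \<xi> * ((F \<xi> x)\<^sup>2 * indicator annulus x) \<partial>lborel) \<partial>lborel)"
    by (subst nn_integral_cmult[symmetric], measurable, subst nn_integral_multc[symmetric])
       (auto simp: mult_ac)
  also have "\<dots> = (\<integral>\<^sup>+\<xi>. (\<integral>\<^sup>+x. ennreal m * indicator D \<xi> * ((F \<xi> x)\<^sup>2 * indicator annulus x) \<partial>lborel) \<partial>lborel)"
    by (rule lborel_pair.Fubini') measurable
  also have "\<dots> = (\<integral>\<^sup>+\<xi>. ennreal m * indicator D \<xi> * annulus_energy (F \<xi>) \<partial>lborel)"
    unfolding annulus_energy_def by (intro nn_integral_cong nn_integral_cmult) measurable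
  also have "\<dots> \<le> (\<integral>\<^sup>+\<xi>. ennreal m * indicator D \<xi> * K \<partial>lborel)"
    by (intro nn_integral_mono mult_left_mono K) auto
  also have "\<dots> = ennreal (m\<^sup>2) * K"
    using m by (simp add: nn_integral_cmult nn_integral_multc power2_eq_square ennreal_mult)
  finally show ?thesis .
qed

section \<open>Iterated averaging over the noise\<close>

definition noise_step ::
    "real \<Rightarrow> real^'n^'n \<Rightarrow> (real^'n^'n \<Rightarrow> 'x \<Rightarrow> ennreal) \<Rightarrow> real^'n^'n \<Rightarrow> 'x \<Rightarrow> ennreal" where
  "noise_step \<epsilon> A \<psi> R x =
     (\<integral>\<^sup>+\<xi>. \<psi> ((A + \<epsilon> *\<^sub>R \<xi>) ** R) x \<partial>uniform_measure lborel (cube 1))"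

text \<open>The head of the list is the factor applied first: the list
  \<open>[A 1, ..., A n]\<close> describes the product \<open>A n ... A 1\<close>.\<close>

abbreviation noise_steps where "noise_steps \<epsilon> \<equiv> foldr (noise_step \<epsilon>)"

lemma noise_steps_Cons:
  "noise_steps \<epsilon> (A # As) \<psi> R x =
     (\<integral>\<^sup>+\<xi>. noise_steps \<epsilon> As \<psi> ((A + \<epsilon> *\<^sub>R \<xi>) ** R) x \<partial>uniform_measure lborel (cube 1))"
  unfolding foldr.simps o_apply by (rule noise_step_def)

lemma prob_space_cube: "prob_space (uniform_measure lborel (cube 1 :: (real^'n^'n) set))"
  by (rule prob_space_uniform_measure) (simp_all add: emeasure_cube)

lemma noise_matrix_borel [measurable]:
  "(\<lambda>(\<xi>, R). (A + \<epsilon> *\<^sub>R \<xi>) ** R) \<in> borel_measurable (borel \<Otimes>\<^sub>M (borel :: (real^'n^'n) measure))"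
  unfolding borel_prod case_prod_beta matrix_matrix_mult_def
  by (intro borel_measurable_continuous_onI continuous_intros continuous_on_vec_lambda)

lemma noise_step_measurable:
  assumes [measurable]: "(\<lambda>(R, x). \<psi> R x) \<in> borel_measurable (borel \<Otimes>\<^sub>M N)"
  shows "(\<lambda>(R, x). noise_step \<epsilon> A \<psi> R x) \<in> borel_measurable (borel \<Otimes>\<^sub>M N)"
proof -
  interpret prob_space "uniform_measure lborel (cube 1 :: (real^'n^'n) set)" by (rule prob_space_cube)
  have [measurable_cong]: "sets (uniform_measure lborel (cube 1)) = sets (borel :: (real^'n^'n) measure)"
    by simp
  show ?thesis unfolding noise_step_def by measurable
qed

lemma noise_steps_measurable:
  assumes "(\<lambda>(R, x). \<psi> R x) \<in> borel_measurable (borel \<Otimes>\<^sub>M N)"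
  shows "(\<lambda>(R, x). noise_steps \<epsilon> As \<psi> R x) \<in> borel_measurable (borel \<Otimes>\<^sub>M N)"
  by (induction As) (use assms in \<open>simp_all add: noise_step_measurable\<close>)

lemma noise_steps_right_mult:
  assumes "\<And>R x. \<psi>' R x = \<psi> (R ** T) x"
  shows "noise_steps \<epsilon> As \<psi>' R x = noise_steps \<epsilon> As \<psi> (R ** T) x"
proof (induction As arbitrary: R)
  case (Cons A As)
  show ?case unfolding noise_steps_Cons Cons matrix_mul_assoc ..
qed (simp add: assms)

text \<open>Averaging acts on the matrix only and commutes with whatever happens to x. One statement
  serves for homogeneity (h a dilation), change of basis (h a planar matrix) and degenerate flags
  (\<open>c = 0\<close>).\<close>

lemma noise_steps_scale:
  assumes \<psi>: "(\<lambda>(R, x). \<psi> R x) \<in> borel_measurable (borel \<Otimes>\<^sub>M N)" and h: "\<And>x. x \<in> space N \<Longrightarrow> h x \<in> space N"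
    and eq: "\<And>R x. x \<in> space N \<Longrightarrow> \<psi>' R x = c * \<psi> R (h x)" and x: "x \<in> space N"
  shows "noise_steps \<epsilon> As \<psi>' R x = c * noise_steps \<epsilon> As \<psi> R (h x)"
  using x
proof (induction As arbitrary: R)
  case (Cons A As)
  note [measurable] = noise_steps_measurable[OF \<psi>, of \<epsilon> As]
  have [measurable_cong]: "sets (uniform_measure lborel (cube 1)) = sets (borel :: (real^'n^'n) measure)"
    by simp
  have [measurable]: "h x \<in> space N" using h Cons.prems by blast
  show ?case
    unfolding noise_steps_Cons Cons.IH[OF Cons.prems] by (rule nn_integral_cmult) measurable
qed (use eq in simp)

definition flag_cost :: "(real^'n) set \<Rightarrow> real^'n \<Rightarrow> real^'n \<Rightarrow> real^'n^'n \<Rightarrow> real^2 \<Rightarrow> ennreal" where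
  "flag_cost W a b R x = ennreal (flag_ratio W a b R x)"

lemma flag_cost_measurable:
  "subspace W \<Longrightarrow> (\<lambda>(R, x). flag_cost W a b R x) \<in> borel_measurable (borel \<Otimes>\<^sub>M borel)"
  using flag_ratio_borel[of W a b] unfolding flag_cost_def by measurable

lemma flag_cost_steps_measurable:
  "subspace W \<Longrightarrow> (\<lambda>(R, x). noise_steps \<epsilon> As (flag_cost W a b) R x) \<in> borel_measurable (borel \<Otimes>\<^sub>M borel)"
  by (intro noise_steps_measurable flag_cost_measurable)

lemma flag_cost_steps_measurable':
  assumes "subspace W"
  shows "noise_steps \<epsilon> As (flag_cost W a b) R \<in> borel_measurable borel"
  using measurable_Pair2[OF flag_cost_steps_measurable[OF assms], of R] by simp

lemma flag_cost_steps_homogeneous: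
  assumes "subspace W" "r > 0"
  shows "ennreal r * noise_steps \<epsilon> As (flag_cost W a b) R (r *\<^sub>R x) = noise_steps \<epsilon> As (flag_cost W a b) R x"
proof -
  have eq: "flag_cost W a b R x = ennreal r * flag_cost W a b R (r *\<^sub>R x)" for R x
    unfolding flag_cost_def using assms(2) flag_ratio_scale[OF assms, of a b R x]
    by (simp add: ennreal_mult'[symmetric])
  show ?thesis
    by (rule noise_steps_scale[OF flag_cost_measurable[OF assms(1)], where h="\<lambda>x. r *\<^sub>R x", symmetric])
       (auto intro: eq)
qed

lemma flag_cost_steps_change_basis:
  fixes h :: "real^2^2"
  assumes W: "subspace W" and u: "u \<in> W" "u' \<in> W"
    and a': "a' = h$1$1 *\<^sub>R a + h$2$1 *\<^sub>R b + u" and b': "b' = h$1$2 *\<^sub>R a + h$2$2 *\<^sub>R b + u'"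
  shows "noise_steps \<epsilon> As (flag_cost W a' b') R x =
     ennreal (sqrt \<bar>det h\<bar>) * noise_steps \<epsilon> As (flag_cost W a b) R (h *v x)"
  by (rule noise_steps_scale[OF flag_cost_measurable[OF W], where h="\<lambda>x. h *v x"])
     (auto simp: flag_cost_def flag_ratio_change_basis[OF assms] ennreal_mult')

lemma flag_cost_steps_image:
  "noise_steps \<epsilon> As (flag_cost ((*v) T ` W) (T *v a) (T *v b)) R x =
     noise_steps \<epsilon> As (flag_cost W a b) (R ** T) x"
  by (rule noise_steps_right_mult) (simp add: flag_cost_def flag_ratio_image)

text \<open>Squaring turns the factor \<open>sqrt \<bar>det h\<bar>\<close> into the Jacobian. Hence
  the energy depends only on W and on the space spanned by W, a and b: this is the unitarity on
  which the argument rests.\<close>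

lemma flag_energy_change_basis:
  fixes h :: "real^2^2"
  assumes W: "subspace W" and u: "u \<in> W" "u' \<in> W"
    and a': "a' = h$1$1 *\<^sub>R a + h$2$1 *\<^sub>R b + u" and b': "b' = h$1$2 *\<^sub>R a + h$2$2 *\<^sub>R b + u'"
    and h: "det h \<noteq> 0"
  shows "annulus_energy (noise_steps \<epsilon> As (flag_cost W a' b') R) =
    annulus_energy (noise_steps \<epsilon> As (flag_cost W a b) R)"
proof -
  define f where "f = noise_steps \<epsilon> As (flag_cost W a b) R"
  have [measurable]: "f \<in> borel_measurable borel"
    unfolding f_def by (rule flag_cost_steps_measurable'[OF W])
  have "annulus_energy (noise_steps \<epsilon> As (flag_cost W a' b') R) =
      (\<integral>\<^sup>+x. ((f (h *v x))\<^sup>2 * indicator annulus x) * ennreal \<bar>det h\<bar> \<partial>lborel)"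
    unfolding annulus_energy_def flag_cost_steps_change_basis[OF assms(1-5)] f_def[symmetric]
    by (simp add: power_mult_distrib ennreal_power mult_ac)
  also have "\<dots> = (\<integral>\<^sup>+x. (f (h *v x))\<^sup>2 * indicator annulus x \<partial>lborel) * ennreal \<bar>det h\<bar>"
    by (rule nn_integral_multc) measurable
  also have "\<dots> = annulus_energy f"
    unfolding annulus_energy_def
  proof (rule annulus_integral_matrix2[OF h])
    fix r :: real and y assume r: "r > 0"
    have "(f y)\<^sup>2 = (ennreal r * f (r *\<^sub>R y))\<^sup>2"
      using flag_cost_steps_homogeneous[OF W r] by (simp add: f_def)
    then show "ennreal (r\<^sup>2) * (f (r *\<^sub>R y))\<^sup>2 = (f y)\<^sup>2"
      using r by (simp add: power_mult_distrib ennreal_power)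
  qed measurable
  finally show ?thesis by (simp add: f_def)
qed

text \<open>Gram-Schmidt on the components of a and b orthogonal to W; h is the triangular matrix of
  coefficients, invertible by independence modulo W.\<close>

lemma orthonormalize_modulo:
  fixes W :: "(real^'n) set"
  assumes W: "subspace W" and indep: "\<And>\<alpha> \<beta>. \<alpha> *\<^sub>R a + \<beta> *\<^sub>R b \<in> W \<Longrightarrow> \<alpha> = 0 \<and> \<beta> = 0"
  obtains a1 b1 u u' and h :: "real^2^2" where "norm a1 = 1" "norm b1 = 1" "a1 \<bullet> b1 = 0"
    "\<And>w. w \<in> W \<Longrightarrow> a1 \<bullet> w = 0" "\<And>w. w \<in> W \<Longrightarrow> b1 \<bullet> w = 0" "det h \<noteq> 0" "u \<in> W" "u' \<in> W"
    "a = h$1$1 *\<^sub>R a1 + h$2$1 *\<^sub>R b1 + u" "b = h$1$2 *\<^sub>R a1 + h$2$2 *\<^sub>R b1 + u'"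
proof -
  have ex: "\<exists>u z. u \<in> W \<and> v = z + u \<and> (\<forall>w\<in>W. z \<bullet> w = 0)" for v
  proof -
    obtain y z where "y \<in> span W" "\<And>w. w \<in> span W \<Longrightarrow> orthogonal z w" "v = y + z"
      using orthogonal_subspace_decomp_exists[of W v] by metis
    moreover have "span W = W" using W by (rule span_eq_iff[THEN iffD2])
    ultimately have "y \<in> W \<and> v = z + y \<and> (\<forall>w\<in>W. z \<bullet> w = 0)"
      by (simp add: orthogonal_def add.commute)
    then show ?thesis by blast
  qed
  obtain u a0 where u: "u \<in> W" "a = a0 + u" "\<forall>w\<in>W. a0 \<bullet> w = 0" using ex[of a] by blast
  obtain u' b0 where u': "u' \<in> W" "b = b0 + u'" "\<forall>w\<in>W. b0 \<bullet> w = 0" using ex[of b] by blast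
  have a0: "a0 \<noteq> 0"
  proof
    assume "a0 = 0"
    then have "1 *\<^sub>R a + 0 *\<^sub>R b \<in> W" using u by simp
    then show False using indep[of 1 0] by simp
  qed
  define a1 where "a1 = (1 / norm a0) *\<^sub>R a0"
  define c where "c = b0 - (b0 \<bullet> a1) *\<^sub>R a1"
  have a1: "norm a1 = 1" "a0 = norm a0 *\<^sub>R a1" using a0 by (simp_all add: a1_def)
  have a1W: "a1 \<bullet> w = 0" if "w \<in> W" for w using u(3) that by (simp add: a1_def)
  have cW: "c \<bullet> w = 0" if "w \<in> W" for w using u'(3) a1W that by (simp add: c_def inner_diff_left)
  have a1a1: "a1 \<bullet> a1 = 1" using a1(1) by (simp add: norm_eq_1)
  have ac: "a1 \<bullet> c = 0" by (simp add: c_def inner_diff_right a1a1 inner_commute)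
  have c: "c \<noteq> 0"
  proof
    assume "c = 0"
    then have "b0 = (b0 \<bullet> a1 / norm a0) *\<^sub>R a0" by (simp add: c_def a1_def)
    then have "b - u' = (b0 \<bullet> a1 / norm a0) *\<^sub>R (a - u)" using u(2) u'(2) by simp
    then have "(- (b0 \<bullet> a1 / norm a0)) *\<^sub>R a + 1 *\<^sub>R b = u' - (b0 \<bullet> a1 / norm a0) *\<^sub>R u"
      by (simp add: algebra_simps)
    moreover have "u' - (b0 \<bullet> a1 / norm a0) *\<^sub>R u \<in> W"
      using W u(1) u'(1) by (simp add: subspace_diff subspace_scale)
    ultimately show False using indep[of "- (b0 \<bullet> a1 / norm a0)" 1] by simp
  qed
  define b1 where "b1 = (1 / norm c) *\<^sub>R c"
  have b1: "norm b1 = 1" "c = norm c *\<^sub>R b1" using c by (simp_all add: b1_def)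
  define h :: "real^2^2" where "h = vector [vector [norm a0, b0 \<bullet> a1], vector [0, norm c]]"
  have bb: "b0 = (b0 \<bullet> a1) *\<^sub>R a1 + norm c *\<^sub>R b1" using b1(2) by (simp add: c_def)
  show ?thesis
  proof (rule that[of a1 b1 h u u'])
    show "det h \<noteq> 0" using a0 c by (simp add: det_2 h_def)
    show "a = h$1$1 *\<^sub>R a1 + h$2$1 *\<^sub>R b1 + u" using u(2) a1(2) by (simp add: h_def)
    show "b = h$1$2 *\<^sub>R a1 + h$2$2 *\<^sub>R b1 + u'" using u'(2) bb by (simp add: h_def)
  qed (use a1 b1 ac a1W cW u u' in \<open>simp_all add: b1_def\<close>)
qed

text \<open>The first factor is the volume of the small cube relative to the unit cube, and the number
  squared is \<open>l - 1\<close> for the hyperbolic matrices used at level \<open>\<epsilon>\<close>.\<close>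

definition rate :: "nat \<Rightarrow> real \<Rightarrow> real" where
  "rate d \<epsilon> = (1/2) ^ (d * d) * (\<epsilon> / (4 * (real d + 1)))\<^sup>2 / 32"

text \<open>The shifted copies of the small cube inside the unit cube realise the average over the four
  hyperbolic matrices with positive probability; on the rest of the unit cube the norm does not
  increase.\<close>

lemma noise_step_contraction_orthonormal:
  fixes W :: "(real^'n) set" and A :: "real^'n^'n"
  assumes d: "1 < CARD('n)" and W: "subspace W" and ab: "norm a = 1" "norm b = 1" "a \<bullet> b = 0"
    and orth: "\<And>u. u \<in> W \<Longrightarrow> a \<bullet> u = 0" "\<And>u. u \<in> W \<Longrightarrow> b \<bullet> u = 0"
    and e: "0 < \<epsilon>" "\<epsilon> < 1" and A: "orthogonal_matrix A"
    and K: "\<And>W a b. subspace W \<Longrightarrow> annulus_energy (noise_steps \<epsilon> As (flag_cost W a b) (mat 1)) \<le> K"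
  shows "annulus_energy (noise_steps \<epsilon> (A # As) (flag_cost W a b) (mat 1)) \<le>
    ennreal ((1 - rate CARD('n) \<epsilon>)\<^sup>2) * K"
proof -
  define l where "l = 1 + \<epsilon> / (4 * (CARD('n) + 1))"
  define p where "p = (1/2 :: real) ^ (CARD('n) * CARD('n))"
  define v where "v = (2 :: real) ^ (CARD('n) * CARD('n))"
  define \<phi> where "\<phi> = 4 - (l - 1)\<^sup>2 / 8"
  have l1: "l \<le> 13/12" "1 \<le> l"
  proof -
    have "2 \<le> real CARD('n)" using d by simp
    then have "\<epsilon> * 12 \<le> 1 * (4 * (real CARD('n) + 1))" using e by (intro mult_mono) auto
    then have "\<epsilon> / (4 * (real CARD('n) + 1)) \<le> 1 / 12" by (simp add: divide_simps)
    then show "l \<le> 13/12" "1 \<le> l" using e by (simp_all add: l_def add.commute)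
  qed
  have lp: "l > 0" using l1 by simp
  have vp: "v > 0" "p > 0" "p < 1" "p * v = 1"
    by (simp_all add: v_def p_def power_mult_distrib[symmetric] power_less_one_iff)
  have "(l - 1)\<^sup>2 \<le> 1" using l1 by (simp add: abs_square_le_1)
  then have \<phi>: "0 < \<phi>" by (simp add: \<phi>_def)
  define F where "F \<xi> = noise_steps \<epsilon> As (flag_cost W a b) (A + \<epsilon> *\<^sub>R \<xi>)" for \<xi>
  define T where "T i = plane_ext a b (hyp l i)" for i
  \<comment> \<open>Chosen such that \<open>A + \<epsilon> *\<^sub>R S i \<eta> = (A + \<epsilon>
    *\<^sub>R \<eta>) ** T i\<close>; \<open>S' i\<close> is the inverse of
    \<open>S i\<close>.\<close>
  define S where "S i \<eta> = \<eta> ** T i + (1/\<epsilon>) *\<^sub>R (A ** (T i - mat 1))" for i \<eta>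
  define S' where "S' i \<xi> = (\<xi> - (1/\<epsilon>) *\<^sub>R (A ** (T i - mat 1))) ** T (flip i)" for i \<xi>
  \<comment> \<open>The image of the small cube under \<open>S i\<close>, written as a preimage
    under the inverse so that it is visibly Borel.\<close>
  define E where "E i = S' i -` cube (1/2)" for i
  have [measurable]: "(\<lambda>(R, x). noise_steps \<epsilon> As (flag_cost W a b) R x) \<in> borel_measurable (borel \<Otimes>\<^sub>M borel)"
    by (rule flag_cost_steps_measurable[OF W])
  have [measurable]: "(\<lambda>(\<xi>, x). F \<xi> x) \<in> borel_measurable (borel \<Otimes>\<^sub>M borel)"
    unfolding F_def by measurable
  have [measurable]: "(\<lambda>\<eta> :: real^'n^'n. \<eta> ** X) \<in> borel_measurable borel" for X :: "real^'n^'n"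
    by (intro linear_imp_borel_measurable linear_matrix_mult_right)
  have [measurable]: "S i \<in> borel_measurable borel" for i
    unfolding S_def by measurable
  have [measurable]: "S' i \<in> borel_measurable borel" for i
    unfolding S'_def by measurable
  have [measurable]: "E i \<in> sets borel" for i
    unfolding E_def using measurable_sets_borel[of "S' i" borel "cube (1/2)"] by simp
  have TT: "T i ** T (flip i) = mat 1" "T (flip i) ** T i = mat 1" if "i < 4" for i
    unfolding T_def using hyp_flip_mult[OF lp that] by (simp_all add: plane_ext_mult[OF ab] plane_ext_one)
  have S'S: "S' i (S i \<eta>) = \<eta>" "S i (S' i \<eta>) = \<eta>" if "i < 4" for i \<eta>
    unfolding S_def S'_def using TT[OF that] by (simp_all add: matrix_mul_assoc[symmetric])
  have int_S: "(\<integral>\<^sup>+\<eta>. f (S i \<eta>) \<partial>lborel) = (\<integral>\<^sup>+\<eta>. f \<eta> \<partial>lborel)"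
    if "i < 4" and [measurable]: "f \<in> borel_measurable borel" for i f
  proof -
    define c where "c = (1/\<epsilon>) *\<^sub>R (A ** (T i - mat 1))"
    have "(\<integral>\<^sup>+\<eta>. f (S i \<eta>) \<partial>lborel) = (\<integral>\<^sup>+\<eta>. f (c + \<eta> ** T i) \<partial>lborel)"
      by (simp add: S_def c_def add.commute)
    also have "\<dots> = (\<integral>\<^sup>+\<eta>. f (c + \<eta>) \<partial>lborel)"
      unfolding T_def by (rule nn_integral_plane_ext[OF ab lp \<open>i < 4\<close>, of "\<lambda>\<eta>. f (c + \<eta>)"]) measurable
    also have "\<dots> = (\<integral>\<^sup>+\<eta>. f \<eta> \<partial>lborel)" by (rule nn_integral_lborel_translate) measurable
    finally show ?thesis .
  qed
  have E_sub: "E i \<subseteq> cube 1" if "i < 4" for i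
  proof
    fix \<xi> assume "\<xi> \<in> E i"
    then have "S i (S' i \<xi>) \<in> cube 1"
      using shifted_noise_in_cube[OF ab(1,2) e that A, of "S' i \<xi>"]
      unfolding S_def[of i "S' i \<xi>"] T_def l_def E_def by simp
    then show "\<xi> \<in> cube 1" by (simp add: S'S[OF that])
  qed
  have emE: "emeasure lborel (E i) = ennreal (p * v)" if "i < 4" for i
  proof -
    have "emeasure lborel (E i) = (\<integral>\<^sup>+\<xi>. indicator (E i) \<xi> \<partial>lborel)" by simp
    also have "\<dots> = (\<integral>\<^sup>+\<eta>. indicator (E i) (S i \<eta>) \<partial>lborel)"
      by (rule int_S[OF that, symmetric]) measurable
    also have "\<dots> = (\<integral>\<^sup>+\<eta>. indicator (cube (1/2) :: (real^'n^'n) set) \<eta> \<partial>lborel)"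
      by (intro nn_integral_cong) (simp add: indicator_def E_def S'S[OF that])
    also have "\<dots> = ennreal (p * v)" by (simp add: emeasure_cube vp)
    finally show ?thesis .
  qed
  have em1: "emeasure lborel (cube 1 :: (real^'n^'n) set) = ennreal v"
    by (simp add: emeasure_cube v_def)
  define m where "m = v - p * v"
  have m: "m > 0" using mult_strict_right_mono[OF vp(3,1)] by (simp add: m_def)
  have emD: "emeasure lborel (cube 1 - E i) = ennreal m" if "i < 4" for i
  proof -
    have "emeasure lborel (cube 1 - E i) = emeasure lborel (cube 1 :: (real^'n^'n) set) - emeasure lborel (E i)"
      using E_sub[OF that] emE[OF that] by (intro emeasure_Diff) auto
    also have "\<dots> = ennreal m"
      unfolding em1 emE[OF that] m_def using vp by (intro ennreal_minus) simp
    finally show ?thesis .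
  qed
  \<comment> \<open>As a and b are orthogonal to W, \<open>T i\<close> fixes W pointwise and moves a
    and b within their plane. Shifting the noise thus amounts to moving x, with no extra factor
    because the determinant is one.\<close>
  have F_S: "F (S i \<eta>) x = F \<eta> (hyp l i *v x)" if "i < 4" for i \<eta> x
  proof -
    have "A + \<epsilon> *\<^sub>R S i \<eta> = (A + \<epsilon> *\<^sub>R \<eta>) ** T i"
      using e by (simp add: S_def scaleR_add_right matrix_add_rdistrib matrix_diff_ldistrib scalar_matrix_assoc)
    then have "F (S i \<eta>) x = noise_steps \<epsilon> As (flag_cost ((*v) (T i) ` W) (T i *v a) (T i *v b)) (A + \<epsilon> *\<^sub>R \<eta>) x"
      by (simp add: F_def flag_cost_steps_image)
    also have "(*v) (T i) ` W = W"
    proof -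
      have "T i *v u = u" if "u \<in> W" for u
        using orth that by (simp add: T_def plane_ext_apply)
      then show ?thesis by force
    qed
    also have "noise_steps \<epsilon> As (flag_cost W (T i *v a) (T i *v b)) (A + \<epsilon> *\<^sub>R \<eta>) x =
       ennreal (sqrt \<bar>det (hyp l i)\<bar>) * noise_steps \<epsilon> As (flag_cost W a b) (A + \<epsilon> *\<^sub>R \<eta>) (hyp l i *v x)"
    proof (rule flag_cost_steps_change_basis[OF W subspace_0[OF W] subspace_0[OF W]])
      have aa: "a \<bullet> a = 1" "b \<bullet> b = 1" "b \<bullet> a = 0" using ab by (simp_all add: norm_eq_1 inner_commute)
      show "T i *v a = hyp l i $1$1 *\<^sub>R a + hyp l i $2$1 *\<^sub>R b + 0"
        "T i *v b = hyp l i $1$2 *\<^sub>R a + hyp l i $2$2 *\<^sub>R b + 0"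
        by (simp_all add: T_def plane_ext_apply aa ab(3) algebra_simps)
    qed
    finally show ?thesis by (simp add: F_def det_hyp[OF lp])
  qed
  \<comment> \<open>The first random factor moves the flag to an unknown and possibly degenerate
    one, which is why the hypothesis bounds all flags at once.\<close>
  have FK: "annulus_energy (F \<xi>) \<le> K" for \<xi>
  proof -
    define R where "R = A + \<epsilon> *\<^sub>R \<xi>"
    have "F \<xi> = noise_steps \<epsilon> As (flag_cost ((*v) R ` W) (R *v a) (R *v b)) (mat 1)"
      by (rule ext) (simp add: F_def flag_cost_steps_image R_def)
    then show ?thesis
      using K[OF linear_subspace_image[OF matrix_vector_mul_linear W, of R], of "R *v a" "R *v b"] by (simp only:)
  qed
  define L where "L x = (\<integral>\<^sup>+\<xi>. F \<xi> x * indicator (cube 1) \<xi> \<partial>lborel)" for x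
  define G where "G i x = (\<integral>\<^sup>+\<xi>. F \<xi> x * indicator (cube 1 - E i) \<xi> \<partial>lborel)" for i x
  define H where "H \<eta> x = (\<Sum>i<4. F \<eta> (hyp l i *v x))" for \<eta> x
  define B where "B x = (\<integral>\<^sup>+\<eta>. H \<eta> x * indicator (cube (1/2)) \<eta> \<partial>lborel)" for x
  have [measurable]: "(\<lambda>(\<eta>, x). H \<eta> x) \<in> borel_measurable (borel \<Otimes>\<^sub>M borel)"
    unfolding H_def by measurable
  have [measurable]: "G i \<in> borel_measurable borel" for i unfolding G_def by measurable
  have [measurable]: "B \<in> borel_measurable borel" unfolding B_def by measurable
  have [measurable]: "L \<in> borel_measurable borel" unfolding L_def by measurable
  have L_split: "L x = G i x + (\<integral>\<^sup>+\<eta>. F \<eta> (hyp l i *v x) * indicator (cube (1/2)) \<eta> \<partial>lborel)" if "i < 4" for i x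
  proof -
    have "L x = (\<integral>\<^sup>+\<xi>. F \<xi> x * indicator (cube 1 - E i) \<xi> + F \<xi> x * indicator (E i) \<xi> \<partial>lborel)"
      unfolding L_def using E_sub[OF that] by (intro nn_integral_cong) (auto simp: indicator_def)
    also have "\<dots> = G i x + (\<integral>\<^sup>+\<xi>. F \<xi> x * indicator (E i) \<xi> \<partial>lborel)"
      unfolding G_def by (rule nn_integral_add) measurable
    also have "(\<integral>\<^sup>+\<xi>. F \<xi> x * indicator (E i) \<xi> \<partial>lborel) = (\<integral>\<^sup>+\<eta>. F (S i \<eta>) x * indicator (E i) (S i \<eta>) \<partial>lborel)"
      by (rule int_S[OF that, symmetric]) measurable
    also have "\<dots> = (\<integral>\<^sup>+\<eta>. F \<eta> (hyp l i *v x) * indicator (cube (1/2)) \<eta> \<partial>lborel)"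
      by (intro nn_integral_cong) (simp add: F_S[OF that] indicator_def E_def S'S[OF that])
    finally show ?thesis .
  qed
  have sum4: "(\<Sum>i<4. g i) = g 0 + g 1 + g 2 + g 3" for g :: "nat \<Rightarrow> ennreal"
    unfolding lessThan_4 by (simp add: add.assoc)
  \<comment> \<open>The unit cube is split four times, once for each i, into \<open>E i\<close> and
    its complement. Pulled back to the small cube, the four integrals over \<open>E i\<close>
    combine into one integral of \<open>H\<close>, to which the spectral gap applies.\<close>
  have L4: "ennreal 4 * L x = G 0 x + G 1 x + G 2 x + G 3 x + B x" for x
  proof -
    have "ennreal 4 * L x = (\<Sum>i<4::nat. L x)" by simp
    also have "\<dots> = (\<Sum>i<4. G i x + (\<integral>\<^sup>+\<eta>. F \<eta> (hyp l i *v x) * indicator (cube (1/2)) \<eta> \<partial>lborel))"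
      by (intro sum.cong) (simp_all add: L_split)
    also have "\<dots> = (\<Sum>i<4. G i x) + B x"
      unfolding B_def H_def sum.distrib sum_distrib_right
      by (subst nn_integral_sum) auto
    finally show ?thesis by (simp only: sum4)
  qed
  have Gb: "annulus_energy (G i) \<le> ennreal (m\<^sup>2) * K" if "i < 4" for i
    unfolding G_def by (rule annulus_energy_nn_integral[OF _ _ FK emD[OF that]]) (use m in \<open>auto\<close>)
  have HK: "annulus_energy (H \<eta>) \<le> ennreal (\<phi>\<^sup>2) * K" for \<eta>
  proof -
    have "annulus_energy (H \<eta>) \<le> ennreal (\<phi>\<^sup>2) * annulus_energy (F \<eta>)"
      unfolding annulus_energy_def H_def \<phi>_def
      by (rule hyp_contraction[OF l1(2,1)]) (simp_all add: F_def flag_cost_steps_measurable'[OF W] flag_cost_steps_homogeneous[OF W])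
    also have "\<dots> \<le> ennreal (\<phi>\<^sup>2) * K" by (intro mult_left_mono FK) simp
    finally show ?thesis .
  qed
  have Bb: "annulus_energy B \<le> ennreal ((p * v * \<phi>)\<^sup>2) * K"
  proof -
    have "annulus_energy B \<le> ennreal ((p * v)\<^sup>2) * (ennreal (\<phi>\<^sup>2) * K)"
      unfolding B_def by (rule annulus_energy_nn_integral[OF _ _ HK]) (use vp in \<open>auto simp: emeasure_cube\<close>)
    then show ?thesis by (simp add: power_mult_distrib ennreal_mult mult.assoc)
  qed
  have "annulus_energy (\<lambda>x. ennreal 4 * L x) \<le> ennreal ((m + m + m + m + p * v * \<phi>)\<^sup>2) * K"
    unfolding L4 by (intro annulus_energy_add Gb Bb) (use m vp \<phi> in auto)
  moreover have "noise_steps \<epsilon> (A # As) (flag_cost W a b) (mat 1) = (\<lambda>x. ennreal (1 / (4 * v)) * (ennreal 4 * L x))"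
  proof
    fix x
    have "noise_steps \<epsilon> (A # As) (flag_cost W a b) (mat 1) x = (\<integral>\<^sup>+\<xi>. F \<xi> x \<partial>uniform_measure lborel (cube 1))"
      unfolding noise_steps_Cons F_def matrix_mul_rid ..
    also have "\<dots> = L x / ennreal v"
      unfolding L_def em1[symmetric] by (rule nn_integral_uniform_measure) auto
    also have "\<dots> = ennreal (1 / (4 * v)) * (ennreal 4 * L x)"
    proof -
      have "L x / ennreal v = ennreal (1 / v) * L x"
        unfolding divide_ennreal_def inverse_ennreal[OF vp(1)] inverse_eq_divide by (rule mult.commute)
      also have "ennreal (1 / v) = ennreal (1 / (4 * v)) * ennreal 4"
        using vp(1) by (subst ennreal_mult[symmetric]) auto
      finally show ?thesis by (simp only: mult.assoc)
    qed
    finally show "noise_steps \<epsilon> (A # As) (flag_cost W a b) (mat 1) x = ennreal (1 / (4 * v)) * (ennreal 4 * L x)" .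
  qed
  ultimately have "annulus_energy (noise_steps \<epsilon> (A # As) (flag_cost W a b) (mat 1)) \<le>
     ennreal ((1 / (4 * v))\<^sup>2) * (ennreal ((m + m + m + m + p * v * \<phi>)\<^sup>2) * K)"
  proof -
    assume L: "annulus_energy (\<lambda>x. ennreal 4 * L x) \<le> ennreal ((m + m + m + m + p * v * \<phi>)\<^sup>2) * K"
      and eq: "noise_steps \<epsilon> (A # As) (flag_cost W a b) (mat 1) = (\<lambda>x. ennreal (1 / (4 * v)) * (ennreal 4 * L x))"
    have "annulus_energy (\<lambda>x. ennreal (1 / (4 * v)) * (ennreal 4 * L x)) =
       ennreal ((1 / (4 * v))\<^sup>2) * annulus_energy (\<lambda>x. ennreal 4 * L x)"
      using vp(1) by (intro annulus_energy_cmult) auto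
    also have "\<dots> \<le> ennreal ((1 / (4 * v))\<^sup>2) * (ennreal ((m + m + m + m + p * v * \<phi>)\<^sup>2) * K)"
      using L by (rule mult_left_mono) simp
    finally show ?thesis unfolding eq .
  qed
  also have "\<dots> = ennreal ((1 / (4 * v) * (m + m + m + m + p * v * \<phi>))\<^sup>2) * K"
    unfolding power_mult_distrib by (subst ennreal_mult) (auto simp: mult.assoc)
  \<comment> \<open>With \<open>m = (1 - p) * v\<close> this is
    \<open>1 - p + p * \<phi> / 4\<close>: the share p of the mass gains the factor
    \<open>\<phi> / 4 = 1 - (l - 1)^2 / 32\<close>, and the rest gains nothing.\<close>
  also have "1 / (4 * v) * (m + m + m + m + p * v * \<phi>) = 1 - rate CARD('n) \<epsilon>"
  proof -
    have "1 / (4 * v) * (m + m + m + m + p * v * \<phi>) = 1 - p * (l - 1)\<^sup>2 / 32"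
      using vp(1) by (simp add: m_def \<phi>_def field_simps)
    then show ?thesis by (simp add: rate_def p_def l_def add.commute)
  qed
  finally show ?thesis .
qed

text \<open>A pair dependent modulo W has energy 0, and any other has the energy of an orthonormal
  pair orthogonal to W. Only for such pairs does \<open>plane_ext\<close> act as a planar map that
  leaves W alone.\<close>

lemma flag_energy_orthonormal_reduction:
  fixes W :: "(real^'n) set"
  assumes W: "subspace W"
    and X: "\<And>a b. \<lbrakk>norm a = 1; norm b = 1; a \<bullet> b = 0; \<And>w. w \<in> W \<Longrightarrow> a \<bullet> w = 0; \<And>w. w \<in> W \<Longrightarrow> b \<bullet> w = 0\<rbrakk>
      \<Longrightarrow> annulus_energy (noise_steps \<epsilon> As (flag_cost W a b) (mat 1)) \<le> X"
  shows "annulus_energy (noise_steps \<epsilon> As (flag_cost W a b) (mat 1)) \<le> X"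
proof (cases "\<exists>\<alpha> \<beta>. (\<alpha> \<noteq> 0 \<or> \<beta> \<noteq> 0) \<and> \<alpha> *\<^sub>R a + \<beta> *\<^sub>R b \<in> W")
  case True
  then obtain \<alpha> \<beta> where "\<alpha> \<noteq> 0 \<or> \<beta> \<noteq> 0" "\<alpha> *\<^sub>R a + \<beta> *\<^sub>R b \<in> W" by blast
  then have z: "flag_cost W a b R x = 0" for R x
    unfolding flag_cost_def by (subst flag_ratio_dependent[OF W]) auto
  have "noise_steps \<epsilon> As (flag_cost W a b) (mat 1) x = 0 * noise_steps \<epsilon> As (flag_cost W a b) (mat 1) x" for x
    by (rule noise_steps_scale[OF flag_cost_measurable[OF W], where h="\<lambda>x. x"]) (auto simp: z)
  then have "noise_steps \<epsilon> As (flag_cost W a b) (mat 1) = (\<lambda>x. 0)" by (simp add: fun_eq_iff)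
  then show ?thesis by (simp add: annulus_energy_def)
next
  case False
  then have indep: "\<alpha> = 0 \<and> \<beta> = 0" if "\<alpha> *\<^sub>R a + \<beta> *\<^sub>R b \<in> W" for \<alpha> \<beta>
    using that by blast
  show ?thesis
  proof (rule orthonormalize_modulo[OF W indep])
    fix a1 b1 u u' and h :: "real^2^2"
    assume h: "norm a1 = 1" "norm b1 = 1" "a1 \<bullet> b1 = 0"
      "\<And>w. w \<in> W \<Longrightarrow> a1 \<bullet> w = 0" "\<And>w. w \<in> W \<Longrightarrow> b1 \<bullet> w = 0" "det h \<noteq> 0" "u \<in> W" "u' \<in> W"
      "a = h$1$1 *\<^sub>R a1 + h$2$1 *\<^sub>R b1 + u" "b = h$1$2 *\<^sub>R a1 + h$2$2 *\<^sub>R b1 + u'"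
    show ?thesis
      unfolding flag_energy_change_basis[OF W h(7,8,9,10,6)] by (rule X[OF h(1-5)])
  qed
qed

lemma noise_step_contraction:
  fixes W :: "(real^'n) set" and A :: "real^'n^'n"
  assumes d: "1 < CARD('n)" and W: "subspace W"
    and e: "0 < \<epsilon>" "\<epsilon> < 1" and A: "orthogonal_matrix A"
    and K: "\<And>W a b. subspace W \<Longrightarrow> annulus_energy (noise_steps \<epsilon> As (flag_cost W a b) (mat 1)) \<le> K"
  shows "annulus_energy (noise_steps \<epsilon> (A # As) (flag_cost W a b) (mat 1)) \<le>
    ennreal ((1 - rate CARD('n) \<epsilon>)\<^sup>2) * K"
  by (rule flag_energy_orthonormal_reduction[OF W],
      rule noise_step_contraction_orthonormal[OF d W _ _ _ _ _ e A K])

lemma rate_bounds: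
  assumes "0 < \<epsilon>" "\<epsilon> < 1"
  shows "0 < rate d \<epsilon>" "rate d \<epsilon> < 1"
proof -
  show "0 < rate d \<epsilon>" unfolding rate_def using assms by (intro divide_pos_pos mult_pos_pos zero_less_power) (auto intro: add_nonneg_pos)
  have "\<epsilon> / (4 * (real d + 1)) \<le> 1" using assms by (simp add: divide_simps)
  then have "(\<epsilon> / (4 * (real d + 1)))\<^sup>2 \<le> 1" using assms by (simp add: abs_square_le_1)
  moreover have "(1/2 :: real) ^ (d * d) \<le> 1" by (simp add: power_le_one)
  ultimately have "(1/2 :: real) ^ (d * d) * (\<epsilon> / (4 * (real d + 1)))\<^sup>2 \<le> 1 * 1" by (intro mult_mono) auto
  then show "rate d \<epsilon> < 1" unfolding rate_def by simp
qed

lemma annulus_finite: "emeasure lborel annulus < \<infinity>"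
  by (rule emeasure_bounded_finite) (auto simp: annulus_def bounded_iff)

lemma annulus_energy_initial:
  fixes W :: "(real^'n) set"
  assumes W: "subspace W"
  shows "annulus_energy (noise_steps \<epsilon> [] (flag_cost W a b) (mat 1)) \<le> emeasure lborel annulus"
proof (rule flag_energy_orthonormal_reduction[OF W])
  fix a b :: "real^'n"
  assume ab: "norm a = 1" "norm b = 1" "a \<bullet> b = 0" "\<And>w. w \<in> W \<Longrightarrow> a \<bullet> w = 0" "\<And>w. w \<in> W \<Longrightarrow> b \<bullet> w = 0"
  have "annulus_energy (noise_steps \<epsilon> [] (flag_cost W a b) (mat 1)) \<le> (\<integral>\<^sup>+x. indicator annulus x \<partial>lborel)"
    unfolding annulus_energy_def
  proof (rule nn_integral_mono)
    fix x
    have "(ennreal (1 / norm x))\<^sup>2 \<le> 1" if "x \<in> annulus"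
    proof -
      have "1 / norm x \<le> 1" using that by (simp add: annulus_def divide_simps)
      then have "(1 / norm x)\<^sup>2 \<le> 1" by (simp add: abs_square_le_1)
      then have "ennreal ((1 / norm x)\<^sup>2) \<le> ennreal 1" by (rule ennreal_leI)
      then show ?thesis by (simp add: ennreal_power)
    qed
    then show "(noise_steps \<epsilon> [] (flag_cost W a b) (mat 1) x)\<^sup>2 * indicator annulus x \<le> indicator annulus x"
      by (auto simp: flag_cost_def flag_ratio_orthonormal[OF W ab] indicator_def)
  qed
  then show "annulus_energy (noise_steps \<epsilon> [] (flag_cost W a b) (mat 1)) \<le> emeasure lborel annulus" by simp
qed

text \<open>The induction peels off the first factor, which replaces the flag by a random one; the
  bound therefore has to be carried along for all flags.\<close>

lemma annulus_energy_decay: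
  fixes W :: "(real^'n) set"
  assumes d: "1 < CARD('n)" and e: "0 < \<epsilon>" "\<epsilon> < 1"
    and As: "\<And>A. A \<in> set As \<Longrightarrow> orthogonal_matrix A" and W: "subspace W"
  shows "annulus_energy (noise_steps \<epsilon> As (flag_cost W a b) (mat 1)) \<le>
    ennreal (((1 - rate CARD('n) \<epsilon>) ^ length As)\<^sup>2) * emeasure lborel annulus"
  using As W
proof (induction As arbitrary: W a b)
  case Nil
  then show ?case using annulus_energy_initial[OF Nil(2), of \<epsilon> a b] by simp
next
  case (Cons A As)
  have "annulus_energy (noise_steps \<epsilon> (A # As) (flag_cost W a b) (mat 1)) \<le>
     ennreal ((1 - rate CARD('n) \<epsilon>)\<^sup>2) *
      (ennreal (((1 - rate CARD('n) \<epsilon>) ^ length As)\<^sup>2) * emeasure lborel annulus)"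
    by (rule noise_step_contraction[OF d Cons.prems(2) e]) (use Cons in auto)
  also have "\<dots> = ennreal (((1 - rate CARD('n) \<epsilon>) ^ length (A # As))\<^sup>2) * emeasure lborel annulus"
    by (simp add: power_mult_distrib ennreal_mult mult.assoc)
  finally show ?case .
qed

subsection \<open>Independence of the noise\<close>

text \<open>The intersection lies between an open and a closed box of equal volume; the outer
  maximum with 0 covers the empty case. General dimension lets the same formula serve both for a
  single entry and for the whole matrix.\<close>

lemma emeasure_unit_cube_Int_box:
  fixes l u :: "'a::euclidean_space"
  shows "emeasure lborel (cbox (- One) One \<inter> box l u) =
    (\<Prod>b\<in>Basis. ennreal (max 0 (min 1 (u \<bullet> b) - max (- 1) (l \<bullet> b))))"
proof -
  define l' where "l' = (\<Sum>b\<in>Basis. max (- 1) (l \<bullet> b) *\<^sub>R b)"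
  define u' where "u' = (\<Sum>b\<in>Basis. min 1 (u \<bullet> b) *\<^sub>R b)"
  have lb: "l' \<bullet> b = max (- 1) (l \<bullet> b)" "u' \<bullet> b = min 1 (u \<bullet> b)" "One \<bullet> b = 1" if "b \<in> Basis" for b
    using that by (simp_all add: l'_def u'_def inner_sum_left inner_Basis if_distrib cong: if_cong)
  have sub: "box l' u' \<subseteq> cbox (- One) One \<inter> box l u" "cbox (- One) One \<inter> box l u \<subseteq> cbox l' u'"
    by (auto simp: mem_box lb less_imp_le)
  have prod: "ennreal (if \<forall>b\<in>Basis. l' \<bullet> b \<le> u' \<bullet> b then \<Prod>b\<in>Basis. (u' - l') \<bullet> b else 0) =
      (\<Prod>b\<in>Basis. ennreal (max 0 (min 1 (u \<bullet> b) - max (- 1) (l \<bullet> b))))"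
  proof (cases "\<forall>b\<in>Basis. l' \<bullet> b \<le> u' \<bullet> b")
    case True
    then have "ennreal (\<Prod>b\<in>Basis. (u' - l') \<bullet> b) = (\<Prod>b\<in>Basis. ennreal ((u' - l') \<bullet> b))"
      by (intro prod_ennreal[symmetric]) (simp add: inner_diff_left)
    also have "\<dots> = (\<Prod>b\<in>Basis. ennreal (max 0 (min 1 (u \<bullet> b) - max (- 1) (l \<bullet> b))))"
      using True by (intro prod.cong refl arg_cong[of _ _ ennreal]) (simp add: inner_diff_left lb)
    finally show ?thesis unfolding if_P[OF True] .
  next
    case False
    then obtain b where b: "b \<in> Basis" "\<not> l' \<bullet> b \<le> u' \<bullet> b" by blast
    then have "min 1 (u \<bullet> b) - max (- 1) (l \<bullet> b) \<le> 0" by (simp only: lb)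
    then have "ennreal (max 0 (min 1 (u \<bullet> b) - max (- 1) (l \<bullet> b))) = 0" by (simp only: max_absorb1 ennreal_0)
    then have "(\<Prod>b\<in>Basis. ennreal (max 0 (min 1 (u \<bullet> b) - max (- 1) (l \<bullet> b)))) = 0"
      using b(1) by (intro prod_zero) auto
    then show ?thesis unfolding if_not_P[OF False] by (simp only: ennreal_0)
  qed
  have "emeasure lborel (box l' u') \<le> emeasure lborel (cbox (- One) One \<inter> box l u)"
    by (rule emeasure_mono[OF sub(1)]) simp
  moreover have "emeasure lborel (cbox (- One) One \<inter> box l u) \<le> emeasure lborel (cbox l' u')"
    by (rule emeasure_mono[OF sub(2)]) simp
  ultimately show ?thesis
    unfolding emeasure_lborel_box_eq emeasure_lborel_cbox_eq prod by (rule antisym[rotated])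
qed

lemma bij_betw_matrix_Basis:
  "bij_betw (\<lambda>(i, j). axis i (axis j 1)) UNIV (Basis :: (real^'n^'m) set)"
  unfolding bij_betw_def by (auto simp: inj_on_def axis_eq_axis Basis_vec_def)

lemma prod_matrix_Basis:
  "(\<Prod>b\<in>(Basis :: (real^'n^'m) set). f b) = (\<Prod>ij\<in>UNIV. f (axis (fst ij) (axis (snd ij) 1)))"
  using prod.reindex_bij_betw[OF bij_betw_matrix_Basis, of f, symmetric] by (simp add: case_prod_beta)

text \<open>Open boxes are an intersection-stable generator, and on them both measures are products
  over the entries: one by independence, the other by the volume formula.\<close>

lemma uniform_noise_distr:
  fixes \<Xi> :: "nat \<Rightarrow> 'w \<Rightarrow> real^'n^'n"
  assumes noise: "uniform_noise M \<Xi>" and n: "n \<ge> 1"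
  shows "distr M borel (\<Xi> n) = uniform_measure lborel (cube 1)"
proof (rule measure_eqI_generator_eq)
  interpret prob_space M using noise by (simp add: uniform_noise_def)
  have [measurable]: "\<Xi> n \<in> borel_measurable M"
    using noise n by (auto simp: uniform_noise_def indep_vars_def)
  have ind: "indep_vars (\<lambda>_. borel) (\<lambda>(i, j) \<omega>. \<Xi> n \<omega> $ i $ j) UNIV"
    using noise n by (simp add: uniform_noise_def)
  have rv: "(\<lambda>\<omega>. \<Xi> n \<omega> $ i $ j) \<in> borel_measurable M" for i j
    using ind unfolding indep_vars_def by auto
  let ?E = "range (\<lambda>(a, b). box a b :: (real^'n^'n) set)"
  let ?len = "\<lambda>l u :: real^'n^'n. \<lambda>ij. max 0 (min 1 (u $ fst ij $ snd ij) - max (- 1) (l $ fst ij $ snd ij)) :: real"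
  show "Int_stable ?E" by (auto simp: Int_stable_def box_Int_box)
  show "?E \<subseteq> Pow UNIV" "sets (distr M borel (\<Xi> n)) = sigma_sets UNIV ?E"
    "sets (uniform_measure lborel (cube 1)) = sigma_sets UNIV ?E"
    by (simp_all add: borel_eq_box)
  let ?A = "\<lambda>n::nat. box (- (real n *\<^sub>R One)) (real n *\<^sub>R One) :: (real^'n^'n) set"
  show "range ?A \<subseteq> ?E" "(\<Union>i. ?A i) = UNIV" unfolding UN_box_eq_UNIV by auto
  show "emeasure (distr M borel (\<Xi> n)) (?A i) \<noteq> \<infinity>" for i
    by (subst emeasure_distr) auto
  fix X assume "X \<in> ?E"
  then obtain l u where X: "X = box l u" by auto
  have one: "prob ((\<lambda>\<omega>. \<Xi> n \<omega> $ i $ j) -` {l$i$j<..<u$i$j} \<inter> space M) = ?len l u (i, j) / 2" for i j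
  proof -
    have "emeasure (distr M lborel (\<lambda>\<omega>. \<Xi> n \<omega> $ i $ j)) {l$i$j<..<u$i$j} =
        emeasure (uniform_measure lborel {-1..1}) {l$i$j<..<u$i$j}"
      using noise n by (simp add: uniform_noise_def)
    also have "\<dots> = emeasure lborel (cbox (- One) One \<inter> box (l$i$j) (u$i$j)) / 2"
      by (simp add: cbox_interval box_real)
    also have "\<dots> = ennreal (?len l u (i, j) / 2)"
      unfolding emeasure_unit_cube_Int_box
      by (simp add: divide_ennreal[symmetric])
    finally show ?thesis
      using rv[of i j] by (simp add: emeasure_distr emeasure_eq_measure)
  qed
  have "\<Xi> n -` box l u \<inter> space M =
     (\<Inter>ij\<in>UNIV. (\<lambda>\<omega>. \<Xi> n \<omega> $ fst ij $ snd ij) -` {l$fst ij$snd ij<..<u$fst ij$snd ij} \<inter> space M)"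
    by (auto simp: mem_box_cart mem_box Basis_vec_def inner_axis)
  moreover have "prob (\<Inter>ij\<in>UNIV. (\<lambda>\<omega>. \<Xi> n \<omega> $ fst ij $ snd ij) -` {l$fst ij$snd ij<..<u$fst ij$snd ij} \<inter> space M) =
     (\<Prod>ij\<in>UNIV. prob ((\<lambda>\<omega>. \<Xi> n \<omega> $ fst ij $ snd ij) -` {l$fst ij$snd ij<..<u$fst ij$snd ij} \<inter> space M))"
    using indep_varsD_finite[OF ind, of "\<lambda>ij. {l$fst ij$snd ij<..<u$fst ij$snd ij}"] by (simp add: case_prod_beta)
  ultimately have "prob (\<Xi> n -` box l u \<inter> space M) = (\<Prod>ij\<in>UNIV. ?len l u ij / 2)"
    by (simp add: one)
  then have lhs: "emeasure (distr M borel (\<Xi> n)) X = ennreal (\<Prod>ij\<in>UNIV. ?len l u ij / 2)"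
    unfolding X by (subst emeasure_distr) (auto simp: emeasure_eq_measure)
  have "emeasure (uniform_measure lborel (cube 1)) X =
      emeasure lborel (cbox (- One) One \<inter> box l u) / emeasure lborel (cube 1 :: (real^'n^'n) set)"
    unfolding X by (subst emeasure_uniform_measure) (auto simp: cube_eq_cbox)
  also have "emeasure lborel (cbox (- One) One \<inter> box l u) = (\<Prod>ij\<in>UNIV. ennreal (?len l u ij))"
    unfolding emeasure_unit_cube_Int_box prod_matrix_Basis by (simp add: inner_axis)
  also have "\<dots> = ennreal (\<Prod>ij\<in>UNIV. ?len l u ij)" by (rule prod_ennreal) simp
  also have "emeasure lborel (cube 1 :: (real^'n^'n) set) = ennreal (\<Prod>ij\<in>(UNIV :: ('n \<times> 'n) set). 2)"
    by (simp add: emeasure_cube)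
  also have "ennreal (\<Prod>ij\<in>UNIV. ?len l u ij) / ennreal (\<Prod>ij\<in>(UNIV :: ('n \<times> 'n) set). 2) =
     ennreal (\<Prod>ij\<in>UNIV. ?len l u ij / 2)"
    unfolding prod_dividef by (intro divide_ennreal) (auto intro: prod_nonneg prod_pos)
  finally show "emeasure (distr M borel (\<Xi> n)) X = emeasure (uniform_measure lborel (cube 1)) X"
    using lhs by simp
qed

section \<open>Decay of the annulus average along the random product\<close>

lemma perturbed_product_cong:
  "(\<And>k. 1 \<le> k \<Longrightarrow> k \<le> n \<Longrightarrow> X k = Y k) \<Longrightarrow> perturbed_product \<epsilon> A X n = perturbed_product \<epsilon> A Y n"
  by (induction n) auto

lemma matrix_mult_borel [measurable (raw)]:
  fixes f :: "'a \<Rightarrow> real^'n^'m" and g :: "'a \<Rightarrow> real^'k^'n"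
  assumes [measurable]: "f \<in> borel_measurable M" "g \<in> borel_measurable M"
  shows "(\<lambda>x. f x ** g x) \<in> borel_measurable M"
proof -
  have "(\<lambda>p :: (real^'n^'m) \<times> (real^'k^'n). fst p ** snd p) \<in> borel_measurable borel"
    unfolding matrix_matrix_mult_def
    by (intro borel_measurable_continuous_onI continuous_intros continuous_on_vec_lambda)
  then have "(\<lambda>p :: (real^'n^'m) \<times> (real^'k^'n). fst p ** snd p) \<in> borel_measurable (borel \<Otimes>\<^sub>M borel)"
    by (simp add: borel_prod)
  from measurable_compose[OF _ this, of "\<lambda>x. (f x, g x)" M] show ?thesis by simp
qed

lemma perturbed_product_borel:
  assumes "\<And>k. 1 \<le> k \<Longrightarrow> k \<le> n \<Longrightarrow> (\<lambda>\<omega>. X \<omega> k) \<in> borel_measurable M"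
  shows "(\<lambda>\<omega>. perturbed_product \<epsilon> A (X \<omega>) n) \<in> borel_measurable M"
  using assms
proof (induction n)
  case (Suc n)
  have [measurable]: "(\<lambda>\<omega>. X \<omega> (Suc n)) \<in> borel_measurable M" using Suc.prems by simp
  have [measurable]: "(\<lambda>\<omega>. perturbed_product \<epsilon> A (X \<omega>) n) \<in> borel_measurable M"
    using Suc by simp
  show ?case by simp
qed simp

text \<open>The last factor is independent of the product of the earlier ones, and integrating it
  out turns \<psi> into another function of the earlier product. The induction thus needs arbitrary
  \<psi>, and it runs from the end of the list opposite to the one used for the energy
  decay.\<close>

lemma expectation_perturbed_product:
  fixes \<Xi> :: "nat \<Rightarrow> 'w \<Rightarrow> real^'n^'n"
  assumes noise: "uniform_noise M \<Xi>" and \<psi>: "(\<lambda>(R, x). \<psi> R x) \<in> borel_measurable (borel \<Otimes>\<^sub>M N)"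
    and x: "x \<in> space N"
  shows "(\<integral>\<^sup>+\<omega>. \<psi> (perturbed_product \<epsilon> A (\<lambda>k. \<Xi> k \<omega>) n) x \<partial>M) =
    noise_steps \<epsilon> (map A [1..<Suc n]) \<psi> (mat 1) x"
  using \<psi>
proof (induction n arbitrary: \<psi>)
  case 0
  interpret prob_space M using noise by (simp add: uniform_noise_def)
  show ?case by (simp add: emeasure_space_1)
next
  case (Suc n)
  interpret prob_space M using noise by (simp add: uniform_noise_def)
  note [measurable] = Suc.prems x
  define R where "R \<omega> = perturbed_product \<epsilon> A (\<lambda>k. \<Xi> k \<omega>) n" for \<omega>
  have ind: "indep_vars (\<lambda>_. borel) \<Xi> {1..}" using noise by (simp add: uniform_noise_def)
  have pm: "(\<lambda>f. perturbed_product \<epsilon> A f n) \<in> borel_measurable (PiM {1..n} (\<lambda>_. borel))"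
  proof (rule perturbed_product_borel)
    fix k assume "1 \<le> k" "k \<le> n"
    then show "(\<lambda>f. f k) \<in> borel_measurable (PiM {1..n} (\<lambda>_. borel))"
      by (intro measurable_component_singleton) simp
  qed
  have "indep_var borel ((\<lambda>f. perturbed_product \<epsilon> A f n) \<circ> (\<lambda>\<omega>. restrict (\<lambda>i. \<Xi> i \<omega>) {1..n}))
     borel ((\<lambda>f. f (Suc n)) \<circ> (\<lambda>\<omega>. restrict (\<lambda>i. \<Xi> i \<omega>) {Suc n}))"
    by (intro indep_var_compose[OF indep_var_restrict[OF ind]] pm) auto
  also have "(\<lambda>f. perturbed_product \<epsilon> A f n) \<circ> (\<lambda>\<omega>. restrict (\<lambda>i. \<Xi> i \<omega>) {1..n}) = R"
    unfolding R_def o_def by (intro ext perturbed_product_cong) simp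
  also have "(\<lambda>f. f (Suc n)) \<circ> (\<lambda>\<omega>. restrict (\<lambda>i. \<Xi> i \<omega>) {Suc n}) = \<Xi> (Suc n)"
    by (auto simp: o_def)
  finally have iv: "indep_var borel R borel (\<Xi> (Suc n))" .
  have [measurable]: "R \<in> borel_measurable M" "\<Xi> (Suc n) \<in> borel_measurable M"
    using indep_var_rv1[OF iv] indep_var_rv2[OF iv] by auto
  have joint: "distr M borel R \<Otimes>\<^sub>M distr M borel (\<Xi> (Suc n)) = distr M (borel \<Otimes>\<^sub>M borel) (\<lambda>\<omega>. (R \<omega>, \<Xi> (Suc n) \<omega>))"
    using iv by (simp add: indep_var_distribution_eq)
  interpret N: prob_space "distr M borel (\<Xi> (Suc n))" by (rule prob_space_distr) measurable
  have "(\<integral>\<^sup>+\<omega>. \<psi> (perturbed_product \<epsilon> A (\<lambda>k. \<Xi> k \<omega>) (Suc n)) x \<partial>M) =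
     (\<integral>\<^sup>+\<omega>. (\<lambda>(r, \<xi>). \<psi> ((A (Suc n) + \<epsilon> *\<^sub>R \<xi>) ** r) x) (R \<omega>, \<Xi> (Suc n) \<omega>) \<partial>M)"
    by (simp add: R_def)
  also have "\<dots> = (\<integral>\<^sup>+p. (\<lambda>(r, \<xi>). \<psi> ((A (Suc n) + \<epsilon> *\<^sub>R \<xi>) ** r) x) p
      \<partial>distr M (borel \<Otimes>\<^sub>M borel) (\<lambda>\<omega>. (R \<omega>, \<Xi> (Suc n) \<omega>)))"
    by (rule nn_integral_distr[symmetric]) measurable
  also have "\<dots> = (\<integral>\<^sup>+p. (\<lambda>(r, \<xi>). \<psi> ((A (Suc n) + \<epsilon> *\<^sub>R \<xi>) ** r) x) p
      \<partial>(distr M borel R \<Otimes>\<^sub>M distr M borel (\<Xi> (Suc n))))"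
    by (simp only: joint)
  also have "\<dots> = (\<integral>\<^sup>+r. \<integral>\<^sup>+\<xi>. \<psi> ((A (Suc n) + \<epsilon> *\<^sub>R \<xi>) ** r) x \<partial>distr M borel (\<Xi> (Suc n)) \<partial>distr M borel R)"
    by (subst N.nn_integral_fst[symmetric]) auto
  also have "\<dots> = (\<integral>\<^sup>+r. noise_step \<epsilon> (A (Suc n)) \<psi> r x \<partial>distr M borel R)"
    unfolding noise_step_def uniform_noise_distr[OF noise, of "Suc n", simplified] ..
  also have "\<dots> = (\<integral>\<^sup>+\<omega>. noise_step \<epsilon> (A (Suc n)) \<psi> (R \<omega>) x \<partial>M)"
    using measurable_Pair1[OF noise_step_measurable[OF Suc.prems, of \<epsilon> "A (Suc n)"] x]
    by (intro nn_integral_distr) simp_all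
  also have "\<dots> = noise_steps \<epsilon> (map A [1..<Suc n]) (noise_step \<epsilon> (A (Suc n)) \<psi>) (mat 1) x"
    unfolding R_def by (rule Suc.IH) (rule noise_step_measurable[OF Suc.prems])
  finally show ?case by simp
qed

text \<open>Fubini moves the expectation inside, where it becomes the iterated average.
  Cauchy-Schwarz on the annulus, a set of finite measure, then passes from the square norm to the
  integral.\<close>

lemma expectation_annulus_flag_cost:
  fixes \<Xi> :: "nat \<Rightarrow> 'w \<Rightarrow> real^'n^'n" and W :: "(real^'n) set"
  assumes d: "1 < CARD('n)" and noise: "uniform_noise M \<Xi>" and e: "0 < \<epsilon>" "\<epsilon> < 1"
    and A: "\<And>n. 1 \<le> n \<Longrightarrow> orthogonal_matrix (A n)" and W: "subspace W"
  shows "(\<integral>\<^sup>+\<omega>. (\<integral>\<^sup>+x. flag_cost W a b (perturbed_product \<epsilon> A (\<lambda>k. \<Xi> k \<omega>) n) x * indicator annulus x \<partial>lborel) \<partial>M)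
    \<le> ennreal ((1 - rate CARD('n) \<epsilon>) ^ n) * emeasure lborel annulus"
proof -
  interpret prob_space M using noise by (simp add: uniform_noise_def)
  interpret P: pair_sigma_finite M lborel by standard
  define R where "R \<omega> = perturbed_product \<epsilon> A (\<lambda>k. \<Xi> k \<omega>) n" for \<omega>
  have [measurable]: "R \<in> borel_measurable M"
    unfolding R_def using noise
    by (intro perturbed_product_borel) (auto simp: uniform_noise_def indep_vars_def)
  note [measurable] = flag_cost_measurable[OF W, of a b]
  define f where "f = noise_steps \<epsilon> (map A [1..<Suc n]) (flag_cost W a b) (mat 1)"
  have [measurable]: "f \<in> borel_measurable borel"
    unfolding f_def by (rule flag_cost_steps_measurable'[OF W])
  define V where "V = measure lborel annulus"
  have V: "emeasure lborel annulus = ennreal V"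
    unfolding V_def using annulus_finite by (intro emeasure_eq_ennreal_measure) auto
  define k where "k = (1 - rate CARD('n) \<epsilon>) ^ n"
  have k: "0 \<le> k" using rate_bounds[OF e] by (simp add: k_def less_imp_le)
  have "(\<integral>\<^sup>+\<omega>. (\<integral>\<^sup>+x. flag_cost W a b (R \<omega>) x * indicator annulus x \<partial>lborel) \<partial>M) =
     (\<integral>\<^sup>+x. (\<integral>\<^sup>+\<omega>. flag_cost W a b (R \<omega>) x * indicator annulus x \<partial>M) \<partial>lborel)"
    by (rule P.Fubini'[symmetric]) measurable
  also have "\<dots> = (\<integral>\<^sup>+x. f x * indicator annulus x \<partial>lborel)"
  proof (rule nn_integral_cong)
    fix x
    have "(\<integral>\<^sup>+\<omega>. flag_cost W a b (R \<omega>) x * indicator annulus x \<partial>M) =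
        (\<integral>\<^sup>+\<omega>. flag_cost W a b (R \<omega>) x \<partial>M) * indicator annulus x"
      by (rule nn_integral_multc) measurable
    also have "(\<integral>\<^sup>+\<omega>. flag_cost W a b (R \<omega>) x \<partial>M) = f x"
      unfolding R_def f_def by (rule expectation_perturbed_product[OF noise flag_cost_measurable[OF W]]) simp
    finally show "(\<integral>\<^sup>+\<omega>. flag_cost W a b (R \<omega>) x * indicator annulus x \<partial>M) = f x * indicator annulus x" .
  qed
  finally have eq: "(\<integral>\<^sup>+\<omega>. (\<integral>\<^sup>+x. flag_cost W a b (R \<omega>) x * indicator annulus x \<partial>lborel) \<partial>M) =
     (\<integral>\<^sup>+x. f x * indicator annulus x \<partial>lborel)" (is "_ = ?I") .
  have ind: "(indicator annulus x :: ennreal) * indicator annulus x = indicator annulus x" for x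
    by (simp add: indicator_def)
  define I where "I = ?I"
  have "I\<^sup>2 = (\<integral>\<^sup>+x. (f x * indicator annulus x) * indicator annulus x \<partial>lborel)\<^sup>2"
    by (simp add: mult.assoc ind I_def)
  also have "\<dots> \<le> (\<integral>\<^sup>+x. (f x * indicator annulus x)\<^sup>2 \<partial>lborel) * (\<integral>\<^sup>+x. (indicator annulus x)\<^sup>2 \<partial>lborel)"
    by (rule Cauchy_Schwarz_nn_integral) measurable
  also have "\<dots> = annulus_energy f * ennreal V"
    by (simp add: power_mult_distrib power2_eq_square[of "indicator annulus _"] ind V annulus_energy_def)
  also have "\<dots> \<le> (ennreal (k\<^sup>2) * ennreal V) * ennreal V"
  proof (rule mult_right_mono)
    have "annulus_energy f \<le> ennreal (((1 - rate CARD('n) \<epsilon>) ^ length (map A [1..<Suc n]))\<^sup>2) * emeasure lborel annulus"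
      unfolding f_def by (rule annulus_energy_decay[OF d e _ W]) (use A in auto)
    then show "annulus_energy f \<le> ennreal (k\<^sup>2) * ennreal V"
      by (simp add: k_def V del: upt_Suc)
  qed simp
  also have "\<dots> = (ennreal (k * V))\<^sup>2"
  proof -
    have V0: "0 \<le> V" by (simp add: V_def)
    have "(ennreal (k * V))\<^sup>2 = ennreal ((k * V)\<^sup>2)" using k V0 by (intro ennreal_power) simp
    also have "(k * V)\<^sup>2 = k\<^sup>2 * V * V" by (simp add: power2_eq_square)
    also have "ennreal (k\<^sup>2 * V * V) = ennreal (k\<^sup>2) * ennreal V * ennreal V"
      using V0 by (subst ennreal_mult, simp, simp)+ simp
    finally show ?thesis by simp
  qed
  also have "(ennreal (k * V))\<^sup>2 = ennreal ((k * V)\<^sup>2)"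
    using k by (intro ennreal_power) (simp add: V_def)
  finally have sq: "I\<^sup>2 \<le> ennreal ((k * V)\<^sup>2)" .
  have "I \<noteq> \<top>"
  proof
    assume "I = \<top>"
    then have "I\<^sup>2 = \<top>" by (simp add: power2_eq_square)
    with sq have "ennreal ((k * V)\<^sup>2) = \<top>" by (simp only: top_le)
    then show False by (rule ennreal_neq_top[THEN notE])
  qed
  then have "I < \<top>" by (simp only: less_top)
  define r where "r = enn2real I"
  have r: "I = ennreal r" "r \<ge> 0"
    unfolding r_def using \<open>I < \<top>\<close> by (rule ennreal_enn2real[symmetric], intro enn2real_nonneg)
  have "ennreal (r\<^sup>2) \<le> ennreal ((k * V)\<^sup>2)" using sq unfolding r(1) ennreal_power[OF r(2)] .
  then have "r\<^sup>2 \<le> (k * V)\<^sup>2" by (rule ennreal_le_iff[THEN iffD1, rotated]) (rule zero_le_power2)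
  moreover have "0 \<le> k * V" using k by (intro mult_nonneg_nonneg) (simp_all add: V_def)
  ultimately have "r \<le> k * V" by (rule power2_le_imp_le)
  then have "I \<le> ennreal (k * V)" unfolding r(1) by (rule ennreal_leI)
  also have "\<dots> = ennreal k * ennreal V" using k by (rule ennreal_mult')
  finally show ?thesis unfolding eq[unfolded R_def] V k_def[symmetric] I_def .
qed

text \<open>Half of the exponent pays for the passage from expectation to almost sure: divided by
  \<open>\<rho> ^ n\<close>, the expectations are still of order \<open>\<rho> ^ n\<close>, so the
  sum over n is integrable and hence almost surely finite. Since the cost controls only the square
  root of the singular value ratio, the final squaring regains this half.\<close>

lemma AE_annulus_flag_cost_decay:
  fixes \<Xi> :: "nat \<Rightarrow> 'w \<Rightarrow> real^'n^'n" and W :: "(real^'n) set"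
  assumes d: "1 < CARD('n)" and noise: "uniform_noise M \<Xi>" and e: "0 < \<epsilon>" "\<epsilon> < 1"
    and A: "\<And>n. 1 \<le> n \<Longrightarrow> orthogonal_matrix (A n)" and W: "subspace W"
  defines "\<rho> \<equiv> sqrt (1 - rate CARD('n) \<epsilon>)"
  shows "AE \<omega> in M. \<exists>C\<ge>0. \<forall>n. (\<integral>\<^sup>+x. flag_cost W a b (perturbed_product \<epsilon> A (\<lambda>k. \<Xi> k \<omega>) n) x
      * indicator annulus x \<partial>lborel) \<le> ennreal (C * \<rho> ^ n)"
proof -
  interpret prob_space M using noise by (simp add: uniform_noise_def)
  define Y where "Y n \<omega> = (\<integral>\<^sup>+x. flag_cost W a b (perturbed_product \<epsilon> A (\<lambda>k. \<Xi> k \<omega>) n) x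
      * indicator annulus x \<partial>lborel)" for n \<omega>
  have \<rho>: "0 < \<rho>" "\<rho> < 1" "\<rho>\<^sup>2 = 1 - rate CARD('n) \<epsilon>"
    using rate_bounds[OF e, of "CARD('n)"] by (auto simp: \<rho>_def)
  have [measurable]: "(\<lambda>\<omega>. perturbed_product \<epsilon> A (\<lambda>k. \<Xi> k \<omega>) n) \<in> borel_measurable M" for n
    using noise by (intro perturbed_product_borel) (auto simp: uniform_noise_def indep_vars_def)
  note [measurable] = flag_cost_measurable[OF W, of a b]
  have [measurable]: "Y n \<in> borel_measurable M" for n unfolding Y_def by measurable
  define V where "V = measure lborel annulus"
  have V: "emeasure lborel annulus = ennreal V"
    unfolding V_def using annulus_finite by (intro emeasure_eq_ennreal_measure) auto
  have EY: "(\<integral>\<^sup>+\<omega>. ennreal (1 / \<rho> ^ n) * Y n \<omega> \<partial>M) \<le> ennreal (V * \<rho> ^ n)" for n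
  proof -
    have "(\<integral>\<^sup>+\<omega>. ennreal (1 / \<rho> ^ n) * Y n \<omega> \<partial>M) = ennreal (1 / \<rho> ^ n) * (\<integral>\<^sup>+\<omega>. Y n \<omega> \<partial>M)"
      by (rule nn_integral_cmult) measurable
    also have "\<dots> \<le> ennreal (1 / \<rho> ^ n) * (ennreal ((\<rho>\<^sup>2) ^ n) * ennreal V)"
      unfolding Y_def \<rho>(3) V[symmetric]
      by (intro mult_left_mono expectation_annulus_flag_cost[OF d noise e A W]) auto
    also have "\<dots> = ennreal (1 / \<rho> ^ n * (\<rho>\<^sup>2) ^ n * V)"
    proof -
      have "ennreal r * (ennreal s * ennreal V) = ennreal (r * s * V)" if "0 \<le> r" "0 \<le> s" for r s
        using that by (simp add: ennreal_mult mult.assoc V_def)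
      then show ?thesis using \<rho>(1) by simp
    qed
    also have "1 / \<rho> ^ n * (\<rho>\<^sup>2) ^ n * V = V * \<rho> ^ n"
      using \<rho>(1) by (simp add: power2_eq_square power_mult_distrib)
    finally show ?thesis .
  qed
  have "(\<integral>\<^sup>+\<omega>. (\<Sum>n. ennreal (1 / \<rho> ^ n) * Y n \<omega>) \<partial>M) = (\<Sum>n. \<integral>\<^sup>+\<omega>. ennreal (1 / \<rho> ^ n) * Y n \<omega> \<partial>M)"
    by (rule nn_integral_suminf) measurable
  also have "\<dots> \<le> (\<Sum>n. ennreal (V * \<rho> ^ n))" by (intro suminf_le EY) auto
  also have "\<dots> = ennreal (\<Sum>n. V * \<rho> ^ n)"
    using \<rho> by (intro suminf_ennreal2 summable_mult summable_geometric) (auto simp: V_def)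
  also have "\<dots> < \<infinity>" by simp
  finally have "(\<integral>\<^sup>+\<omega>. (\<Sum>n. ennreal (1 / \<rho> ^ n) * Y n \<omega>) \<partial>M) \<noteq> \<infinity>" by simp
  then have "AE \<omega> in M. (\<Sum>n. ennreal (1 / \<rho> ^ n) * Y n \<omega>) \<noteq> \<infinity>"
    by (rule nn_integral_PInf_AE[rotated]) measurable
  then show ?thesis
  proof eventually_elim
    case (elim \<omega>)
    then obtain C where C: "C \<ge> 0" "(\<Sum>n. ennreal (1 / \<rho> ^ n) * Y n \<omega>) = ennreal C"
      by (cases "\<Sum>n. ennreal (1 / \<rho> ^ n) * Y n \<omega>") auto
    have "Y n \<omega> \<le> ennreal (C * \<rho> ^ n)" for n
    proof -
      have "ennreal (1 / \<rho> ^ n) * Y n \<omega> \<le> ennreal C"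
        unfolding C(2)[symmetric] using sum_le_suminf[of "\<lambda>n. ennreal (1 / \<rho> ^ n) * Y n \<omega>" "{n}"] by simp
      then have "ennreal (\<rho> ^ n) * (ennreal (1 / \<rho> ^ n) * Y n \<omega>) \<le> ennreal (\<rho> ^ n) * ennreal C"
        by (rule mult_left_mono) simp
      moreover have "ennreal (\<rho> ^ n) * (ennreal (1 / \<rho> ^ n) * Y n \<omega>) = Y n \<omega>"
        using \<rho>(1) by (simp add: mult.assoc[symmetric] ennreal_mult[symmetric])
      moreover have "ennreal (\<rho> ^ n) * ennreal C = ennreal (C * \<rho> ^ n)"
        using \<rho>(1) C(1) by (simp add: ennreal_mult[symmetric] mult.commute)
      ultimately show ?thesis by simp
    qed
    then show ?case using C(1) unfolding Y_def by blast
  qed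
qed

subsection \<open>Singular values\<close>

text \<open>A maximiser v of the Rayleigh quotient on the unit sphere of V. By invariance the
  residual z lies in V, and unless it vanished, a small move from v towards z would increase the
  quotient.\<close>

lemma symmetric_eigenvector:
  fixes S :: "real^'n^'n"
  assumes sym: "\<And>v w. (S *v v) \<bullet> w = v \<bullet> (S *v w)" and V: "subspace V" and inv: "\<And>v. v \<in> V \<Longrightarrow> S *v v \<in> V"
    and ne: "V \<noteq> {0}"
  obtains v \<mu> where "v \<in> V" "norm v = 1" "S *v v = \<mu> *\<^sub>R v"
proof -
  define K where "K = sphere 0 1 \<inter> V"
  obtain y where y: "y \<in> V" "y \<noteq> 0" using ne subspace_0[OF V] by blast
  have "(1 / norm y) *\<^sub>R y \<in> K" using y V by (simp add: K_def subspace_scale)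
  then have "K \<noteq> {}" by blast
  moreover have "compact K"
    unfolding K_def by (intro compact_Int_closed compact_sphere closed_subspace V)
  moreover have "continuous_on K (\<lambda>v. v \<bullet> (S *v v))"
    by (intro continuous_intros linear_continuous_on matrix_vector_mul_bounded_linear)
  ultimately obtain v where v: "v \<in> K" and max: "\<And>w. w \<in> K \<Longrightarrow> w \<bullet> (S *v w) \<le> v \<bullet> (S *v v)"
    using continuous_attains_sup by metis
  define \<mu> where "\<mu> = v \<bullet> (S *v v)"
  have vV: "v \<in> V" and nv: "norm v = 1" using v by (auto simp: K_def)
  have vv: "v \<bullet> v = 1" using nv by (simp add: norm_eq_1)
  have le: "w \<bullet> (S *v w) \<le> \<mu> * (w \<bullet> w)" if w: "w \<in> V" for w
  proof (cases "w = 0")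
    case False
    define c where "c = 1 / norm w"
    have "c *\<^sub>R w \<in> K" using False w V by (simp add: K_def c_def subspace_scale)
    from max[OF this] have "c * c * (w \<bullet> (S *v w)) \<le> \<mu>"
      by (simp add: \<mu>_def matrix_vector_mult_scaleR mult.assoc)
    also have "\<mu> = c * c * (\<mu> * (w \<bullet> w))"
      using False by (simp add: c_def dot_square_norm power2_eq_square)
    finally show ?thesis
      using False by (subst (asm) mult_le_cancel_left_pos) (auto simp: c_def)
  qed simp
  define z where "z = S *v v - \<mu> *\<^sub>R v"
  have zV: "z \<in> V" unfolding z_def by (intro subspace_diff subspace_scale V inv vV)
  have vz: "v \<bullet> z = 0" by (simp add: z_def inner_diff_right \<mu>_def vv)
  have "z \<bullet> z = z \<bullet> (S *v v - \<mu> *\<^sub>R v)" unfolding z_def[symmetric] ..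
  then have zz: "z \<bullet> (S *v v) = z \<bullet> z"
    using vz by (simp add: inner_diff_right inner_commute[of z v])
  have q: "2 * t * (z \<bullet> z) \<le> t * t * (\<mu> * (z \<bullet> z) - z \<bullet> (S *v z))" for t
  proof -
    have "v + t *\<^sub>R z \<in> V" using V vV zV by (simp add: subspace_add subspace_scale)
    from le[OF this] have 1: "(v + t *\<^sub>R z) \<bullet> (S *v v + t *\<^sub>R (S *v z)) \<le> \<mu> * ((v + t *\<^sub>R z) \<bullet> (v + t *\<^sub>R z))"
      by (simp add: matrix_vector_right_distrib matrix_vector_mult_scaleR)
    have 2: "v \<bullet> (S *v z) = z \<bullet> z" using sym[of v z] zz by (simp add: inner_commute)
    have 3: "(v + t *\<^sub>R z) \<bullet> (S *v v + t *\<^sub>R (S *v z)) =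
       \<mu> + t * (v \<bullet> (S *v z)) + t * (z \<bullet> (S *v v)) + t * t * (z \<bullet> (S *v z))"
      by (simp add: inner_add_left inner_add_right \<mu>_def algebra_simps)
    have 4: "(v + t *\<^sub>R z) \<bullet> (v + t *\<^sub>R z) = 1 + t * t * (z \<bullet> z)"
      using vz by (simp add: inner_add_left inner_add_right vv inner_commute[of z v])
    from 1 show ?thesis unfolding 3 4 2 zz by (simp add: algebra_simps)
  qed
  have "z \<bullet> z = 0"
  proof (rule ccontr)
    assume nz: "z \<bullet> z \<noteq> 0"
    define a where "a = z \<bullet> z"
    define b where "b = \<mu> * (z \<bullet> z) - z \<bullet> (S *v z)"
    have a: "a > 0" using nz by (simp add: a_def)
    have b: "b \<ge> 0" unfolding b_def using le[OF zV] by simp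
    \<comment> \<open>Small enough that the quadratic term of the inequality cannot compensate the
      linear one.\<close>
    define t where "t = a / (b + 1)"
    have t: "t > 0" "t * b < a"
      using a b by (simp_all add: t_def field_simps)
    have "2 * t * a \<le> t * (t * b)" using q[of t] by (simp add: a_def b_def)
    also have "\<dots> \<le> t * a" using t by (intro mult_left_mono) auto
    finally have "t * a \<le> 0" by (simp add: algebra_simps)
    moreover have "t * a > 0" using t a by simp
    ultimately show False by simp
  qed
  then have "S *v v = \<mu> *\<^sub>R v" by (simp add: z_def)
  with that vV nv show ?thesis by blast
qed

lemma symmetric_eigenbasis_subspace:
  fixes S :: "real^'n^'n"
  assumes sym: "\<And>v w. (S *v v) \<bullet> w = v \<bullet> (S *v w)"
  shows "subspace V \<Longrightarrow> (\<And>v. v \<in> V \<Longrightarrow> S *v v \<in> V) \<Longrightarrow> dim V = n \<Longrightarrow>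
    \<exists>B. B \<subseteq> V \<and> finite B \<and> card B = n \<and> pairwise orthogonal B \<and> (\<forall>v\<in>B. norm v = 1 \<and> (\<exists>\<mu>. S *v v = \<mu> *\<^sub>R v))"
proof (induction n arbitrary: V)
  case 0
  then show ?case by (intro exI[of _ "{}"]) simp
next
  case (Suc n)
  have "V \<noteq> {0}" using Suc.prems(3) by auto
  then obtain v \<mu> where v: "v \<in> V" "norm v = 1" "S *v v = \<mu> *\<^sub>R v"
    using symmetric_eigenvector[OF sym Suc.prems(1,2)] by metis
  define V' where "V' = {y \<in> V. \<forall>x\<in>span {v}. orthogonal x y}"
  have V': "y \<in> V' \<longleftrightarrow> y \<in> V \<and> v \<bullet> y = 0" for y
    unfolding V'_def by (auto simp: orthogonal_def span_singleton)
  have sub: "subspace V'"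
    unfolding subspace_def using Suc.prems(1)
    by (auto simp: V' subspace_0 subspace_add subspace_scale inner_add_right)
  have inv: "S *v y \<in> V'" if "y \<in> V'" for y
    using that Suc.prems(2) sym[of v y] v(3) by (simp add: V')
  have "dim V' + dim (span {v}) = dim V"
    unfolding V'_def using Suc.prems(1) v(1) by (intro dim_subspace_orthogonal_to_vectors) (auto simp: span_minimal)
  moreover have "dim (span {v}) = 1"
    using v(2) by (subst dim_span) (auto simp: dim_singleton)
  ultimately have "dim V' = n" using Suc.prems(3) by simp
  from Suc.IH[OF sub inv this] obtain B where B: "B \<subseteq> V'" "finite B" "card B = n" "pairwise orthogonal B"
    "\<forall>v\<in>B. norm v = 1 \<and> (\<exists>\<mu>. S *v v = \<mu> *\<^sub>R v)" by blast
  have "v \<notin> B"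
  proof
    assume "v \<in> B"
    then have "v \<bullet> v = 0" using B(1) V' by blast
    then show False using v(2) by simp
  qed
  then have "card (insert v B) = Suc n" using B by simp
  moreover have "pairwise orthogonal (insert v B)"
    using B(1,4) V' by (auto simp: pairwise_insert orthogonal_def inner_commute)
  moreover have "insert v B \<subseteq> V" using B(1) v(1) V' by blast
  ultimately show ?case using B v by (intro exI[of _ "insert v B"]) auto
qed

text \<open>The eigenbasis is indexed by \<open>'n\<close> so that its vectors can be the columns of
  a matrix.\<close>

lemma gram_eigenbasis:
  fixes M :: "real^'n^'n"
  obtains u :: "'n \<Rightarrow> real^'n" and \<kappa> where "\<And>i j. u i \<bullet> u j = (if i = j then 1 else 0)"
    "\<And>i. (transpose M ** M) *v u i = \<kappa> i *\<^sub>R u i" "\<And>x. (\<Sum>i\<in>UNIV. (u i \<bullet> x) *\<^sub>R u i) = x"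
proof -
  define S where "S = transpose M ** M"
  have sym: "(S *v v) \<bullet> w = v \<bullet> (S *v w)" for v w
    unfolding S_def matrix_vector_mul_assoc[symmetric]
    by (metis dot_lmul_matrix inner_commute transpose_matrix_vector transpose_transpose)
  obtain B where B: "finite B" "card B = CARD('n)" "pairwise orthogonal B"
    "\<forall>v\<in>B. norm v = 1 \<and> (\<exists>\<mu>. S *v v = \<mu> *\<^sub>R v)"
    using symmetric_eigenbasis_subspace[OF sym subspace_UNIV, of "CARD('n)"] by auto
  then obtain u where u: "bij_betw u (UNIV :: 'n set) B"
    using finite_same_card_bij[of "UNIV :: 'n set" B] by auto
  have uB: "u i \<in> B" for i using u by (auto simp: bij_betw_def)
  have "\<exists>\<mu>. S *v u i = \<mu> *\<^sub>R u i" for i using B(4) uB by blast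
  then obtain \<kappa> where \<kappa>: "\<And>i. S *v u i = \<kappa> i *\<^sub>R u i" by metis
  have "0 \<notin> B" using B(4) by force
  then have "independent B" using B(3) by (rule pairwise_orthogonal_independent[rotated])
  then have sp: "span B = UNIV"
    using B(2) by (intro dim_eq_full[THEN iffD1]) (simp add: dim_span_eq_card_independent dim_eq_card_independent)
  have "(\<Sum>i\<in>UNIV. (u i \<bullet> x) *\<^sub>R u i) = x" for x
  proof -
    have "(\<Sum>b\<in>B. (x \<bullet> b) *\<^sub>R b) = x"
      using B sp by (intro orthonormal_basis_expand) auto
    then show ?thesis using sum.reindex_bij_betw[OF u, of "\<lambda>b. (x \<bullet> b) *\<^sub>R b"] by (simp add: inner_commute)
  qed
  moreover have "u i \<bullet> u j = (if i = j then 1 else 0)" for i j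
  proof (cases "i = j")
    case True
    then show ?thesis using B(4) uB[of j] by (simp add: norm_eq_1)
  next
    case False
    then have "u i \<noteq> u j" using u by (auto simp: bij_betw_def inj_on_def)
    then show ?thesis using B(3) uB False by (simp add: pairwise_def orthogonal_def)
  qed
  ultimately show ?thesis using that \<kappa> unfolding S_def by blast
qed

lemma sum_const_poly: "(\<Sum>i\<in>A. [:f i:]) = [:\<Sum>i\<in>A. f i:]"
  by (induction A rule: infinite_finite_induct) auto

text \<open>The diagonalisation \<open>P ** U = U ** D\<close> is carried out over the ring of
  polynomials, with \<open>U\<close> the constant matrix of eigenvectors. Polynomials form an
  integral domain, so the nonzero \<open>det U\<close> cancels.\<close>

lemma charpoly_eigenbasis:
  fixes S :: "real^'n^'n" and u :: "'n \<Rightarrow> real^'n"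
  assumes u: "\<And>i j. u i \<bullet> u j = (if i = j then 1 else 0)" and ev: "\<And>i. S *v u i = \<kappa> i *\<^sub>R u i"
  shows "charpoly S = (\<Prod>i\<in>UNIV. [:- \<kappa> i, 1:])"
proof -
  define U where "U = (\<chi> i j. [:u j $ i:])"
  define P where "P = (\<chi> i j. (if i = j then [:0, 1:] else 0) - [:S $ i $ j:])"
  define D where "D = (\<chi> i j :: 'n. if i = j then [:- \<kappa> j, 1:] else 0)"
  have "transpose U ** U = mat 1"
    unfolding vec_eq_iff matrix_matrix_mult_def transpose_def U_def mat_def
    using u by (simp add: sum_const_poly inner_vec_def one_pCons)
  then have "det U * det U = 1" by (metis det_I det_mul det_transpose)
  then have U0: "det U \<noteq> 0" by auto
  have "P ** U = U ** D"
    unfolding vec_eq_iff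
  proof (intro allI)
    fix i j
    have d: "(\<Sum>k\<in>UNIV. (if i = k then [:0, 1:] else 0) * [:u j $ k:]) = [:0, 1:] * [:u j $ i:]"
    proof -
      have "(if i = k then [:0, 1:] else 0) * [:u j $ k:] = (if k = i then [:0, 1:] * [:u j $ i:] else 0)" for k
        by simp
      then show ?thesis by (simp only: sum.delta finite UNIV_I if_True)
    qed
    have "(P ** U) $ i $ j = [:0, 1:] * [:u j $ i:] - [:(S *v u j) $ i:]"
      unfolding matrix_matrix_mult_def P_def U_def
      by (simp add: left_diff_distrib sum_subtractf d sum_const_poly matrix_vector_mult_def del: mult_pCons_left mult_pCons_right)
         (simp add: sum_const_poly mult.commute)
    also have "\<dots> = [:u j $ i:] * [:- \<kappa> j, 1:]" by (simp add: ev)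
    also have "\<dots> = (U ** D) $ i $ j"
      unfolding matrix_matrix_mult_def D_def U_def
      by (simp add: if_distrib[of "\<lambda>z. _ * z"] cong: if_cong del: mult_pCons_left mult_pCons_right)
    finally show "(P ** U) $ i $ j = (U ** D) $ i $ j" .
  qed
  then have "det P * det U = det D * det U" by (metis det_mul mult.commute)
  then have "det P = det D" using U0 by simp
  also have "det D = (\<Prod>i\<in>UNIV. D $ i $ i)" by (rule det_diagonal) (simp add: D_def)
  finally show ?thesis by (simp add: charpoly_def P_def D_def)
qed

lemma singular_values_eigenbasis:
  fixes M :: "real^'n^'n" and u :: "'n \<Rightarrow> real^'n"
  assumes u: "\<And>i j. u i \<bullet> u j = (if i = j then 1 else 0)" and ev: "\<And>i. (transpose M ** M) *v u i = \<kappa> i *\<^sub>R u i"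
  shows "mset (singular_values M) = image_mset (\<lambda>i. sqrt (\<kappa> i)) (mset_set UNIV)"
    "sorted (rev (singular_values M))"
proof -
  have "proots (\<Prod>i\<in>UNIV. [:- \<kappa> i, 1:]) = (\<Sum>i\<in>UNIV. proots [:- \<kappa> i, 1:])"
    by (rule proots_prod) simp
  also have "\<dots> = (\<Sum>i\<in>UNIV. {#\<kappa> i#})" by simp
  also have "\<dots> = image_mset \<kappa> (mset_set UNIV)"
    by (simp add: sum_unfold_sum_mset) 
  finally have "proots (charpoly (transpose M ** M)) = image_mset \<kappa> (mset_set UNIV)"
    by (simp add: charpoly_eigenbasis[OF u ev])
  then show "mset (singular_values M) = image_mset (\<lambda>i. sqrt (\<kappa> i)) (mset_set UNIV)"
    unfolding singular_values_def by (simp add: multiset.map_comp o_def)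
  show "sorted (rev (singular_values M))" unfolding singular_values_def by simp
qed

lemma sorted_desc_nth_ge:
  fixes xs :: "real list"
  assumes "sorted (rev xs)" "1 \<le> j" "j \<le> length xs" "j \<le> length (filter (\<lambda>x. a \<le> x) xs)"
  shows "a \<le> xs ! (j - 1)"
proof (rule ccontr)
  assume "\<not> a \<le> xs ! (j - 1)"
  then have "{i. i < length xs \<and> a \<le> xs ! i} \<subseteq> {..<j - 1}"
    using sorted_rev_nth_mono[OF assms(1), of "j - 1"] by (force simp: not_le)
  then have "length (filter (\<lambda>x. a \<le> x) xs) \<le> j - 1"
    unfolding length_filter_conv_card using card_mono[of "{..<j - 1}"] by simp
  then show False using assms by linarith
qed

lemma sorted_desc_nth_le:
  fixes xs :: "real list"
  assumes "sorted (rev xs)" "j < length xs" "length (filter (\<lambda>x. b < x) xs) \<le> j"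
  shows "xs ! j \<le> b"
proof (rule ccontr)
  assume "\<not> xs ! j \<le> b"
  then have "b < xs ! i" if "i \<le> j" for i
    using sorted_rev_nth_mono[OF assms(1) that assms(2)] by linarith
  then have "{..j} \<subseteq> {i. i < length xs \<and> b < xs ! i}" using assms(2) by auto
  then have "Suc j \<le> length (filter (\<lambda>x. b < x) xs)"
    unfolding length_filter_conv_card using card_mono[of "{i. i < length xs \<and> b < xs ! i}" "{..j}"] by simp
  then show False using assms(3) by simp
qed

lemma subspaces_intersect:
  fixes V Z :: "'a::euclidean_space set"
  assumes "subspace V" "subspace Z" "dim V + dim Z > DIM('a)"
  obtains v where "v \<in> V" "v \<in> Z" "v \<noteq> 0"
proof -
  have "dim {x + y |x y. x \<in> V \<and> y \<in> Z} + dim (V \<inter> Z) = dim V + dim Z"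
    by (rule dim_sums_Int[OF assms(1,2)])
  moreover have "dim {x + y |x y. x \<in> V \<and> y \<in> Z} \<le> DIM('a)" by (rule dim_subset_UNIV)
  ultimately have "dim (V \<inter> Z) > 0" using assms(3) by linarith
  then have "\<not> V \<inter> Z \<subseteq> {0}" by (metis dim_eq_0 less_irrefl)
  then show ?thesis using that by blast
qed

text \<open>The first two parts are the halves of the Courant-Fischer principle, by a dimension
  count: with too few (or too many) singular values beyond the threshold, V would share a nonzero
  vector with the span of eigenvectors on which the opposite strict inequality holds.\<close>

lemma singular_value_minmax:
  fixes M :: "real^'n^'n"
  shows singular_value_ge: "\<lbrakk>1 \<le> j; subspace V; dim V = j; a > 0; \<And>v. v \<in> V \<Longrightarrow> a * norm v \<le> norm (M *v v)\<rbrakk>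
      \<Longrightarrow> a \<le> singular_value j M"
    and singular_value_le: "\<lbrakk>j < CARD('n); subspace V; CARD('n) \<le> dim V + j; b \<ge> 0; \<And>v. v \<in> V \<Longrightarrow> norm (M *v v) \<le> b * norm v\<rbrakk>
      \<Longrightarrow> singular_value (j + 1) M \<le> b"
    and singular_value_pos: "\<lbrakk>invertible M; 1 \<le> j; j \<le> CARD('n)\<rbrakk> \<Longrightarrow> 0 < singular_value j M"
proof -
  obtain u :: "'n \<Rightarrow> real^'n" and \<kappa> where u: "\<And>i j. u i \<bullet> u j = (if i = j then 1 else 0)"
    and ev: "\<And>i. (transpose M ** M) *v u i = \<kappa> i *\<^sub>R u i" and expand: "\<And>x. (\<Sum>i\<in>UNIV. (u i \<bullet> x) *\<^sub>R u i) = x"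
    by (rule gram_eigenbasis[of M], rule that; assumption)
  define \<sigma> where "\<sigma> i = sqrt (\<kappa> i)" for i
  define xs where "xs = singular_values M"
  have mset: "mset xs = image_mset \<sigma> (mset_set UNIV)" and sorted: "sorted (rev xs)"
    using singular_values_eigenbasis[OF u ev] by (simp_all add: xs_def \<sigma>_def[abs_def])
  have len: "length xs = CARD('n)" using arg_cong[OF mset, of size] by simp
  have count: "length (filter P xs) = card {i. P (\<sigma> i)}" for P
  proof -
    have "length (filter P xs) = size (filter_mset P (mset xs))" by (simp flip: mset_filter)
    also have "\<dots> = card {i. P (\<sigma> i)}" by (simp add: mset filter_mset_image_mset filter_mset_mset_set)
    finally show ?thesis .
  qed
  have gram: "(M *v v) \<bullet> (M *v w) = v \<bullet> ((transpose M ** M) *v w)" for v w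
    unfolding matrix_vector_mul_assoc[symmetric]
    by (metis dot_lmul_matrix transpose_matrix_vector transpose_transpose)
  have quad: "(norm (M *v v))\<^sup>2 = (\<Sum>i\<in>UNIV. \<kappa> i * (u i \<bullet> v)\<^sup>2)" for v
  proof -
    have "(transpose M ** M) *v v = (transpose M ** M) *v (\<Sum>i\<in>UNIV. (u i \<bullet> v) *\<^sub>R u i)" by (simp only: expand)
    also have "\<dots> = (\<Sum>i\<in>UNIV. (u i \<bullet> v) *\<^sub>R \<kappa> i *\<^sub>R u i)"
      by (simp add: linear_sum[OF matrix_vector_mul_linear] matrix_vector_mult_scaleR ev)
    finally show ?thesis
      unfolding power2_norm_eq_inner gram
      by (simp add: inner_sum_right power2_eq_square inner_commute[of v] mult_ac)
  qed
  have nrm: "(norm v)\<^sup>2 = (\<Sum>i\<in>UNIV. (u i \<bullet> v)\<^sup>2)" for v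
  proof -
    have "(norm v)\<^sup>2 = v \<bullet> (\<Sum>i\<in>UNIV. (u i \<bullet> v) *\<^sub>R u i)" by (simp only: expand power2_norm_eq_inner)
    then show ?thesis by (simp add: inner_sum_right power2_eq_square inner_commute[of v])
  qed
  have \<kappa>: "\<kappa> i = (norm (M *v u i))\<^sup>2" for i
    unfolding power2_norm_eq_inner gram ev by (simp add: u)
  then have \<kappa>0: "0 \<le> \<kappa> i" for i by simp
  have \<sigma>2: "(\<sigma> i)\<^sup>2 = \<kappa> i" and \<sigma>0: "0 \<le> \<sigma> i" for i using \<kappa>0 by (simp_all add: \<sigma>_def)
  have inj: "inj u"
  proof (rule injI)
    fix i j assume "u i = u j"
    then show "i = j" using u[of i j] u[of j j] by (simp split: if_splits)
  qed
  have dimI: "dim (u ` I) = card I" for I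
  proof -
    have "pairwise orthogonal (u ` I)" by (auto simp: pairwise_def orthogonal_def u)
    moreover have "0 \<notin> u ` I"
    proof
      assume "0 \<in> u ` I"
      then obtain i where "u i = 0" by force
      then show False using u[of i i] by simp
    qed
    ultimately have "independent (u ` I)" by (rule pairwise_orthogonal_independent)
    then have "dim (u ` I) = card (u ` I)" by (rule dim_eq_card_independent)
    also have "\<dots> = card I" using inj by (simp add: card_image inj_on_subset)
    finally show ?thesis .
  qed
  have spanI: "u k \<bullet> v = 0" if v: "v \<in> span (u ` I)" and k: "k \<notin> I" for v k I
  proof -
    have "orthogonal (u k) v"
      using v by (rule orthogonal_to_span) (use k in \<open>auto simp: orthogonal_def u\<close>)
    then show ?thesis by (simp add: orthogonal_def)
  qed
  show "a \<le> singular_value j M"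
    if j: "1 \<le> j" and V: "subspace V" "dim V = j" and a: "a > 0" and bound: "\<And>v. v \<in> V \<Longrightarrow> a * norm v \<le> norm (M *v v)" for j V a
  proof -
    have jn: "j \<le> CARD('n)" using V(2) dim_subset_UNIV[of V] by simp
    have "j \<le> card {i. a \<le> \<sigma> i}"
    proof (rule ccontr)
      assume less: "\<not> j \<le> card {i. a \<le> \<sigma> i}"
      define I where "I = {i. \<not> a \<le> \<sigma> i}"
      have "I = UNIV - {i. a \<le> \<sigma> i}" by (auto simp: I_def)
      then have "card I = CARD('n) - card {i. a \<le> \<sigma> i}" by (simp add: card_Diff_subset)
      then have "dim V + dim (span (u ` I)) > DIM(real^'n)" using less V(2) jn by (simp add: dimI)
      then obtain v where v: "v \<in> V" "v \<in> span (u ` I)" "v \<noteq> 0"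
        using subspaces_intersect[OF V(1) subspace_span] by blast
      have "(a * norm v)\<^sup>2 \<le> (norm (M *v v))\<^sup>2" using bound[OF v(1)] a by (intro power_mono) auto
      also have "\<dots> < (\<Sum>i\<in>UNIV. a\<^sup>2 * (u i \<bullet> v)\<^sup>2)"
        unfolding quad
      proof (rule sum_strict_mono_ex1)
        have tm: "\<kappa> i * (u i \<bullet> v)\<^sup>2 \<le> a\<^sup>2 * (u i \<bullet> v)\<^sup>2" for i
        proof (cases "i \<in> I")
          case True
          then have "\<kappa> i \<le> a\<^sup>2" using \<sigma>0[of i] unfolding \<sigma>2[symmetric] by (intro power_mono) (auto simp: I_def)
          then show ?thesis by (intro mult_right_mono) auto
        qed (simp add: spanI[OF v(2)])
        then show "\<forall>i\<in>UNIV. \<kappa> i * (u i \<bullet> v)\<^sup>2 \<le> a\<^sup>2 * (u i \<bullet> v)\<^sup>2" by blast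
        have "\<exists>i. u i \<bullet> v \<noteq> 0"
        proof (rule ccontr)
          assume "\<nexists>i. u i \<bullet> v \<noteq> 0"
          then have "v = 0" using expand[of v] by simp
          then show False using v by simp
        qed
        then obtain i where i: "u i \<bullet> v \<noteq> 0" by blast
        then have "i \<in> I" using spanI[OF v(2)] by blast
        then have "\<kappa> i < a\<^sup>2" using \<sigma>0[of i] unfolding \<sigma>2[symmetric] by (intro power_strict_mono) (auto simp: I_def)
        then show "\<exists>i\<in>UNIV. \<kappa> i * (u i \<bullet> v)\<^sup>2 < a\<^sup>2 * (u i \<bullet> v)\<^sup>2"
          using i by (intro bexI[of _ i]) auto
      qed simp
      also have "\<dots> = (a * norm v)\<^sup>2" by (simp add: power_mult_distrib nrm sum_distrib_left)
      finally show False by simp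
    qed
    then show ?thesis
      unfolding singular_value_def xs_def[symmetric] using j jn len sorted
      by (intro sorted_desc_nth_ge) (auto simp: count)
  qed
  show "singular_value (j + 1) M \<le> b"
    if j: "j < CARD('n)" and V: "subspace V" "CARD('n) \<le> dim V + j" and b: "b \<ge> 0"
      and bound: "\<And>v. v \<in> V \<Longrightarrow> norm (M *v v) \<le> b * norm v" for j V b
  proof -
    have "card {i. b < \<sigma> i} \<le> j"
    proof (rule ccontr)
      assume less: "\<not> card {i. b < \<sigma> i} \<le> j"
      define I where "I = {i. b < \<sigma> i}"
      have "dim V + dim (span (u ` I)) > DIM(real^'n)" using less V(2) by (simp add: dimI I_def)
      then obtain v where v: "v \<in> V" "v \<in> span (u ` I)" "v \<noteq> 0"
        using subspaces_intersect[OF V(1) subspace_span] by blast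
      have "(b * norm v)\<^sup>2 = (\<Sum>i\<in>UNIV. b\<^sup>2 * (u i \<bullet> v)\<^sup>2)"
        by (simp add: power_mult_distrib nrm sum_distrib_left)
      also have "\<dots> < (norm (M *v v))\<^sup>2"
        unfolding quad
      proof (rule sum_strict_mono_ex1)
        have tm: "b\<^sup>2 * (u i \<bullet> v)\<^sup>2 \<le> \<kappa> i * (u i \<bullet> v)\<^sup>2" for i
        proof (cases "i \<in> I")
          case True
          then have "b\<^sup>2 \<le> \<kappa> i" using b unfolding \<sigma>2[symmetric] by (intro power_mono) (auto simp: I_def)
          then show ?thesis by (intro mult_right_mono) auto
        qed (simp add: spanI[OF v(2)])
        then show "\<forall>i\<in>UNIV. b\<^sup>2 * (u i \<bullet> v)\<^sup>2 \<le> \<kappa> i * (u i \<bullet> v)\<^sup>2" by blast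
        have "\<exists>i. u i \<bullet> v \<noteq> 0"
        proof (rule ccontr)
          assume "\<nexists>i. u i \<bullet> v \<noteq> 0"
          then have "v = 0" using expand[of v] by simp
          then show False using v by simp
        qed
        then obtain i where i: "u i \<bullet> v \<noteq> 0" by blast
        then have "i \<in> I" using spanI[OF v(2)] by blast
        then have "b\<^sup>2 < \<kappa> i" using b unfolding \<sigma>2[symmetric] by (intro power_strict_mono) (auto simp: I_def)
        then show "\<exists>i\<in>UNIV. b\<^sup>2 * (u i \<bullet> v)\<^sup>2 < \<kappa> i * (u i \<bullet> v)\<^sup>2"
          using i by (intro bexI[of _ i]) auto
      qed simp
      also have "\<dots> \<le> (b * norm v)\<^sup>2" using bound[OF v(1)] by (intro power_mono) auto
      finally show False by simp
    qed
    then show ?thesis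
      unfolding singular_value_def xs_def[symmetric] using j len sorted
      by (simp, intro sorted_desc_nth_le) (auto simp: count)
  qed
  show "0 < singular_value j M" if inv: "invertible M" and j: "1 \<le> j" "j \<le> CARD('n)" for j
  proof -
    have "singular_value j M \<in> set xs"
      unfolding singular_value_def xs_def[symmetric] using j len by (intro nth_mem) simp
    also have "set xs = range \<sigma>" using arg_cong[OF mset, of set_mset] by simp
    finally obtain i where i: "singular_value j M = \<sigma> i" by blast
    have "u i \<noteq> 0" using u[of i i] by auto
    obtain N where N: "N ** M = mat 1" using inv by (auto simp: invertible_def)
    have "M *v u i \<noteq> 0"
    proof
      assume "M *v u i = 0"
      then have "N *v (M *v u i) = 0" by simp
      then show False using \<open>u i \<noteq> 0\<close> by (simp add: matrix_vector_mul_assoc N)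
    qed
    then show ?thesis unfolding i \<sigma>_def \<kappa> by simp
  qed
qed

subsection \<open>Column pivoting\<close>

lemma quot_norm_le:
  assumes "u \<in> W" shows "quot_norm W g v \<le> norm (g *v (v + u))"
  unfolding quot_norm_def using assms by (intro cINF_lower) (auto intro: bdd_belowI2[of _ 0])

lemma quot_norm_eqI:
  assumes W: "subspace W" and z: "z \<in> W" and orth: "\<And>w. w \<in> W \<Longrightarrow> (g *v (v - z)) \<bullet> (g *v w) = 0"
  shows "quot_norm W g v = norm (g *v (v - z))"
  unfolding quot_norm_def
proof (rule cInf_eq_minimum)
  show "norm (g *v (v - z)) \<in> (\<lambda>u. norm (g *v (v + u))) ` W"
    using subspace_neg[OF W z] by (intro image_eqI[of _ _ "- z"]) simp_all
  fix y assume "y \<in> (\<lambda>u. norm (g *v (v + u))) ` W"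
  then obtain u where u: "u \<in> W" "y = norm (g *v (v + u))" by blast
  define w where "w = u + z"
  have w: "w \<in> W" unfolding w_def using W u(1) z by (rule subspace_add)
  have e: "g *v (v + u) = g *v (v - z) + g *v w"
    unfolding matrix_vector_right_distrib[symmetric] w_def by simp
  have "orthogonal (g *v (v - z)) (g *v w)" unfolding orthogonal_def by (rule orth[OF w])
  then have "(norm (g *v (v - z) + g *v w))\<^sup>2 = (norm (g *v (v - z)))\<^sup>2 + (norm (g *v w))\<^sup>2"
    by (rule norm_add_Pythagorean)
  then have "(norm (g *v (v - z)))\<^sup>2 \<le> (norm (g *v (v - z) + g *v w))\<^sup>2" by simp
  then show "norm (g *v (v - z)) \<le> y" unfolding u(2) e by (rule power2_le_imp_le) simp
qed

definition coord_span :: "'n set \<Rightarrow> (real^'n) set" where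
  "coord_span I = span ((\<lambda>i. axis i 1) ` I)"

lemma subspace_coord_span: "subspace (coord_span I)"
  unfolding coord_span_def by (rule subspace_span)

lemma axis_in_coord_span_iff: "(axis l 1 :: real^'n) \<in> coord_span I \<longleftrightarrow> l \<in> I"
proof
  assume l: "(axis l 1 :: real^'n) \<in> coord_span I"
  show "l \<in> I"
  proof (rule ccontr)
    assume "l \<notin> I"
    then have "orthogonal (axis l 1 :: real^'n) (axis l 1)"
      using l unfolding coord_span_def
      by (intro orthogonal_to_span[of "axis l 1"]) (auto simp: orthogonal_def inner_axis_axis)
    then show False by (simp add: orthogonal_def inner_axis_axis)
  qed
qed (simp add: coord_span_def span_base)

lemma coord_span_insert:
  "v \<in> coord_span (insert p I) \<longleftrightarrow> (\<exists>\<beta>. v - \<beta> *\<^sub>R axis p 1 \<in> coord_span I)"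
  unfolding coord_span_def image_insert by (rule span_breakdown_eq)

lemma dim_coord_span: "dim (coord_span I :: (real^'n) set) = card I"
proof -
  have inj: "inj_on (\<lambda>i. axis i 1 :: real^'n) I" by (auto simp: inj_on_def axis_eq_axis)
  have "independent ((\<lambda>i. axis i 1 :: real^'n) ` I)"
    by (rule independent_mono[OF independent_Basis]) (auto simp: Basis_vec_def)
  then show ?thesis
    unfolding coord_span_def using inj by (simp add: dim_eq_card_independent card_image)
qed

text \<open>Bounds the correction z that makes the image of a coordinate vector orthogonal to the
  images of k pivots. A step adds to z a multiple, with factor at most 1, of a vector of norm at
  most \<open>1 + pivot_bound k\<close>; the closed form is \<open>2^k - 1\<close>. The bound does
  not depend on the matrix.\<close>

fun pivot_bound :: "nat \<Rightarrow> real" where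
  "pivot_bound 0 = 0"
| "pivot_bound (Suc k) = 2 * pivot_bound k + 1"

text \<open>In each step \<open>1 + pivot_bound k\<close> pays for the length of the new direction
  \<open>axis p 1 - z p\<close>, and 2 for replacing a hypotenuse by the mean of its legs.\<close>

fun pivot_const :: "nat \<Rightarrow> real" where
  "pivot_const 0 = 1"
| "pivot_const (Suc k) = pivot_const k / (2 * (1 + pivot_bound k))"

lemma pivot_bound_nonneg: "0 \<le> pivot_bound k"
  by (induction k) auto

lemma pivot_const_bounds: "0 < pivot_const k" "pivot_const k \<le> 1"
proof -
  show pos: "0 < pivot_const k" for k by (induction k) (auto simp: pivot_bound_nonneg add_pos_nonneg)
  show "pivot_const k \<le> 1"
  proof (induction k)
    case (Suc k)
    then show ?case using pivot_bound_nonneg[of k] by (simp add: divide_simps)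
  qed simp
qed

text \<open>The invariant of greedy column pivoting after \<open>k\<close> steps.\<close>

definition pivoted :: "real^'n^'n \<Rightarrow> 'n set \<Rightarrow> nat \<Rightarrow> real \<Rightarrow> bool" where
  "pivoted g I k r \<longleftrightarrow> 0 < r \<and>
     (\<forall>l. \<exists>z\<in>coord_span I. norm z \<le> pivot_bound k \<and>
        (\<forall>w\<in>coord_span I. (g *v (axis l 1 - z)) \<bullet> (g *v w) = 0) \<and> norm (g *v (axis l 1 - z)) \<le> r) \<and>
     (\<forall>u\<in>coord_span I. pivot_const k * r * norm u \<le> norm (g *v u))"

text \<open>The new pivot p is the column farthest from the span of the current ones. Hence every
  Gram-Schmidt coefficient against it has absolute value at most 1, which keeps the corrections
  bounded independently of g.\<close>

lemma pivot_step:
  fixes g :: "real^'n^'n"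
  assumes piv: "pivoted g I k r" and I: "I \<noteq> UNIV" and g: "invertible g"
  obtains p where "p \<notin> I" "\<And>l. quot_norm (coord_span I) g (axis l 1) \<le> quot_norm (coord_span I) g (axis p 1)"
    "pivoted g (insert p I) (Suc k) (quot_norm (coord_span I) g (axis p 1))"
proof -
  define W where "W = coord_span I"
  define q where "q l = quot_norm W g (axis l 1)" for l
  have W: "subspace W" unfolding W_def by (rule subspace_coord_span)
  define B where "B = pivot_bound k"
  define c where "c = pivot_const k"
  have B: "0 \<le> B" unfolding B_def by (rule pivot_bound_nonneg)
  have c: "0 < c" "c \<le> 1" unfolding c_def by (rule pivot_const_bounds)+
  have "\<forall>l. \<exists>z. z \<in> W \<and> norm z \<le> B \<and> (\<forall>w\<in>W. (g *v (axis l 1 - z)) \<bullet> (g *v w) = 0) \<and> norm (g *v (axis l 1 - z)) \<le> r"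
    using piv unfolding pivoted_def W_def B_def by blast
  then have "\<exists>z. \<forall>l. z l \<in> W \<and> norm (z l) \<le> B \<and> (\<forall>w\<in>W. (g *v (axis l 1 - z l)) \<bullet> (g *v w) = 0) \<and> norm (g *v (axis l 1 - z l)) \<le> r"
    by (rule choice)
  then obtain z where z': "\<forall>l. z l \<in> W \<and> norm (z l) \<le> B \<and> (\<forall>w\<in>W. (g *v (axis l 1 - z l)) \<bullet> (g *v w) = 0) \<and> norm (g *v (axis l 1 - z l)) \<le> r" ..
  have z: "z l \<in> W" "norm (z l) \<le> B" "norm (g *v (axis l 1 - z l)) \<le> r" for l using z' by simp_all
  have zorth: "(g *v (axis l 1 - z l)) \<bullet> (g *v w) = 0" if "w \<in> W" for l w using z' that by simp
  have q: "q l = norm (g *v (axis l 1 - z l))" for l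
    unfolding q_def by (rule quot_norm_eqI[OF W z(1) zorth])
  have low: "c * r * norm u \<le> norm (g *v u)" if "u \<in> W" for u
    using piv that unfolding pivoted_def W_def c_def by blast
  have ginj: "v = 0" if "g *v v = 0" for v
  proof -
    obtain h where "h ** g = mat 1" using g by (auto simp: invertible_def)
    then have "v = h *v (g *v v)" by (simp add: matrix_vector_mul_assoc)
    then show ?thesis using that by simp
  qed
  have "Max (range q) \<in> range q" by (rule Max_in) auto
  then obtain p where p: "Max (range q) = q p" by blast
  have max: "q l \<le> q p" for l unfolding p[symmetric] by (rule Max_ge) auto
  have qpos: "0 < q l" if "l \<notin> I" for l
  proof (rule ccontr)
    assume "\<not> 0 < q l"
    then have "g *v (axis l 1 - z l) = 0" unfolding q by simp
    then have "axis l 1 - z l = 0" by (rule ginj)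
    then have "axis l 1 \<in> W" using z(1)[of l] by simp
    then show False using that axis_in_coord_span_iff by (auto simp: W_def)
  qed
  obtain l where "l \<notin> I" using I by blast
  then have rp: "0 < q p" using qpos[of l] max[of l] by linarith
  have rpr: "q p \<le> r" using z(3) q by simp
  have pI: "p \<notin> I"
  proof
    assume "p \<in> I"
    then have "axis p 1 \<in> W" by (simp add: W_def axis_in_coord_span_iff)
    then have "q p \<le> norm (g *v (axis p 1 + - axis p 1))"
      unfolding q_def by (intro quot_norm_le subspace_neg W)
    then show False using rp by simp
  qed
  define y where "y l = g *v (axis l 1 - z l)" for l
  have yp: "y p \<bullet> y p = (q p)\<^sup>2" by (simp add: y_def q power2_norm_eq_inner)
  have one: "\<exists>z'\<in>coord_span (insert p I). norm z' \<le> pivot_bound (Suc k) \<and>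
        (\<forall>w\<in>coord_span (insert p I). (g *v (axis l 1 - z')) \<bullet> (g *v w) = 0) \<and> norm (g *v (axis l 1 - z')) \<le> q p" for l
  proof -
    \<comment> \<open>The Gram-Schmidt coefficient of column l against the new pivot; maximality of
      \<open>q p\<close> and Cauchy-Schwarz give absolute value at most 1.\<close>
    define \<beta> where "\<beta> = (y l \<bullet> y p) / (q p)\<^sup>2"
    define z' where "z' = z l + \<beta> *\<^sub>R (axis p 1 - z p)"
    have "\<bar>y l \<bullet> y p\<bar> \<le> norm (y l) * norm (y p)" by (rule Cauchy_Schwarz_ineq2)
    also have "\<dots> \<le> q p * q p" using max[of l] rp by (intro mult_mono) (simp_all add: y_def q[symmetric])
    finally have \<beta>: "\<bar>\<beta>\<bar> \<le> 1" using rp by (simp add: \<beta>_def divide_simps power2_eq_square)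
    have "z' - \<beta> *\<^sub>R axis p 1 = z l - \<beta> *\<^sub>R z p" by (simp add: z'_def algebra_simps)
    also have "\<dots> \<in> W" by (intro subspace_diff subspace_scale W z)
    finally have z'W: "z' \<in> coord_span (insert p I)" unfolding coord_span_insert W_def by blast
    have "norm z' \<le> norm (z l) + norm (\<beta> *\<^sub>R (axis p 1 - z p))" unfolding z'_def by (rule norm_triangle_ineq)
    also have "\<dots> \<le> B + 1 * (1 + B)"
    proof -
      have "norm (axis p 1 - z p) \<le> norm (axis p 1 :: real^'n) + norm (z p)" by (rule norm_triangle_ineq4)
      also have "\<dots> \<le> 1 + B" using z(2)[of p] by simp
      finally have "norm (\<beta> *\<^sub>R (axis p 1 - z p)) \<le> 1 * (1 + B)"
        unfolding norm_scaleR using \<beta> by (intro mult_mono) auto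
      then show ?thesis using z(2)[of l] by linarith
    qed
    finally have nz': "norm z' \<le> pivot_bound (Suc k)" by (simp add: B_def)
    have gy: "g *v (axis l 1 - z') = y l - \<beta> *\<^sub>R y p"
      unfolding y_def z'_def by (simp add: matrix_vector_mult_diff_distrib matrix_vector_right_distrib matrix_vector_mult_scaleR algebra_simps)
    have yy: "(y l - \<beta> *\<^sub>R y p) \<bullet> y p = 0" using rp by (simp add: inner_diff_left yp \<beta>_def)
    have orth: "(g *v (axis l 1 - z')) \<bullet> (g *v w) = 0" if w: "w \<in> coord_span (insert p I)" for w
    proof -
      obtain \<gamma> where \<gamma>: "w - \<gamma> *\<^sub>R axis p 1 \<in> W" using w unfolding coord_span_insert W_def by blast
      define w0 where "w0 = (w - \<gamma> *\<^sub>R axis p 1) + \<gamma> *\<^sub>R z p"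
      have w0: "w0 \<in> W" unfolding w0_def using \<gamma> by (intro subspace_add subspace_scale W z)
      have "g *v w = g *v w0 + \<gamma> *\<^sub>R y p"
        unfolding w0_def y_def by (simp add: matrix_vector_mult_diff_distrib matrix_vector_right_distrib matrix_vector_mult_scaleR algebra_simps)
      moreover have "(y l - \<beta> *\<^sub>R y p) \<bullet> (g *v w0) = 0"
        using zorth[OF w0] by (simp add: inner_diff_left y_def)
      ultimately show ?thesis unfolding gy by (simp add: inner_add_right yy)
    qed
    have "norm (g *v (axis l 1 - z')) \<le> q p"
    proof -
      have "norm (g *v (axis l 1 - z')) = quot_norm (coord_span (insert p I)) g (axis l 1)"
        by (rule quot_norm_eqI[OF subspace_coord_span z'W orth, symmetric])
      also have "\<dots> \<le> norm (g *v (axis l 1 + - z l))"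
      proof (rule quot_norm_le)
        have "- z l - 0 *\<^sub>R axis p 1 \<in> W" using subspace_neg[OF W z(1)] by simp
        then show "- z l \<in> coord_span (insert p I)" unfolding coord_span_insert W_def by blast
      qed
      also have "\<dots> \<le> q p" using max[of l] by (simp add: q)
      finally show ?thesis .
    qed
    with z'W nz' orth show ?thesis by blast
  qed
  have two: "pivot_const (Suc k) * q p * norm u \<le> norm (g *v u)" if u: "u \<in> coord_span (insert p I)" for u
  proof -
    obtain \<beta> where \<beta>: "u - \<beta> *\<^sub>R axis p 1 \<in> W" using u unfolding coord_span_insert W_def by blast
    define w where "w = (u - \<beta> *\<^sub>R axis p 1) + \<beta> *\<^sub>R z p"
    have w: "w \<in> W" unfolding w_def using \<beta> by (intro subspace_add subspace_scale W z)
    have u': "u = w + \<beta> *\<^sub>R (axis p 1 - z p)" by (simp add: w_def algebra_simps)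
    have gu: "g *v u = g *v w + \<beta> *\<^sub>R y p"
      unfolding y_def by (subst u') (simp add: matrix_vector_mult_diff_distrib matrix_vector_right_distrib matrix_vector_mult_scaleR)
    have "orthogonal (g *v w) (\<beta> *\<^sub>R y p)"
      using zorth[OF w, of p] by (simp add: orthogonal_def y_def inner_commute)
    then have "(norm (g *v w + \<beta> *\<^sub>R y p))\<^sup>2 = (norm (g *v w))\<^sup>2 + (norm (\<beta> *\<^sub>R y p))\<^sup>2"
      by (rule norm_add_Pythagorean)
    then have pyth: "(norm (g *v u))\<^sup>2 = (norm (g *v w))\<^sup>2 + (\<bar>\<beta>\<bar> * q p)\<^sup>2"
      by (simp add: gu y_def q)
    define X where "X = norm w"
    have X: "0 \<le> X" by (simp add: X_def)
    have "norm u \<le> X + \<bar>\<beta>\<bar> * (1 + B)"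
    proof -
      have "norm u \<le> norm w + norm (\<beta> *\<^sub>R (axis p 1 - z p))" by (subst u') (rule norm_triangle_ineq)
      moreover have "norm (axis p 1 - z p) \<le> 1 + B"
        using norm_triangle_ineq4[of "axis p 1" "z p"] z(2)[of p] by simp
      then have "norm (\<beta> *\<^sub>R (axis p 1 - z p)) \<le> \<bar>\<beta>\<bar> * (1 + B)"
        unfolding norm_scaleR by (intro mult_left_mono) auto
      ultimately show ?thesis by (simp add: X_def)
    qed
    \<comment> \<open>The images of w and of \<open>\<beta> *\<^sub>R (axis p 1 - z p)\<close> are
      orthogonal, so each is at most \<open>norm (g *v u)\<close> and so is their mean. The old
      invariant bounds the image of w below, as \<open>q p\<close> is at most r.\<close>
    then have "c / (2 * (1 + B)) * q p * norm u \<le> c / (2 * (1 + B)) * q p * (X + \<bar>\<beta>\<bar> * (1 + B))"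
      using c B rp by (intro mult_left_mono) auto
    also have "\<dots> = q p * ((c / (1 + B)) * X + c * \<bar>\<beta>\<bar>) / 2"
      using B by (simp add: divide_simps) (simp add: algebra_simps)
    also have "\<dots> \<le> q p * (c * X + \<bar>\<beta>\<bar>) / 2"
    proof -
      have "c / (1 + B) \<le> c" using c B by (simp add: divide_simps)
      then have "(c / (1 + B)) * X \<le> c * X" using X by (rule mult_right_mono)
      moreover have "c * \<bar>\<beta>\<bar> \<le> 1 * \<bar>\<beta>\<bar>" using c by (intro mult_right_mono) auto
      ultimately show ?thesis using rp by (intro divide_right_mono mult_left_mono) auto
    qed
    also have "\<dots> \<le> (norm (g *v w) + \<bar>\<beta>\<bar> * q p) / 2"
    proof -
      have "c * q p * X \<le> c * r * X" using c X rpr by (intro mult_right_mono mult_left_mono) auto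
      also have "\<dots> \<le> norm (g *v w)" using low[OF w] by (simp add: X_def)
      finally show ?thesis by (simp add: algebra_simps)
    qed
    also have "\<dots> \<le> norm (g *v u)"
    proof -
      have "norm (g *v w) \<le> norm (g *v u)"
        by (rule power2_le_imp_le) (use pyth in auto)
      moreover have "\<bar>\<beta>\<bar> * q p \<le> norm (g *v u)"
        by (rule power2_le_imp_le) (use pyth in auto)
      ultimately show ?thesis by simp
    qed
    finally show ?thesis by (simp add: c_def B_def)
  qed
  have "pivoted g (insert p I) (Suc k) (q p)"
    unfolding pivoted_def using rp one two by blast
  with that pI max show ?thesis unfolding q_def W_def by blast
qed

lemma pivoted_exists:
  fixes g :: "real^'n^'n"
  assumes g: "invertible g" and k: "k < CARD('n)"
  shows "\<exists>I r. card I = k \<and> pivoted g I k r"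
  using k
proof (induction k)
  case 0
  define r where "r = 1 + (\<Sum>l\<in>UNIV. norm (g *v axis l 1))"
  have "norm (g *v axis l 1) \<le> r" for l
    unfolding r_def using member_le_sum[of l UNIV "\<lambda>l. norm (g *v axis l 1)"] by simp
  moreover have "0 < r" unfolding r_def by (intro add_pos_nonneg sum_nonneg) auto
  ultimately have "pivoted g {} 0 r" by (simp add: pivoted_def coord_span_def)
  then show ?case by (intro exI[of _ "{}"] exI[of _ r]) simp
next
  case (Suc k)
  then obtain I r where I: "card I = k" "pivoted g I k r" by auto
  then have "I \<noteq> UNIV" using Suc.prems by auto
  from I(2) this g obtain p where "p \<notin> I" "pivoted g (insert p I) (Suc k) (quot_norm (coord_span I) g (axis p 1))"
    by (rule pivot_step)
  then show ?case using I(1) by (intro exI[of _ "insert p I"] exI) auto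
qed

text \<open>Two pivots p and q are added to \<open>j - 1\<close> earlier ones, at distances r1 and
  r2 from the span of the preceding columns. Up to constants r1 bounds
  \<open>singular_value j g\<close> below and r2 bounds \<open>singular_value (j + 1) g\<close>
  above. In the quotient the area is at least \<open>r1 * r2\<close>, while every direction of the
  plane has length at most \<open>6 * r1\<close>, so the estimate holds for all x in the
  annulus.\<close>

lemma flag_ratio_ge_singular_ratio:
  fixes g :: "real^'n^'n"
  assumes g: "invertible g" and j: "1 \<le> j" "j < CARD('n)"
  shows "\<exists>I p q. \<forall>x\<in>annulus. sqrt (pivot_const j / CARD('n)) / 6 * sqrt (singular_value (j + 1) g / singular_value j g)
    \<le> flag_ratio (coord_span I) (axis p 1) (axis q 1) g x"
proof -
  define d where "d = real CARD('n)"
  have d: "d > 0" by (simp add: d_def)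
  obtain I r where I: "card I = j - 1" "pivoted g I (j - 1) r"
  proof -
    have "j - 1 < CARD('n)" using j by simp
    from pivoted_exists[OF g this] show ?thesis using that by blast
  qed
  have IU: "I \<noteq> UNIV" using I(1) j by auto
  obtain p where p: "p \<notin> I"
    "\<And>l. quot_norm (coord_span I) g (axis l 1) \<le> quot_norm (coord_span I) g (axis p 1)"
    "pivoted g (insert p I) (Suc (j - 1)) (quot_norm (coord_span I) g (axis p 1))"
    by (rule pivot_step[OF I(2) IU g], rule that; assumption)
  define J where "J = insert p I"
  define r1 where "r1 = quot_norm (coord_span I) g (axis p 1)"
  have J: "card J = j" using I(1) p(1) j by (simp add: J_def)
  then have JU: "J \<noteq> UNIV" using j by auto
  have pivJ: "pivoted g J j r1" using p(3) j by (simp add: J_def r1_def)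
  obtain q where q: "q \<notin> J"
    "\<And>l. quot_norm (coord_span J) g (axis l 1) \<le> quot_norm (coord_span J) g (axis q 1)"
    "pivoted g (insert q J) (Suc j) (quot_norm (coord_span J) g (axis q 1))"
    by (rule pivot_step[OF pivJ JU g], rule that; assumption)
  define r2 where "r2 = quot_norm (coord_span J) g (axis q 1)"
  have r1: "r1 > 0" using pivJ by (simp add: pivoted_def)
  have r2: "r2 > 0" using q(3) by (simp add: pivoted_def r2_def)
  have c: "0 < pivot_const j" by (rule pivot_const_bounds)
  have sj: "pivot_const j * r1 \<le> singular_value j g"
  proof (rule singular_value_ge[OF j(1) subspace_coord_span])
    show "dim (coord_span J :: (real^'n) set) = j" by (simp add: dim_coord_span J)
    show "pivot_const j * r1 * norm v \<le> norm (g *v v)" if "v \<in> coord_span J" for v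
      using pivJ that by (simp add: pivoted_def)
  qed (use c r1 in simp)
  have sj1: "singular_value (j + 1) g \<le> d * r2"
  proof -
    \<comment> \<open>V consists of the vectors whose images are orthogonal to the image of
      \<open>coord_span J\<close>. Its codimension is at most j, and on it
      \<open>norm (g *v v)\<close> equals the quotient norm, which r2 controls column by
      column.\<close>
    define S where "S = (\<lambda>v. (transpose g ** g) *v v) ` coord_span J"
    define V where "V = {v \<in> UNIV. \<forall>s\<in>S. orthogonal s v}"
    have gram: "(g *v v) \<bullet> (g *v w) = v \<bullet> ((transpose g ** g) *v w)" for v w
      unfolding matrix_vector_mul_assoc[symmetric]
      by (metis dot_lmul_matrix transpose_matrix_vector transpose_transpose)
    have subS: "subspace S"
      unfolding S_def by (rule linear_subspace_image[OF matrix_vector_mul_linear subspace_coord_span])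
    have "dim S \<le> dim (coord_span J :: (real^'n) set)"
      unfolding S_def by (rule dim_image_le[OF matrix_vector_mul_linear])
    then have dimS: "dim S \<le> j" by (simp add: dim_coord_span J)
    have "dim V + dim S = dim (UNIV :: (real^'n) set)"
      unfolding V_def by (rule dim_subspace_orthogonal_to_vectors[OF subS subspace_UNIV]) simp
    then have dimV: "CARD('n) \<le> dim V + j" using dimS by simp
    have subV: "subspace V"
      unfolding V_def subspace_def by (auto simp: orthogonal_def inner_add_right)
    show ?thesis
    proof (rule singular_value_le[OF j(2) subV dimV])
      show "0 \<le> d * r2" using d r2 by simp
      fix v assume "v \<in> V"
      then have orth: "(g *v (v - 0)) \<bullet> (g *v w) = 0" if "w \<in> coord_span J" for w
        using that unfolding gram by (auto simp: V_def S_def orthogonal_def inner_commute)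
      have "norm (g *v v) = quot_norm (coord_span J) g v"
        using quot_norm_eqI[OF subspace_coord_span subspace_0[OF subspace_coord_span] orth] by simp
      also have "\<dots> \<le> d * r2 * norm v"
      proof (rule quot_norm_projection[OF subspace_coord_span, of J g])
        fix \<pi> :: "real^'n \<Rightarrow> real^'n" assume \<pi>: "linear \<pi>" "\<And>v. quot_norm (coord_span J) g v = norm (\<pi> v)"
        have "\<pi> v = \<pi> (\<Sum>l\<in>UNIV. v $ l *\<^sub>R axis l 1)"
          using basis_expansion[of v] by (simp add: scalar_mult_eq_scaleR)
        also have "\<dots> = (\<Sum>l\<in>UNIV. v $ l *\<^sub>R \<pi> (axis l 1))"
          by (simp add: linear_sum[OF \<pi>(1)] linear_scale[OF \<pi>(1)])
        finally have "norm (\<pi> v) \<le> (\<Sum>l\<in>UNIV. norm (v $ l *\<^sub>R \<pi> (axis l 1)))" by (simp only: norm_sum)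
        also have "\<dots> \<le> (\<Sum>l\<in>(UNIV :: 'n set). norm v * r2)"
          using q(2) unfolding \<pi>(2) r2_def
          by (intro sum_mono) (auto intro!: mult_mono simp: component_le_norm_cart)
        also have "\<dots> = d * r2 * norm v" by (simp add: d_def)
        finally show "quot_norm (coord_span J) g v \<le> d * r2 * norm v" by (simp add: \<pi>(2))
      qed
      finally show "norm (g *v v) \<le> d * r2 * norm v" .
    qed
  qed
  have s0: "0 < singular_value (j + 1) g" using singular_value_pos[OF g] j by simp
  have "singular_value (j + 1) g / singular_value j g \<le> (d * r2) / (pivot_const j * r1)"
    using sj sj1 s0 c r1 d r2 by (intro frac_le) auto
  then have "sqrt (pivot_const j / d) / 6 * sqrt (singular_value (j + 1) g / singular_value j g) \<le>
     sqrt (pivot_const j / d) / 6 * sqrt ((d * r2) / (pivot_const j * r1))"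
    using c d by (intro mult_left_mono) auto
  also have "\<dots> = sqrt (r2 / r1) / 6"
    using c d by (simp add: real_sqrt_mult[symmetric])
  finally have up: "sqrt (pivot_const j / d) / 6 * sqrt (singular_value (j + 1) g / singular_value j g) \<le> sqrt (r2 / r1) / 6" .
  have "sqrt (r2 / r1) / 6 \<le> flag_ratio (coord_span I) (axis p 1) (axis q 1) g x" if x: "x \<in> annulus" for x
  proof (rule quot_norm_projection[OF subspace_coord_span, of I g])
    fix \<pi> :: "real^'n \<Rightarrow> real^'n" assume \<pi>: "linear \<pi>" "\<And>v. quot_norm (coord_span I) g v = norm (\<pi> v)"
      "\<And>v. \<exists>u\<in>coord_span I. \<pi> v = g *v (v + u)"
    define a b where "a = \<pi> (axis p 1)" and "b = \<pi> (axis q 1)"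
    define y where "y = x$1 *\<^sub>R a + x$2 *\<^sub>R b"
    have na: "norm a = r1" and nb: "norm b \<le> r1"
      using p(2)[of q] by (simp_all add: a_def b_def r1_def \<pi>(2))
    have aa: "a \<bullet> a = r1\<^sup>2" using na by (simp add: power2_norm_eq_inner[symmetric])
    define area where "area = (a \<bullet> a) * (b \<bullet> b) - (a \<bullet> b)\<^sup>2"
    have area: "quot_area2 (coord_span I) (axis p 1) (axis q 1) g = area"
      unfolding quot_area2_projection[OF \<pi>(1,2)] area_def a_def b_def ..
    \<comment> \<open>Base times height: the base is r1, and the height is the distance from column
      q to the span of column p and those in I, hence at least r2.\<close>
    have area_ge: "(r1 * r2)\<^sup>2 \<le> area"
    proof -
      define \<beta> where "\<beta> = (a \<bullet> b) / r1\<^sup>2"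
      obtain u where u: "u \<in> coord_span I" "\<pi> (axis q 1 - \<beta> *\<^sub>R axis p 1) = g *v (axis q 1 - \<beta> *\<^sub>R axis p 1 + u)"
        using \<pi>(3) by blast
      have "r2 \<le> norm (g *v (axis q 1 + (u - \<beta> *\<^sub>R axis p 1)))"
        unfolding r2_def
      proof (rule quot_norm_le)
        have "(u - \<beta> *\<^sub>R axis p 1) - (- \<beta>) *\<^sub>R axis p 1 \<in> coord_span I" using u(1) by simp
        then show "u - \<beta> *\<^sub>R axis p 1 \<in> coord_span J" unfolding J_def coord_span_insert by blast
      qed
      also have "axis q 1 + (u - \<beta> *\<^sub>R axis p 1) = axis q 1 - \<beta> *\<^sub>R axis p 1 + u" by simp
      also have "norm (g *v (axis q 1 - \<beta> *\<^sub>R axis p 1 + u)) = norm (b - \<beta> *\<^sub>R a)"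
        unfolding u(2)[symmetric] by (simp add: linear_diff[OF \<pi>(1)] linear_scale[OF \<pi>(1)] a_def b_def)
      finally have "r2\<^sup>2 \<le> (norm (b - \<beta> *\<^sub>R a))\<^sup>2" using r2 by (intro power_mono) auto
      also have "\<dots> = b \<bullet> b - 2 * \<beta> * (a \<bullet> b) + \<beta>\<^sup>2 * (a \<bullet> a)"
        unfolding power2_norm_eq_inner
        by (simp add: inner_diff_left inner_diff_right inner_commute[of b a] power2_eq_square algebra_simps)
      finally have "r1\<^sup>2 * r2\<^sup>2 \<le> r1\<^sup>2 * (b \<bullet> b - 2 * \<beta> * (a \<bullet> b) + \<beta>\<^sup>2 * (a \<bullet> a))"
        by (intro mult_left_mono) auto
      also have "\<dots> = area"
        unfolding area_def aa \<beta>_def using r1 by (simp add: field_simps power2_eq_square)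
      finally show ?thesis by (simp add: power_mult_distrib)
    qed
    have area_pos: "area > 0" using area_ge r1 r2 by (smt (verit) mult_pos_pos zero_less_power)
    have x1: "1 \<le> norm x" "norm x \<le> exp 1" using x by (simp_all add: annulus_def)
    have y0: "y \<noteq> 0"
    proof
      assume y: "y = 0"
      have "(x$1)\<^sup>2 * area = (y \<bullet> y) * (b \<bullet> b) - (y \<bullet> b)\<^sup>2"
        "(x$2)\<^sup>2 * area = (y \<bullet> y) * (a \<bullet> a) - (y \<bullet> a)\<^sup>2"
        unfolding area_def y_def
        by (simp_all add: inner_add_left inner_add_right inner_commute[of b a] power2_eq_square algebra_simps)
      then have "x$1 = 0" "x$2 = 0" using y area_pos by simp_all
      then have "x = 0" by (simp add: vec_eq_iff forall_2)
      then show False using x1 by simp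
    qed
    have "norm y \<le> \<bar>x$1\<bar> * norm a + \<bar>x$2\<bar> * norm b"
      unfolding y_def using norm_triangle_ineq[of "x$1 *\<^sub>R a" "x$2 *\<^sub>R b"] by simp
    also have "\<dots> \<le> exp 1 * r1 + exp 1 * r1"
      using component_le_norm_cart[of x 1] component_le_norm_cart[of x 2] x1 na nb r1
      by (intro add_mono mult_mono) auto
    \<comment> \<open>Two terms, each at most \<open>exp 1 * r1\<close>, with \<open>exp 1\<close>
      at most 3.\<close>
    also have "\<dots> \<le> 6 * r1" using exp_le r1 by simp
    finally have ny: "norm y \<le> 6 * r1" .
    have "sqrt (r2 / r1) / 6 = sqrt (r1 * r2) / (6 * r1)"
      using r1 by (simp add: real_sqrt_divide real_sqrt_mult field_simps)
    also have "\<dots> \<le> sqrt (sqrt area) / norm y"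
    proof (rule frac_le)
      have "r1 * r2 \<le> sqrt area" using area_ge by (rule real_le_rsqrt)
      then show "sqrt (r1 * r2) \<le> sqrt (sqrt area)" by simp
    qed (use ny y0 area_pos in auto)
    also have "\<dots> = flag_ratio (coord_span I) (axis p 1) (axis q 1) g x"
      unfolding flag_ratio_def area \<pi>(2) y_def a_def b_def
      by (simp add: linear_add[OF \<pi>(1)] linear_scale[OF \<pi>(1)])
    finally show ?thesis .
  qed
  then show ?thesis using up unfolding d_def by (meson order_trans)
qed

subsection \<open>Growth of the gaps\<close>

lemma poly_charpoly: "poly (charpoly M) s = det (s *\<^sub>R mat 1 - M)"
proof -
  have i: "poly (of_int z) s = of_int z" for z :: int
    by (metis of_int_poly poly_pCons poly_0 mult_zero_right add_0_right)
  have e: "poly ((if i = j then [:0, 1:] else 0) - [:M $ i $ j:]) s = (s *\<^sub>R mat 1 - M) $ i $ j" for i j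
    by (simp add: mat_def)
  show ?thesis
    unfolding charpoly_def det_def poly_sum poly_mult poly_prod vec_lambda_beta e i ..
qed

text \<open>At a point beyond a bound for the operator norm the shifted matrix is injective, so the
  value of the polynomial there is not 0.\<close>

lemma charpoly_nonzero: "charpoly (M :: real^'n^'n) \<noteq> 0"
proof
  assume z: "charpoly M = 0"
  obtain B where B: "B > 0" "\<And>v. norm (M *v v) \<le> B * norm v"
    using linear_bounded_pos[OF matrix_vector_mul_linear[of M]] by blast
  have "inj ((*v) ((B + 1) *\<^sub>R mat 1 - M))"
  proof (rule linear_injective_0[OF matrix_vector_mul_linear, THEN iffD2], intro allI impI)
    fix v assume "((B + 1) *\<^sub>R mat 1 - M) *v v = 0"
    then have "M *v v = (B + 1) *\<^sub>R v"
      by (simp add: matrix_vector_mult_diff_rdistrib scaleR_matrix_vector_assoc[symmetric])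
    then have "(B + 1) * norm v \<le> B * norm v" using B(2)[of v] B(1) by simp
    then show "v = 0" by (simp add: algebra_simps)
  qed
  then have "det ((B + 1) *\<^sub>R mat 1 - M) \<noteq> 0"
    by (simp add: invertible_det_nz[symmetric] invertible_left_inverse matrix_left_invertible_injective)
  then show False using z poly_charpoly[of M "B + 1"] by simp
qed

lemma continuous_on_det: "continuous_on UNIV (det :: real^'n^'n \<Rightarrow> real)"
  unfolding det_def by (intro continuous_intros)

text \<open>Along each line in the direction of the identity matrix the determinant has finitely many
  zeros.\<close>

lemma AE_perturbed_det_nonzero:
  fixes A :: "real^'n^'n"
  assumes e: "\<epsilon> \<noteq> 0"
  shows "AE \<xi> in lborel. det (A + \<epsilon> *\<^sub>R \<xi>) \<noteq> 0"
proof -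
  define Z where "Z = {\<xi> :: real^'n^'n. det (A + \<epsilon> *\<^sub>R \<xi>) = 0}"
  have "continuous_on UNIV (\<lambda>\<xi>. det (A + \<epsilon> *\<^sub>R \<xi>))"
    by (rule continuous_on_compose2[OF continuous_on_det]) (auto intro!: continuous_intros)
  then have "closed Z" unfolding Z_def by (intro closed_Collect_eq continuous_on_const)
  then have [measurable]: "Z \<in> sets borel" by (rule borel_closed)
  have fin: "finite {t. t *\<^sub>R mat 1 + \<xi> \<in> Z}" for \<xi>
  proof -
    define M where "M = - (A + \<epsilon> *\<^sub>R \<xi>)"
    have "finite {s. poly (charpoly M) s = 0}" by (rule poly_roots_finite[OF charpoly_nonzero])
    then have "finite ((\<lambda>s. s / \<epsilon>) ` {s. poly (charpoly M) s = 0})" by (rule finite_imageI)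
    moreover have "t \<in> (\<lambda>s. s / \<epsilon>) ` {s. poly (charpoly M) s = 0}" if "t *\<^sub>R mat 1 + \<xi> \<in> Z" for t
    proof (rule image_eqI)
      show "t = (\<epsilon> * t) / \<epsilon>" using e by simp
      show "\<epsilon> * t \<in> {s. poly (charpoly M) s = 0}"
        using that by (simp add: poly_charpoly M_def Z_def scaleR_add_right algebra_simps)
    qed
    then have "{t. t *\<^sub>R mat 1 + \<xi> \<in> Z} \<subseteq> (\<lambda>s. s / \<epsilon>) ` {s. poly (charpoly M) s = 0}" by blast
    ultimately show ?thesis by (rule rev_finite_subset)
  qed
  \<comment> \<open>The measure of \<open>Z\<close> is averaged over translates by
    \<open>t *\<^sub>R mat 1\<close> with t in the unit interval. After Fubini the inner integral
    runs over a finite set of t.\<close>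
  have "emeasure lborel Z = (\<integral>\<^sup>+t. indicator {0..1::real} t * (\<integral>\<^sup>+\<xi>. indicator Z \<xi> \<partial>lborel) \<partial>lborel)"
    by (simp add: nn_integral_multc)
  also have "\<dots> = (\<integral>\<^sup>+t. (\<integral>\<^sup>+\<xi>. indicator {0..1::real} t * indicator Z (t *\<^sub>R mat 1 + \<xi>) \<partial>lborel) \<partial>lborel)"
  proof (rule nn_integral_cong)
    fix t :: real
    have "(\<integral>\<^sup>+\<xi>. indicator Z (t *\<^sub>R mat 1 + \<xi>) \<partial>lborel) = (\<integral>\<^sup>+\<xi>. indicator Z \<xi> \<partial>lborel)"
      by (rule nn_integral_lborel_translate) measurable
    then show "indicator {0..1::real} t * (\<integral>\<^sup>+\<xi>. indicator Z \<xi> \<partial>lborel) =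
      (\<integral>\<^sup>+\<xi>. indicator {0..1::real} t * indicator Z (t *\<^sub>R mat 1 + \<xi>) \<partial>lborel)"
      by (subst nn_integral_cmult) auto
  qed
  also have "\<dots> = (\<integral>\<^sup>+\<xi>. (\<integral>\<^sup>+t. indicator {0..1::real} t * indicator Z (t *\<^sub>R mat 1 + \<xi>) \<partial>lborel) \<partial>lborel)"
    by (rule lborel_pair.Fubini') measurable
  also have "\<dots> = (\<integral>\<^sup>+(\<xi> :: real^'n^'n). 0 \<partial>lborel)"
  proof (rule nn_integral_cong)
    fix \<xi> :: "real^'n^'n"
    have "emeasure lborel {t. t *\<^sub>R mat 1 + \<xi> \<in> Z} = 0"
      by (rule emeasure_lborel_countable) (rule countable_finite[OF fin])
    then have "{t. t *\<^sub>R mat 1 + \<xi> \<in> Z} \<in> null_sets lborel"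
      using fin[of \<xi>] by (auto simp: null_sets_def finite_imp_closed borel_closed)
    then have "AE t in lborel. t *\<^sub>R mat 1 + \<xi> \<notin> Z"
      using AE_not_in by fastforce
    then have "(\<integral>\<^sup>+t. indicator {0..1::real} t * indicator Z (t *\<^sub>R mat 1 + \<xi>) \<partial>lborel) = (\<integral>\<^sup>+(t::real). 0 \<partial>lborel)"
      by (intro nn_integral_cong_AE) (auto elim!: eventually_mono)
    then show "(\<integral>\<^sup>+t. indicator {0..1::real} t * indicator Z (t *\<^sub>R mat 1 + \<xi>) \<partial>lborel) = 0" by simp
  qed
  finally have "Z \<in> null_sets lborel" by (auto simp: null_sets_def)
  then have "AE \<xi> in lborel. \<xi> \<notin> Z" by (rule AE_not_in)
  then show ?thesis by (simp add: Z_def)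
qed

text \<open>Invertibility makes all singular values positive, so that the ratios and logarithms are
  genuine, and column pivoting relies on it.\<close>

lemma AE_perturbed_product_invertible:
  fixes \<Xi> :: "nat \<Rightarrow> 'w \<Rightarrow> real^'n^'n"
  assumes noise: "uniform_noise M \<Xi>" and e: "\<epsilon> \<noteq> 0"
  shows "AE \<omega> in M. \<forall>n. invertible (perturbed_product \<epsilon> A (\<lambda>k. \<Xi> k \<omega>) n)"
proof -
  have "AE \<omega> in M. \<forall>n. det (A (Suc n) + \<epsilon> *\<^sub>R \<Xi> (Suc n) \<omega>) \<noteq> 0"
  proof (subst AE_all_countable, rule allI)
    fix n
    have [measurable]: "\<Xi> (Suc n) \<in> borel_measurable M"
      using noise by (auto simp: uniform_noise_def prob_space.indep_vars_def)
    have "AE \<xi> in uniform_measure lborel (cube 1). det (A (Suc n) + \<epsilon> *\<^sub>R \<xi>) \<noteq> 0"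
      using AE_perturbed_det_nonzero[OF e, of "A (Suc n)"] by (intro AE_uniform_measureI) (auto elim!: eventually_mono)
    then have "AE \<xi> in distr M borel (\<Xi> (Suc n)). det (A (Suc n) + \<epsilon> *\<^sub>R \<xi>) \<noteq> 0"
      by (subst uniform_noise_distr[OF noise]) simp_all
    then show "AE \<omega> in M. det (A (Suc n) + \<epsilon> *\<^sub>R \<Xi> (Suc n) \<omega>) \<noteq> 0"
      by (rule AE_distrD[rotated]) measurable
  qed
  then show ?thesis
  proof eventually_elim
    case (elim \<omega>)
    have "det (perturbed_product \<epsilon> A (\<lambda>k. \<Xi> k \<omega>) n) \<noteq> 0" for n
      by (induction n) (use elim in \<open>auto simp: det_mul\<close>)
    then show ?case by (simp add: invertible_det_nz)
  qed
qed

lemma annulus_measure_pos: "0 < measure lborel annulus"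
proof -
  define c :: "real^2" where "c = (3/2) *\<^sub>R axis 1 1"
  have c: "norm c = 3/2" by (simp add: c_def)
  have "ball c (1/2) \<subseteq> annulus"
  proof
    fix x assume "x \<in> ball c (1/2)"
    then have "norm (x - c) < 1/2" by (simp add: dist_norm norm_minus_commute)
    moreover have "\<bar>norm x - norm c\<bar> \<le> norm (x - c)" by (rule norm_triangle_ineq3)
    moreover have "2 \<le> exp (1::real)" using exp_ge_add_one_self[of "1::real"] by simp
    ultimately show "x \<in> annulus" unfolding c by (simp add: annulus_def abs_le_iff abs_less_iff)
  qed
  then have "measure lborel (ball c (1/2)) \<le> measure lborel annulus"
    using annulus_finite by (intro measure_mono_fmeasurable) (auto simp: fmeasurable_def)
  moreover have "0 < measure lborel (ball c (1/2))" by (rule content_ball_pos) simp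
  ultimately show ?thesis by linarith
qed

lemma liminf_log_ratio_ge:
  fixes a b :: "nat \<Rightarrow> real"
  assumes pos: "\<And>n. 0 < a n" "\<And>n. 0 < b n" and D: "0 \<le> D" and r: "0 < r" "r < 1"
    and le: "\<And>n. sqrt (b n / a n) \<le> D * sqrt (1 - r) ^ n"
  shows "ereal r \<le> liminf (\<lambda>n. ereal (1 / real n * ln (a n / b n)))"
proof -
  \<comment> \<open>\<open>D\<close> may be 0; with \<open>D + 1\<close> the logarithm of
    \<open>E\<close> is meaningful, and after division by n it disappears in the limit.\<close>
  define E where "E = (D + 1)\<^sup>2"
  have E: "E > 0" using D by (simp add: E_def)
  have bound: "- ln (1 - r) - ln E * (1 / real n) \<le> 1 / real n * ln (a n / b n)" if n: "n \<ge> 1" for n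
  proof -
    have "D * sqrt (1 - r) ^ n \<le> (D + 1) * sqrt (1 - r) ^ n" using r by (intro mult_right_mono) auto
    with le[of n] have "sqrt (b n / a n) \<le> (D + 1) * sqrt (1 - r) ^ n" by (rule order_trans)
    then have "(sqrt (b n / a n))\<^sup>2 \<le> ((D + 1) * sqrt (1 - r) ^ n)\<^sup>2"
      using pos[of n] by (intro power_mono) (auto intro: less_imp_le)
    also have "\<dots> = E * (1 - r) ^ n"
      using r by (simp add: E_def power_mult_distrib power_even_eq[symmetric] power_mult[symmetric] mult.commute[of n 2])
         (simp add: power_mult)
    finally have "b n / a n \<le> E * (1 - r) ^ n" using pos[of n] by (simp add: less_imp_le)
    then have "ln (b n / a n) \<le> ln (E * (1 - r) ^ n)" using pos[of n] E r by (subst ln_le_cancel_iff) auto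
    also have "\<dots> = ln E + real n * ln (1 - r)" using E r by (simp add: ln_mult ln_realpow)
    finally have "- ln E - real n * ln (1 - r) \<le> ln (a n / b n)"
      using pos[of n] by (simp add: ln_div)
    then have "1 / real n * (- ln E - real n * ln (1 - r)) \<le> 1 / real n * ln (a n / b n)"
      by (intro mult_left_mono) auto
    then show ?thesis using n by (simp add: field_simps)
  qed
  have "(\<lambda>n. - ln (1 - r) - ln E * (1 / real n)) \<longlonglongrightarrow> - ln (1 - r) - ln E * 0"
    by (intro tendsto_intros lim_1_over_n)
  then have "(\<lambda>n. ereal (- ln (1 - r) - ln E * (1 / real n))) \<longlonglongrightarrow> ereal (- ln (1 - r))" by simp
  then have "ereal (- ln (1 - r)) = liminf (\<lambda>n. ereal (- ln (1 - r) - ln E * (1 / real n)))"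
    by (intro lim_imp_Liminf[symmetric]) simp_all
  also have "\<dots> \<le> liminf (\<lambda>n. ereal (1 / real n * ln (a n / b n)))"
    using bound by (intro Liminf_mono) (auto simp: eventually_sequentially intro!: exI[of _ 1])
  finally have "ereal (- ln (1 - r)) \<le> liminf (\<lambda>n. ereal (1 / real n * ln (a n / b n)))" .
  moreover have "ln (1 - r) \<le> - r" using ln_le_minus_one[of "1 - r"] r by simp
  then have "ereal r \<le> ereal (- ln (1 - r))" by simp
  ultimately show ?thesis by (rule order_trans[rotated])
qed

text \<open>The coordinate flag supplied by pivoting varies with n and \<omega>, but there are only
  finitely many triples of an index set and two indices. The almost sure decay thus holds for all of
  them simultaneously.\<close>

lemma AE_singular_ratio_decay:
  fixes \<Xi> :: "nat \<Rightarrow> 'w \<Rightarrow> real^'n^'n"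
  assumes d: "1 < CARD('n)" and noise: "uniform_noise M \<Xi>" and e: "0 < \<epsilon>" "\<epsilon> < 1"
    and A: "\<And>n. 1 \<le> n \<Longrightarrow> orthogonal_matrix (A n)" and j: "1 \<le> j" "j < CARD('n)"
  shows "AE \<omega> in M. liminf (\<lambda>n. ereal (1 / real n *
            ln (singular_value j (perturbed_product \<epsilon> A (\<lambda>k. \<Xi> k \<omega>) n) /
                singular_value (j + 1) (perturbed_product \<epsilon> A (\<lambda>k. \<Xi> k \<omega>) n)))) \<ge> ereal (rate CARD('n) \<epsilon>)"
proof -
  define \<rho> where "\<rho> = sqrt (1 - rate CARD('n) \<epsilon>)"
  define R where "R n \<omega> = perturbed_product \<epsilon> A (\<lambda>k. \<Xi> k \<omega>) n" for n \<omega>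
  define Y where "Y t n \<omega> = (\<integral>\<^sup>+x. flag_cost (coord_span (fst t)) (axis (fst (snd t)) 1) (axis (snd (snd t)) 1) (R n \<omega>) x
      * indicator annulus x \<partial>lborel)" for t :: "'n set \<times> 'n \<times> 'n" and n \<omega>
  define V where "V = measure lborel annulus"
  have V: "emeasure lborel annulus = ennreal V" "V > 0"
    unfolding V_def using annulus_finite annulus_measure_pos by (auto intro!: emeasure_eq_ennreal_measure)
  define c where "c = sqrt (pivot_const j / CARD('n)) / 6"
  have c: "c > 0" using pivot_const_bounds(1)[of j] by (simp add: c_def)
  have \<rho>: "0 < \<rho>" using rate_bounds[OF e, of "CARD('n)"] by (simp add: \<rho>_def)
  have "AE \<omega> in M. \<forall>t\<in>UNIV. \<exists>C\<ge>0. \<forall>n. Y t n \<omega> \<le> ennreal (C * \<rho> ^ n)"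
    unfolding Y_def R_def \<rho>_def
    by (intro AE_finite_allI finite AE_annulus_flag_cost_decay[OF d noise e A subspace_coord_span])
  moreover have "AE \<omega> in M. \<forall>n. invertible (R n \<omega>)"
    unfolding R_def using e by (intro AE_perturbed_product_invertible[OF noise]) simp
  ultimately show ?thesis
  proof eventually_elim
    case (elim \<omega>)
    have inv: "invertible (R n \<omega>)" for n using elim(2) by simp
    from elim(1) have "\<forall>t. \<exists>C. 0 \<le> C \<and> (\<forall>n. Y t n \<omega> \<le> ennreal (C * \<rho> ^ n))" by blast
    then have "\<exists>C. \<forall>t. 0 \<le> C t \<and> (\<forall>n. Y t n \<omega> \<le> ennreal (C t * \<rho> ^ n))" by (rule choice)
    then obtain C where C': "\<forall>t. 0 \<le> C t \<and> (\<forall>n. Y t n \<omega> \<le> ennreal (C t * \<rho> ^ n))" ..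
    then have C: "0 \<le> C t" "Y t n \<omega> \<le> ennreal (C t * \<rho> ^ n)" for t n
      using C'[THEN spec, of t] by blast+
    \<comment> \<open>Summing the constants over all triples makes \<open>D\<close> independent of
      n, whichever triple the pivoting selects.\<close>
    define D where "D = (\<Sum>t\<in>UNIV. C t) / (c * V)"
    have D: "0 \<le> D" unfolding D_def using C(1) c V(2) by (intro divide_nonneg_nonneg sum_nonneg) auto
    have pos: "0 < singular_value j (R n \<omega>)" "0 < singular_value (j + 1) (R n \<omega>)" for n
      using singular_value_pos[OF inv] j by auto
    have le: "sqrt (singular_value (j + 1) (R n \<omega>) / singular_value j (R n \<omega>)) \<le> D * \<rho> ^ n" for n
    proof -
      define s where "s = sqrt (singular_value (j + 1) (R n \<omega>) / singular_value j (R n \<omega>))"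
      have s: "0 \<le> s" unfolding s_def using pos[of n] by simp
      obtain I p q where Ipq: "\<forall>x\<in>annulus. c * s \<le> flag_ratio (coord_span I) (axis p 1) (axis q 1) (R n \<omega>) x"
        using flag_ratio_ge_singular_ratio[OF inv j] unfolding c_def s_def by blast
      have "ennreal (c * s * V) = (\<integral>\<^sup>+x. ennreal (c * s) * indicator annulus x \<partial>lborel)"
        using c s V by (simp add: nn_integral_cmult ennreal_mult)
      also have "\<dots> \<le> Y (I, p, q) n \<omega>"
        unfolding Y_def flag_cost_def using Ipq
        by (intro nn_integral_mono) (auto simp: indicator_def intro: ennreal_leI)
      also have "\<dots> \<le> ennreal (C (I, p, q) * \<rho> ^ n)" by (rule C(2))
      finally have "c * s * V \<le> C (I, p, q) * \<rho> ^ n"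
        using C(1) \<rho> by (subst (asm) ennreal_le_iff) auto
      also have "\<dots> \<le> (\<Sum>t\<in>UNIV. C t) * \<rho> ^ n"
        using C(1) \<rho> by (intro mult_right_mono member_le_sum) auto
      finally have "s \<le> D * \<rho> ^ n" unfolding D_def using c V(2) by (simp add: field_simps)
      then show ?thesis by (simp add: s_def)
    qed
    show ?case
      unfolding R_def[symmetric]
      by (rule liminf_log_ratio_ge[OF pos D rate_bounds[OF e] le[unfolded \<rho>_def]])
  qed
qed

text \<open>The rate is K times the square of \<epsilon>. Since \<open>exp (- y) < 1 / y\<close>,
  the right hand side is below the power \<open>2 + \<delta>\<close> of \<epsilon>, and the surplus
  \<open>\<epsilon> powr \<delta>\<close> drops below K once \<epsilon> is less than
  \<open>K powr (1 / \<delta>)\<close>.\<close>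

lemma rate_eventually_gt:
  assumes "\<delta> > 0"
  shows "\<forall>\<^sub>F \<epsilon> in at_right 0. rate d \<epsilon> > exp (- (1 / \<epsilon> powr (2 + \<delta>)))"
proof -
  define K where "K = (1/2) ^ (d * d) * (1 / (4 * (real d + 1)))\<^sup>2 / 32"
  have K: "K > 0" unfolding K_def by (intro divide_pos_pos mult_pos_pos zero_less_power) (auto intro: add_nonneg_pos)
  have "\<forall>\<^sub>F \<epsilon> in at_right 0. \<epsilon> \<in> {0<..<K powr (1 / \<delta>)}"
    using K by (intro eventually_at_right_real) simp
  then show ?thesis
  proof eventually_elim
    case (elim \<epsilon>)
    then have e: "0 < \<epsilon>" "\<epsilon> < K powr (1 / \<delta>)" by auto
    define y where "y = 1 / \<epsilon> powr (2 + \<delta>)"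
    have y: "y > 0" using e by (simp add: y_def)
    have "exp (- y) < 1 / y"
    proof -
      have "y < exp y" using exp_ge_add_one_self[of y] by linarith
      then show ?thesis using y by (simp add: exp_minus field_simps)
    qed
    also have "1 / y = \<epsilon>\<^sup>2 * \<epsilon> powr \<delta>" using e by (simp add: y_def powr_add)
    also have "\<epsilon>\<^sup>2 * \<epsilon> powr \<delta> \<le> \<epsilon>\<^sup>2 * K"
    proof (intro mult_left_mono)
      have "\<epsilon> powr \<delta> \<le> (K powr (1 / \<delta>)) powr \<delta>" using e assms by (intro powr_mono2) auto
      also have "\<dots> = K" using K assms by (simp add: powr_powr)
      finally show "\<epsilon> powr \<delta> \<le> K" .
    qed simp
    also have "\<epsilon>\<^sup>2 * K = rate d \<epsilon>" by (simp add: rate_def K_def power_divide)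
    finally show ?case by (simp add: y_def)
  qed
qed

theorem theorem4:
  assumes "CARD('n::finite) > 1"
  shows "\<exists>c :: real \<Rightarrow> real.
    (\<forall>\<epsilon>. 0 < \<epsilon> \<and> \<epsilon> < 1 \<longrightarrow> 0 < c \<epsilon>) \<and>
    (\<forall>(M :: 'w measure) (\<Xi> :: nat \<Rightarrow> 'w \<Rightarrow> real^'n^'n) \<epsilon> (A :: nat \<Rightarrow> real^'n^'n) j.
       uniform_noise M \<Xi> \<and> 0 < \<epsilon> \<and> \<epsilon> < 1 \<and> (\<forall>n\<ge>1. orthogonal_matrix (A n)) \<and>
       1 \<le> j \<and> j < CARD('n) \<longrightarrow>
       (AE \<omega> in M.
          liminf (\<lambda>n. ereal (1 / real n *
            ln (singular_value j (perturbed_product \<epsilon> A (\<lambda>k. \<Xi> k \<omega>) n) /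
                singular_value (j + 1) (perturbed_product \<epsilon> A (\<lambda>k. \<Xi> k \<omega>) n))))
          \<ge> ereal (c \<epsilon>))) \<and>
    (\<forall>\<delta>>0. \<forall>\<^sub>F \<epsilon> in at_right 0. c \<epsilon> > exp (- (1 / \<epsilon> powr (2 + \<delta>))))"
proof (intro exI[of _ "rate CARD('n)"] conjI allI impI)
  show "0 < rate CARD('n) \<epsilon>" if "0 < \<epsilon> \<and> \<epsilon> < 1" for \<epsilon>
    using that by (intro rate_bounds) auto
next
  fix M :: "'w measure" and \<Xi> :: "nat \<Rightarrow> 'w \<Rightarrow> real^'n^'n" and \<epsilon> :: real and A :: "nat \<Rightarrow> real^'n^'n" and j
  assume "uniform_noise M \<Xi> \<and> 0 < \<epsilon> \<and> \<epsilon> < 1 \<and> (\<forall>n\<ge>1. orthogonal_matrix (A n)) \<and> 1 \<le> j \<and> j < CARD('n)"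
  then show "AE \<omega> in M. liminf (\<lambda>n. ereal (1 / real n *
            ln (singular_value j (perturbed_product \<epsilon> A (\<lambda>k. \<Xi> k \<omega>) n) /
                singular_value (j + 1) (perturbed_product \<epsilon> A (\<lambda>k. \<Xi> k \<omega>) n)))) \<ge> ereal (rate CARD('n) \<epsilon>)"
    by (intro AE_singular_ratio_decay[OF assms]) auto
next
  show "\<forall>\<^sub>F \<epsilon> in at_right 0. rate CARD('n) \<epsilon> > exp (- (1 / \<epsilon> powr (2 + \<delta>)))" if "\<delta> > 0" for \<delta>
    using that by (rule rate_eventually_gt)
qed

end
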